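(* Let $H$ and $\mathscr{H}$ be real Hilbert spaces, $E$ a real Banach space, $0<T<\infty$, and write $L^2(H):=L^2(0,T;H)$. Assume that $L^2(H)$ is continuously and densely included in $\mathscr{H}$, and let $W$ be an $\mathscr{H}$-isonormal process. Let $A$ generate a $C_0$-semigroup $(S(t))_{t\ge 0}$ on $E$ and let $B\in\mathscr{L}(H,E)$. Suppose that the function $\Phi:=S(T-\cdot)B:(0,T)\to\mathscr{L}(H,E)$ is stochastically integrable with respect to $W$, and let $\mathscr{G}_T$ be the reproducing kernel Hilbert space associated with the centred Gaussian random variable $\int_0^T S(T-t)B\,dW(t)$. Then the following assertions are equivalent: (i) $S(T)E\subseteq \mathscr{G}_T$; (ii) for all $x_0\in E$ the problem $x'=Ax+Bf$, $x(0)=x_0$, is null controllable in time $T$ with a control $f\in\mathscr{H}^\star$, i.e. for every $x_0\in E$ there is $f\in \mathscr{H}^\star$ such that the mild solution satisfies $x(T)=S(T)x_0+\int_0^TS(T-t)Bf(t)\,dt=0$; (iii) the laws on $E$, for $x_0$ ranging over $E$, of the mild solutions at time $T$, $X^{x_0}(T)=S(T)x_0+\int_0^T S(T-t)B\,dW(t)$, of the stochastic evolution equation $dX(t)=AX(t)\,dt+B\,dW$, $X(0)=x_0$, are mutually equivalent (mutually absolutely continuous).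
   Context: An $\mathscr{H}$-isonormal process on a probability space $(\Omega,\mathscr{F},\mathbb{P})$ is a bounded linear map $W:\mathscr{H}\to L^2(\Omega)$ such that each $W(h)$ is centred Gaussian and $\mathbb{E}\,W(h_1)W(h_2)=[h_1,h_2]_{\mathscr{H}}$ for all $h_1,h_2\in\mathscr{H}$. $\gamma(\mathscr{H},E)$ (the $\gamma$-radonifying operators) is the completion of $\mathscr{H}\otimes E$ with respect to the norm $\|\sum_{n=1}^N h_n\otimes x_n\|^2_{\gamma(\mathscr{H},E)}=\mathbb{E}\|\sum_{n=1}^N\gamma_n x_n\|^2$, where $(h_n)_{n=1}^N$ is orthonormal in $\mathscr{H}$, $x_n\in E$, and $(\gamma_n)$ are independent standard real Gaussians; it is identified with a subspace of $\mathscr{L}(\mathscr{H},E)$. The map $W$ extends to an isometry $W:\gamma(\mathscr{H},E)\to L^2(\Omega;E)$ with $W(h\otimes x)=W(h)\otimes x$, and $\langle W(R),x^*\rangle=W(R^*x^* )$. $\Phi^*(t)=(\Phi(t))^*:E^*\to H$ denotes the adjoint of $\Phi(t):H\to E$ via the Riesz identification of $H$ with its dual. It is a standing assumption that the orbits $\Phi^*x^*:t\mapsto\Phi^*(t)x^*$ belong to $L^2(H)$ for all $x^*\in E^*$; hence they define elements of $\mathscr{H}$. $\Phi$ is called stochastically integrable with respect to $W$ if there exists $R_\Phi\in\gamma(\mathscr{H},E)$ such that $R_\Phi^*x^*=\Phi^*x^*$ (as elements of $\mathscr{H}$) for all $x^*\in E^*$, where $R_\Phi^*:E^*\to\mathscr{H}$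 is the adjoint via the Riesz identification of $\mathscr{H}$ with its dual. Then $\int_0^T\Phi\,dW:=W(R_\Phi)$. $\mathscr{H}^\star$ denotes the dual of $\mathscr{H}$ relative to the $L^2(H)$-duality, so that $\mathscr{H}^\star\hookrightarrow L^2(H)\hookrightarrow\mathscr{H}$ continuously and densely. Concretely, $\mathscr{H}^\star$ is identified with the space of those $f\in L^2(H)$ for which $h\mapsto\int_0^T[h(t),f(t)]_H\,dt$, $h\in L^2(H)$, extends to a bounded functional on $\mathscr{H}$. The reproducing kernel Hilbert space associated with a centred Gaussian $E$-valued random variable with covariance operator $Q\in\mathscr{L}(E^*,E)$ is the completion of $\{Qx^*:x^*\in E^*\}$ with respect to the inner product $[Qx^*,Qy^*]=\langle Qx^*,y^*\rangle$, viewed as a subspace of $E$ by continuous extension of the inclusion map. *)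

theory Defs
  imports "HOL-Probability.Probability"
begin

section \<open>Functions with values in a possibly non-separable Banach space\<close>

text \<open>
  The library's Bochner integral is restricted to second-countable target types. Here neither
  \<open>H\<close> nor \<open>E\<close> is assumed to be separable, so that strong measurability (pointwise limit of simple
  functions) has to replace Borel measurability; apart from that,
  \<open>has_strong_integral\<close> repeats the definition of \<^const>\<open>has_bochner_integral\<close>.
\<close>

definition strongly_measurable :: "'a measure \<Rightarrow> ('a \<Rightarrow> 'b::real_normed_vector) \<Rightarrow> bool" where
  "strongly_measurable M f \<longleftrightarrow>
     (\<exists>s. (\<forall>i. simple_function M (s i)) \<and> (\<forall>x\<in>space M. (\<lambda>i::nat. s i x) \<longlonglongrightarrow> f x))"

definition has_strong_integral ::
    "'a measure \<Rightarrow> ('a \<Rightarrow> 'b::real_normed_vector) \<Rightarrow> 'b \<Rightarrow> bool" where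
  "has_strong_integral M f I \<longleftrightarrow> strongly_measurable M f \<and>
     (\<exists>s. (\<forall>i. Bochner_Integration.simple_bochner_integrable M (s i)) \<and>
          (\<lambda>i::nat. \<integral>\<^sup>+x. ennreal (norm (f x - s i x)) \<partial>M) \<longlonglongrightarrow> 0 \<and>
          (\<lambda>i. Bochner_Integration.simple_bochner_integral M (s i)) \<longlonglongrightarrow> I)"

definition square_integrable :: "'a measure \<Rightarrow> ('a \<Rightarrow> 'b::real_normed_vector) \<Rightarrow> bool" where
  "square_integrable M f \<longleftrightarrow> strongly_measurable M f \<and> integrable M (\<lambda>x. (norm (f x))\<^sup>2)"

text \<open>Representatives of elements of \<open>L\<^sup>2(0,T;H)\<close>; values outside \<open>(0,T)\<close> are irrelevant.\<close>

definition L2 :: "real \<Rightarrow> (real \<Rightarrow> 'h::real_inner) set" where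
  "L2 T = {f. square_integrable (lebesgue_on {0<..<T}) f}"

definition L2_norm :: "real \<Rightarrow> (real \<Rightarrow> 'h::real_inner) \<Rightarrow> real" where
  "L2_norm T f = sqrt (\<integral>t. (norm (f t))\<^sup>2 \<partial>lebesgue_on {0<..<T})"

text \<open>
  \<open>j\<close> is a continuous linear injection with dense range of \<open>L\<^sup>2(0,T;H)\<close> into the Hilbert space \<open>'k\<close>.
  It acts on representatives; the first conjunct says both that it is well defined on
  almost-everywhere classes and that it is injective on them.
\<close>

definition L2_dense_inclusion ::
    "real \<Rightarrow> ((real \<Rightarrow> 'h::real_inner) \<Rightarrow> 'k::real_inner) \<Rightarrow> bool" where
  "L2_dense_inclusion T j \<longleftrightarrow>
     (\<forall>f\<in>L2 T. \<forall>g\<in>L2 T. j f = j g \<longleftrightarrow> (AE t in lebesgue_on {0<..<T}. f t = g t)) \<and>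
     (\<forall>f\<in>L2 T. \<forall>g\<in>L2 T. j (\<lambda>t. f t + g t) = j f + j g) \<and>
     (\<forall>f\<in>L2 T. \<forall>c. j (\<lambda>t. c *\<^sub>R f t) = c *\<^sub>R j f) \<and>
     (\<exists>C. \<forall>f\<in>L2 T. norm (j f) \<le> C * L2_norm T f) \<and>
     closure (j ` L2 T) = UNIV"

text \<open>The dual \<open>\<H>\<^sup>\<star>\<close> of the Hilbert space \<open>'k\<close> relative to the \<open>L\<^sup>2(0,T;H)\<close>-duality.\<close>

definition L2_dual ::
    "real \<Rightarrow> ((real \<Rightarrow> 'h::real_inner) \<Rightarrow> 'k::real_inner) \<Rightarrow> (real \<Rightarrow> 'h) set" where
  "L2_dual T j = {f \<in> L2 T. \<exists>\<phi> :: 'k \<Rightarrow>\<^sub>L real.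
     \<forall>h\<in>L2 T. \<phi> (j h) = (\<integral>t. h t \<bullet> f t \<partial>lebesgue_on {0<..<T})}"


section \<open>Isonormal processes and radonifying operators\<close>

definition centred_gaussian :: "'w measure \<Rightarrow> ('w \<Rightarrow> real) \<Rightarrow> bool" where
  "centred_gaussian M Z \<longleftrightarrow> Z \<in> borel_measurable M \<and>
     (\<exists>\<sigma>\<ge>0. distr M borel Z =
        (if \<sigma> = 0 then return borel 0 else density lborel (\<lambda>x. ennreal (normal_density 0 \<sigma> x))))"

definition isonormal_process ::
    "'w measure \<Rightarrow> ('k::real_inner \<Rightarrow> 'w \<Rightarrow> real) \<Rightarrow> bool" where
  "isonormal_process M W \<longleftrightarrow>
     (\<forall>h. W h \<in> borel_measurable M \<and> integrable M (\<lambda>\<omega>. (W h \<omega>)\<^sup>2)) \<and>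
     (\<forall>g h. AE \<omega> in M. W (g + h) \<omega> = W g \<omega> + W h \<omega>) \<and>
     (\<forall>c h. AE \<omega> in M. W (c *\<^sub>R h) \<omega> = c * W h \<omega>) \<and>
     (\<exists>C. \<forall>h. sqrt (\<integral>\<omega>. (W h \<omega>)\<^sup>2 \<partial>M) \<le> C * norm h) \<and>
     (\<forall>h. centred_gaussian M (W h)) \<and>
     (\<forall>g h. (\<integral>\<omega>. W g \<omega> * W h \<omega> \<partial>M) = g \<bullet> h)"

text \<open>
  A list \<open>[(h\<^sub>1, x\<^sub>1), \<dots>, (h\<^sub>N, x\<^sub>N)]\<close> stands for the tensor \<open>\<Sum>n. h\<^sub>n \<otimes> x\<^sub>n\<close>, which
  acts as the finite rank operator \<open>k \<mapsto> \<Sum>n. (h\<^sub>n \<bullet> k) x\<^sub>n\<close>.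
\<close>

definition tensor_op ::
    "('k::real_inner \<times> 'e::real_normed_vector) list \<Rightarrow> 'k \<Rightarrow>\<^sub>L 'e" where
  "tensor_op u = (\<Sum>(h, x)\<leftarrow>u. blinfun_scaleR_left x o\<^sub>L blinfun_inner_right h)"

definition orthonormal_tensor :: "('k::real_inner \<times> 'e) list \<Rightarrow> bool" where
  "orthonormal_tensor u \<longleftrightarrow>
     (\<forall>m<length u. \<forall>n<length u. fst (u ! m) \<bullet> fst (u ! n) = (if m = n then 1 else 0))"

text \<open>The norm of a finite rank operator; it does not depend on the orthonormal representation.\<close>

definition gamma_norm :: "('k::real_inner \<Rightarrow>\<^sub>L 'e::real_normed_vector) \<Rightarrow> real" where
  "gamma_norm R = (THE c. \<exists>u. orthonormal_tensor u \<and> tensor_op u = R \<and>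
     c = sqrt (\<integral>\<gamma>. (norm (\<Sum>n<length u. \<gamma> n *\<^sub>R snd (u ! n)))\<^sup>2
               \<partial>(\<Pi>\<^sub>M n\<in>{..<length u}. density lborel (\<lambda>x. ennreal (std_normal_density x)))))"

text \<open>
  Since the \<open>\<gamma>\<close>-norm dominates the operator norm, an element of the completion of \<open>\<H> \<otimes> E\<close>, i.e. a
  class of \<open>\<gamma>\<close>-Cauchy sequences, is identified with the limit of these sequences in operator norm.
\<close>

definition gamma_approx ::
    "(nat \<Rightarrow> ('k::real_inner \<times> 'e::real_normed_vector) list) \<Rightarrow> ('k \<Rightarrow>\<^sub>L 'e) \<Rightarrow> bool" where
  "gamma_approx u R \<longleftrightarrow>
     (\<forall>\<epsilon>>0. \<exists>N. \<forall>m\<ge>N. \<forall>n\<ge>N. gamma_norm (tensor_op (u m) - tensor_op (u n)) < \<epsilon>) \<and>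
     (\<lambda>n. tensor_op (u n)) \<longlonglongrightarrow> R"

definition gamma_radonifying :: "('k::real_inner \<Rightarrow>\<^sub>L 'e::real_normed_vector) \<Rightarrow> bool" where
  "gamma_radonifying R \<longleftrightarrow> (\<exists>u. gamma_approx u R)"

text \<open>\<open>X\<close> is a version of \<open>W(R)\<close>, for the isometric extension \<open>W : \<gamma>(\<H>,E) \<rightarrow> L\<^sup>2(\<Omega>;E)\<close>.\<close>

definition isonormal_extension ::
    "'w measure \<Rightarrow> ('k::real_inner \<Rightarrow> 'w \<Rightarrow> real) \<Rightarrow> ('k \<Rightarrow>\<^sub>L 'e::real_normed_vector) \<Rightarrow>
      ('w \<Rightarrow> 'e) \<Rightarrow> bool" where
  "isonormal_extension M W R X \<longleftrightarrow> square_integrable M X \<and>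
     (\<exists>u. gamma_approx u R \<and>
        (\<lambda>n. \<integral>\<^sup>+\<omega>. ennreal ((norm (X \<omega> - (\<Sum>(h, x)\<leftarrow>u n. W h \<omega> *\<^sub>R x)))\<^sup>2) \<partial>M) \<longlonglongrightarrow> 0)"


section \<open>The stochastic integral\<close>

text \<open>The adjoint \<open>E\<^sup>* \<rightarrow> H\<close>, with \<open>H\<close> identified with its dual by the Riesz theorem.\<close>

definition riesz_adjoint ::
    "('h::real_inner \<Rightarrow>\<^sub>L 'e::real_normed_vector) \<Rightarrow> ('e \<Rightarrow>\<^sub>L real) \<Rightarrow> 'h" where
  "riesz_adjoint R y = (THE v. \<forall>h. v \<bullet> h = y (R h))"

definition represents ::
    "real \<Rightarrow> ((real \<Rightarrow> 'h::real_inner) \<Rightarrow> 'k::real_inner) \<Rightarrow>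
      (real \<Rightarrow> 'h \<Rightarrow>\<^sub>L 'e::real_normed_vector) \<Rightarrow> ('k \<Rightarrow>\<^sub>L 'e) \<Rightarrow> bool" where
  "represents T j \<Phi> R \<longleftrightarrow> gamma_radonifying R \<and>
     (\<forall>y. riesz_adjoint R y = j (\<lambda>t. riesz_adjoint (\<Phi> t) y))"

text \<open>The first conjunct is the standing assumption on the orbits of \<open>\<Phi>\<^sup>*\<close>.\<close>

definition stochastically_integrable ::
    "real \<Rightarrow> ((real \<Rightarrow> 'h::real_inner) \<Rightarrow> 'k::real_inner) \<Rightarrow>
      (real \<Rightarrow> 'h \<Rightarrow>\<^sub>L 'e::real_normed_vector) \<Rightarrow> bool" where
  "stochastically_integrable T j \<Phi> \<longleftrightarrow>
     (\<forall>y. (\<lambda>t. riesz_adjoint (\<Phi> t) y) \<in> L2 T) \<and> (\<exists>R. represents T j \<Phi> R)"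

text \<open>\<open>X\<close> is a version of \<open>\<integral>\<^sub>0\<^sup>T \<Phi> dW\<close>, an element of \<open>L\<^sup>2(\<Omega>;E)\<close>.\<close>

definition is_stochastic_integral ::
    "'w measure \<Rightarrow> ('k::real_inner \<Rightarrow> 'w \<Rightarrow> real) \<Rightarrow> real \<Rightarrow>
      ((real \<Rightarrow> 'h::real_inner) \<Rightarrow> 'k) \<Rightarrow> (real \<Rightarrow> 'h \<Rightarrow>\<^sub>L 'e::real_normed_vector) \<Rightarrow>
      ('w \<Rightarrow> 'e) \<Rightarrow> bool" where
  "is_stochastic_integral M W T j \<Phi> X \<longleftrightarrow>
     (\<exists>R. represents T j \<Phi> R \<and> isonormal_extension M W R X)"


section \<open>Reproducing kernel Hilbert spaces\<close>

definition covariance_operator ::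
    "'w measure \<Rightarrow> ('w \<Rightarrow> 'e::real_normed_vector) \<Rightarrow> ('e \<Rightarrow>\<^sub>L real) \<Rightarrow>\<^sub>L 'e" where
  "covariance_operator M X =
     (THE Q. \<forall>x y. blinfun_apply y (blinfun_apply Q x) =
        (\<integral>\<omega>. blinfun_apply x (X \<omega>) * blinfun_apply y (X \<omega>) \<partial>M))"

text \<open>
  The image in \<open>E\<close> of the completion of the range of \<open>Q\<close> with respect to
  \<open>[Q x, Q y] = \<langle>Q x, y\<rangle>\<close>: the limits in \<open>E\<close> of the sequences in the range that are Cauchy for
  the norm induced by this inner product.
\<close>

definition rkhs :: "(('e::real_normed_vector \<Rightarrow>\<^sub>L real) \<Rightarrow>\<^sub>L 'e) \<Rightarrow> 'e set" where
  "rkhs Q = {z. \<exists>x :: nat \<Rightarrow> 'e \<Rightarrow>\<^sub>L real.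
     (\<forall>\<epsilon>>0. \<exists>N. \<forall>m\<ge>N. \<forall>n\<ge>N. sqrt ((x m - x n) (Q (x m - x n))) < \<epsilon>) \<and>
     (\<lambda>n. Q (x n)) \<longlonglongrightarrow> z}"


section \<open>Semigroups and mild solutions\<close>

definition C0_semigroup :: "(real \<Rightarrow> 'e::real_normed_vector \<Rightarrow>\<^sub>L 'e) \<Rightarrow> bool" where
  "C0_semigroup S \<longleftrightarrow> S 0 = id_blinfun \<and>
     (\<forall>s\<ge>0. \<forall>t\<ge>0. S (s + t) = S s o\<^sub>L S t) \<and>
     (\<forall>x. ((\<lambda>t. S t x) \<longlongrightarrow> x) (at_right 0))"

definition generates ::
    "'e::real_normed_vector set \<Rightarrow> ('e \<Rightarrow> 'e) \<Rightarrow> (real \<Rightarrow> 'e \<Rightarrow>\<^sub>L 'e) \<Rightarrow> bool" where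
  "generates domA A S \<longleftrightarrow> C0_semigroup S \<and>
     domA = {x. \<exists>y. ((\<lambda>t. (1 / t) *\<^sub>R (S t x - x)) \<longlongrightarrow> y) (at_right 0)} \<and>
     (\<forall>x\<in>domA. ((\<lambda>t. (1 / t) *\<^sub>R (S t x - x)) \<longlongrightarrow> A x) (at_right 0))"

text \<open>
  \<open>x\<close> is the mild solution on \<open>[0,T]\<close> of \<open>x' = Ax + Bf\<close>, \<open>x(0) = x\<^sub>0\<close>, where \<open>S\<close> is the semigroup
  generated by \<open>A\<close>: \<open>x(t) = S(t)x\<^sub>0 + \<integral>\<^sub>0\<^sup>t S(t-s)Bf(s) ds\<close>.
\<close>

definition mild_solution ::
    "(real \<Rightarrow> 'e::real_normed_vector \<Rightarrow>\<^sub>L 'e) \<Rightarrow> ('h::real_normed_vector \<Rightarrow>\<^sub>L 'e) \<Rightarrow> real \<Rightarrow> 'e \<Rightarrow>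
      (real \<Rightarrow> 'h) \<Rightarrow> (real \<Rightarrow> 'e) \<Rightarrow> bool" where
  "mild_solution S B T x0 f x \<longleftrightarrow>
     (\<forall>t\<in>{0..T}. \<exists>I. has_strong_integral (lebesgue_on {0<..<t}) (\<lambda>s. S (t - s) (B (f s))) I \<and>
        x t = S t x0 + I)"

definition null_controllable ::
    "(real \<Rightarrow> 'e::real_normed_vector \<Rightarrow>\<^sub>L 'e) \<Rightarrow> ('h::real_normed_vector \<Rightarrow>\<^sub>L 'e) \<Rightarrow> real \<Rightarrow>
      (real \<Rightarrow> 'h) set \<Rightarrow> 'e \<Rightarrow> bool" where
  "null_controllable S B T F x0 \<longleftrightarrow> (\<exists>f\<in>F. \<exists>x. mild_solution S B T x0 f x \<and> x T = 0)"

definition mutually_absolutely_continuous :: "'a measure \<Rightarrow> 'a measure \<Rightarrow> bool" where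
  "mutually_absolutely_continuous \<mu> \<nu> \<longleftrightarrow>
     absolutely_continuous \<mu> \<nu> \<and> absolutely_continuous \<nu> \<mu>"

end

theory Submission
  imports Defs
begin

text \<open>
  Let \<open>R\<close> be the operator representing \<open>\<Phi>\<close>. Each of the three assertions is equivalent to
  \<open>range (S T) \<subseteq> range R\<close>.

  (i) The Gaussian variable \<open>X = W(R)\<close> has covariance \<open>R R\<^sup>*\<close>, whose reproducing kernel space is
  \<open>range R\<close>.

  (ii) By the Riesz theorems in the Hilbert space of \<open>W\<close> and in \<open>L\<^sup>2(0,T;H)\<close>, a control \<open>f\<close> in the dual is
  the same as a vector \<open>k\<close> with \<open>[k, j h] = \<integral> [h, f]\<close>, and then \<open>\<integral> \<Phi> f = R k\<close>.

  (iii) If \<open>k\<close> is a unit vector, then \<open>X - W(k) R k\<close> is independent of \<open>W(k)\<close>, because their joint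
  characteristic functions factor; as \<open>W(k)\<close> has a positive density, translating \<open>X\<close> by multiples of
  \<open>R k\<close> preserves null sets. If \<open>z\<close> is not in \<open>range R\<close>, there are functionals \<open>y\<^sub>n\<close> with \<open>y\<^sub>n z = 1\<close> and
  \<open>R\<^sup>* y\<^sub>n \<rightarrow> 0\<close> so fast that \<open>y\<^sub>n X \<rightarrow> 0\<close> almost surely; the set where \<open>y\<^sub>n \<rightarrow> 0\<close> then separates the
  laws of \<open>X\<close> and \<open>z + X\<close>.
\<close>

section \<open>Functional analysis\<close>

text \<open>Everything is tested against functionals: the link between \<open>X\<close> and
  \<open>R\<close> is that \<open>y X = W(R* y)\<close> almost surely, for each \<open>y\<close>
  with its own null set. Membership of \<open>z\<close> in \<open>range R\<close> is scalar too: it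
  holds iff \<open>|y z| <= C |R* y|\<close> for some \<open>C\<close> and all \<open>y\<close>.
  This criterion yields the reproducing kernel space, and its failure yields the functionals
  \<open>y_n\<close>. The obstacle is that the spaces may be non-separable. Borel sets of
  \<open>E\<close> need not be generated by functionals, and Borel sets of \<open>E x R\<close> need
  not lie in the product sigma-algebra. The first problem is overcome by the countably many values
  of the simple functions approximating \<open>X\<close>, the second by the countable base of the
  real line. Uniqueness of characteristic functions is applied to real variables only: a bounded
  weight carries the remaining information, and the functionals of a cylinder event are added one at
  a time.\<close>

definition sublinear :: "('a::real_vector \<Rightarrow> real) \<Rightarrow> bool" where
  "sublinear p \<longleftrightarrow> (\<forall>x y. p (x + y) \<le> p x + p y) \<and> (\<forall>c x. c > 0 \<longrightarrow> p (c *\<^sub>R x) = c * p x)"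

lemma sublinear_add: "sublinear p \<Longrightarrow> p (x + y) \<le> p x + p y"
  and sublinear_scale: "sublinear p \<Longrightarrow> c > 0 \<Longrightarrow> p (c *\<^sub>R x) = c * p x"
  by (auto simp: sublinear_def)

lemma sublinear_zero:
  assumes "sublinear p" shows "p 0 = 0"
  using sublinear_scale[OF assms, of 2 0] by simp

lemma sublinear_ge:
  assumes "sublinear p" shows "- p (- x) \<le> p x"
  using sublinear_add[OF assms, of x "- x"] sublinear_zero[OF assms] by simp

text \<open>Pushes \<open>p\<close> down as far as possible in the direction \<open>-z\<close>.\<close>

definition push :: "('a::real_vector \<Rightarrow> real) \<Rightarrow> 'a \<Rightarrow> 'a \<Rightarrow> real" where
  "push p z x = (INF t\<in>{0..}. p (x + t *\<^sub>R z) - t * p z)"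

lemma push_bdd:
  assumes p: "sublinear p"
  shows "bdd_below ((\<lambda>t. p (x + t *\<^sub>R z) - t * p z) ` {0..})"
proof (rule bdd_belowI2[where m = "- p (- x)"])
  fix t :: real assume t: "t \<in> {0..}"
  have "t * p z = p (t *\<^sub>R z)"
    using t sublinear_scale[OF p, of t z] sublinear_zero[OF p] by (cases "t = 0") auto
  also have "\<dots> \<le> p (x + t *\<^sub>R z) + p (- x)"
    using sublinear_add[OF p, of "x + t *\<^sub>R z" "- x"] by simp
  finally show "- p (- x) \<le> p (x + t *\<^sub>R z) - t * p z" by simp
qed

text \<open>Two instances matter: \<open>t = 0\<close> gives \<open>push p z <= p\<close>, and
  \<open>t = 1\<close> gives \<open>push p z x <= p (x + z) - p z\<close>, the half of additivity
  that sublinearity lacks.\<close>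

lemma push_le:
  assumes p: "sublinear p" and "t \<ge> 0"
  shows "push p z x \<le> p (x + t *\<^sub>R z) - t * p z"
  unfolding push_def using assms by (intro cINF_lower push_bdd) auto

lemma sublinear_push:
  assumes p: "sublinear p"
  shows "sublinear (push p z)"
  unfolding sublinear_def
proof (intro conjI allI impI)
  fix x y
  have *: "push p z (x + y) \<le> (p (x + s *\<^sub>R z) - s * p z) + (p (y + t *\<^sub>R z) - t * p z)"
    if "s \<ge> 0" "t \<ge> 0" for s t
  proof -
    have "push p z (x + y) \<le> p ((x + s *\<^sub>R z) + (y + t *\<^sub>R z)) - (s + t) * p z"
      using push_le[OF p, of "s + t" z "x + y"] that by (simp add: algebra_simps)
    with sublinear_add[OF p, of "x + s *\<^sub>R z" "y + t *\<^sub>R z"] show ?thesis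
      by (simp add: algebra_simps)
  qed
  have "push p z (x + y) - (p (x + s *\<^sub>R z) - s * p z) \<le> push p z y" if "s \<ge> 0" for s
    unfolding push_def[of p z y] using *[OF that] by (intro cINF_greatest) (auto simp: algebra_simps)
  then have "push p z (x + y) - push p z y \<le> push p z x"
    unfolding push_def[of p z x] by (intro cINF_greatest) (auto simp: algebra_simps)
  then show "push p z (x + y) \<le> push p z x + push p z y" by simp
next
  fix c :: real and x assume c: "c > 0"
  \<comment> \<open>Only this inequality needs the infimum; applied to \<open>1 / c\<close> and
    \<open>c x\<close> it gives the reverse one.\<close>
  have le: "push p z (c *\<^sub>R x) \<le> c * push p z x" if c: "c > 0" for c x
  proof -
    have "push p z (c *\<^sub>R x) / c \<le> p (x + t *\<^sub>R z) - t * p z" if t: "t \<ge> 0" for t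
    proof -
      have "push p z (c *\<^sub>R x) \<le> p (c *\<^sub>R (x + t *\<^sub>R z)) - (c * t) * p z"
        using push_le[OF p, of "c * t" z "c *\<^sub>R x"] that c by (simp add: algebra_simps)
      then show ?thesis using c unfolding sublinear_scale[OF p c] by (simp add: field_simps)
    qed
    then have "push p z (c *\<^sub>R x) / c \<le> push p z x"
      unfolding push_def[of p z x] by (intro cINF_greatest) auto
    then show ?thesis using c by (simp add: field_simps)
  qed
  have "push p z x \<le> (1 / c) * push p z (c *\<^sub>R x)"
    using le[of "1 / c" "c *\<^sub>R x"] c by simp
  then have "c * push p z x \<le> push p z (c *\<^sub>R x)" using c by (simp add: field_simps)
  with le[OF c, of x] show "push p z (c *\<^sub>R x) = c * push p z x" by simp
qed

text \<open>Zorn's lemma for the reversed order. The pointwise infimum bounds a chain from below: it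
  is finite because \<open>p <= q\<close> forces \<open>- q (- x) <= p x\<close>, and subadditive
  because the smaller of two members of the chain serves both arguments.\<close>

lemma minimal_sublinear_exists:
  fixes q :: "'a::real_vector \<Rightarrow> real"
  assumes q: "sublinear q"
  shows "\<exists>p. sublinear p \<and> p \<le> q \<and> (\<forall>p'. sublinear p' \<and> p' \<le> p \<longrightarrow> p' = p)"
proof -
  define A where "A = {p. sublinear p \<and> p \<le> q}"
  have "\<exists>m\<in>A. \<forall>a\<in>A. m \<ge> a \<longrightarrow> a = m"
  proof (rule predicate_Zorn)
    show "partial_order_on A (relation_of (\<ge>) A)"
      by (rule partial_order_on_relation_ofI) auto
  next
    fix C assume "C \<in> Chains (relation_of (\<ge>) A)"
    then have CA: "C \<subseteq> A" and ch: "\<And>a b. a \<in> C \<Longrightarrow> b \<in> C \<Longrightarrow> a \<le> b \<or> b \<le> a"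
      by (auto simp: Chains_def relation_of_def)
    show "\<exists>u\<in>A. \<forall>a\<in>C. a \<ge> u"
    proof (cases "C = {}")
      case True then show ?thesis using q by (auto simp: A_def)
    next
      case False
      then obtain p0 where p0: "p0 \<in> C" by auto
      define u where "u x = (INF p\<in>C. p x)" for x
      have sl: "sublinear p" "p \<le> q" if "p \<in> C" for p using that CA by (auto simp: A_def)
      have bdd: "bdd_below ((\<lambda>p. p x) ` C)" for x
      proof (rule bdd_belowI2[where m = "- q (- x)"])
        fix p assume "p \<in> C"
        then show "- q (- x) \<le> p x"
          using sublinear_ge[OF sl(1), of p x] le_funD[OF sl(2), of p "- x"] by simp
      qed
      have low: "u x \<le> p x" if "p \<in> C" for p x
        unfolding u_def using that bdd by (intro cINF_lower) auto
      have gr: "c \<le> u x" if "\<And>p. p \<in> C \<Longrightarrow> c \<le> p x" for c x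
        unfolding u_def using that False by (intro cINF_greatest) auto
      have "sublinear u"
        unfolding sublinear_def
      proof (intro conjI allI impI)
        fix x y
        have *: "u (x + y) \<le> p x + p' y" if pp: "p \<in> C" "p' \<in> C" for p p'
        proof -
          obtain r where r: "r \<in> C" "r \<le> p" "r \<le> p'" using ch[OF pp] pp by auto
          have "u (x + y) \<le> r x + r y"
            using low[OF r(1), of "x + y"] sublinear_add[OF sl(1)[OF r(1)], of x y] by simp
          then show ?thesis using le_funD[OF r(2), of x] le_funD[OF r(3), of y] by simp
        qed
        have "u (x + y) - p x \<le> u y" if "p \<in> C" for p
          using *[OF that] by (intro gr) (auto simp: algebra_simps)
        then have "u (x + y) - u y \<le> u x" by (intro gr) (auto simp: algebra_simps)
        then show "u (x + y) \<le> u x + u y" by simp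
      next
        fix c :: real and x assume c: "c > 0"
        have "u (c *\<^sub>R x) / c \<le> u x"
        proof (rule gr)
          fix p assume "p \<in> C"
          then show "u (c *\<^sub>R x) / c \<le> p x"
            using c low[of p "c *\<^sub>R x"] sublinear_scale[OF sl(1) c, of p x] by (simp add: field_simps)
        qed
        moreover have "c * u x \<le> u (c *\<^sub>R x)"
        proof (rule gr)
          fix p assume "p \<in> C"
          then show "c * u x \<le> p (c *\<^sub>R x)"
            using c low[of p x] sublinear_scale[OF sl(1) c, of p x] by simp
        qed
        ultimately show "u (c *\<^sub>R x) = c * u x" using c by (simp add: field_simps)
      qed
      moreover have "u \<le> q"
        using low[OF p0] sl(2)[OF p0] by (meson le_funI le_funD order_trans)
      ultimately show ?thesis using low by (auto simp: A_def le_fun_def)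
    qed
  qed
  then obtain m where m: "m \<in> A" and "\<And>a. a \<in> A \<Longrightarrow> a \<le> m \<Longrightarrow> a = m" by auto
  then show ?thesis unfolding A_def by (metis (mono_tags, lifting) mem_Collect_eq order_trans)
qed

text \<open>By minimality \<open>p\<close> equals its push in every direction, and the push with
  \<open>t = 1\<close> then supplies \<open>p x + p z <= p (x + z)\<close>.\<close>

lemma minimal_sublinear_linear:
  fixes p :: "'a::real_vector \<Rightarrow> real"
  assumes p: "sublinear p" and min: "\<And>p'. sublinear p' \<Longrightarrow> p' \<le> p \<Longrightarrow> p' = p"
  shows "linear p"
proof -
  have eq: "push p z = p" for z
    using push_le[OF p, of 0 z] by (intro min sublinear_push p) (auto simp: le_fun_def)
  have add: "p (x + z) = p x + p z" for x z
    using push_le[OF p, of 1 z x] sublinear_add[OF p, of x z] by (simp add: eq)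
  have neg: "p (- x) = - p x" for x
    using add[of x "- x"] sublinear_zero[OF p] by simp
  have "p (c *\<^sub>R x) = c * p x" for c x
  proof -
    consider "c > 0" | "c = 0" | "- c > 0" by linarith
    then show ?thesis
    proof cases
      case 3
      then show ?thesis using sublinear_scale[OF p 3, of x] neg[of "c *\<^sub>R x"] by simp
    qed (auto simp: sublinear_scale[OF p] sublinear_zero[OF p])
  qed
  with add show ?thesis by (intro linearI) auto
qed

text \<open>No functional is extended from a subspace. The minimal functional is sought below
  \<open>push norm z\<close> instead of \<open>norm\<close>, because the former is at most
  \<open>- norm z\<close> at \<open>- z\<close>, which forces \<open>f z = norm z\<close>.\<close>

theorem norming_functional:
  fixes z :: "'a::real_normed_vector"
  obtains f :: "'a \<Rightarrow>\<^sub>L real" where "f z = norm z" "\<And>x. \<bar>f x\<bar> \<le> norm x"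
proof -
  have n: "sublinear (norm :: 'a \<Rightarrow> real)" by (auto simp: sublinear_def norm_triangle_ineq)
  obtain p where p: "sublinear p" "p \<le> push norm z"
      and min: "\<And>p'. sublinear p' \<Longrightarrow> p' \<le> p \<Longrightarrow> p' = p"
    using minimal_sublinear_exists[OF sublinear_push[OF n]] by metis
  have lin: "linear p" by (rule minimal_sublinear_linear[OF p(1) min])
  have le: "p x \<le> norm x" for x
    using le_funD[OF p(2), of x] push_le[OF n, of 0 z x] by simp
  have abs: "\<bar>p x\<bar> \<le> norm x" for x
    using le[of x] le[of "- x"] linear_neg[OF lin, of x] by auto
  have "p (- z) \<le> - norm z"
    using le_funD[OF p(2), of "- z"] push_le[OF n, of 1 z "- z"] by simp
  then have eq: "p z = norm z" using le[of z] linear_neg[OF lin, of z] by auto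
  have "bounded_linear p"
    using lin abs by (intro bounded_linear_intro[where K = 1]) (auto simp: linear_add linear_scale)
  then have "blinfun_apply (Blinfun p) = p" by (rule bounded_linear_Blinfun_apply)
  with that[of "Blinfun p"] eq abs show ?thesis by simp
qed

corollary functionals_separate:
  fixes x y :: "'a::real_normed_vector"
  assumes "\<And>f :: 'a \<Rightarrow>\<^sub>L real. f x = f y"
  shows "x = y"
proof -
  obtain f :: "'a \<Rightarrow>\<^sub>L real" where "f (x - y) = norm (x - y)" by (rule norming_functional)
  then show ?thesis using assms[of f] by (simp add: blinfun.diff_right)
qed

section \<open>The Riesz theorem in Hilbert spaces and adjoints\<close>

text \<open>A minimising sequence of \<open>J u = ip u u - 2 * \<phi> u\<close> works. A sequence is
  returned, not a vector, because \<open>V\<close> need not be complete and \<open>ip\<close> may be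
  degenerate. The operations are parameters so that one proof serves a Hilbert space, the simple
  functions, and the dual of \<open>E\<close> with the form \<open>[R* x, R* y]\<close>.\<close>

lemma riesz_sequence:
  fixes add :: "'v \<Rightarrow> 'v \<Rightarrow> 'v" and scl :: "real \<Rightarrow> 'v \<Rightarrow> 'v"
    and ip :: "'v \<Rightarrow> 'v \<Rightarrow> real" and \<phi> :: "'v \<Rightarrow> real"
  assumes V: "V \<noteq> {}" "\<And>u v. u \<in> V \<Longrightarrow> v \<in> V \<Longrightarrow> add u v \<in> V" "\<And>c v. v \<in> V \<Longrightarrow> scl c v \<in> V"
    and ip: "\<And>u v w. u \<in> V \<Longrightarrow> v \<in> V \<Longrightarrow> w \<in> V \<Longrightarrow> ip (add u v) w = ip u w + ip v w"
      "\<And>c u w. u \<in> V \<Longrightarrow> w \<in> V \<Longrightarrow> ip (scl c u) w = c * ip u w"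
      "\<And>u w. u \<in> V \<Longrightarrow> w \<in> V \<Longrightarrow> ip u w = ip w u"
      "\<And>u. u \<in> V \<Longrightarrow> ip u u \<ge> 0"
    and \<phi>: "\<And>u v. u \<in> V \<Longrightarrow> v \<in> V \<Longrightarrow> \<phi> (add u v) = \<phi> u + \<phi> v"
      "\<And>c u. u \<in> V \<Longrightarrow> \<phi> (scl c u) = c * \<phi> u"
      "\<And>u. u \<in> V \<Longrightarrow> \<bar>\<phi> u\<bar> \<le> C * sqrt (ip u u)"
  obtains v :: "nat \<Rightarrow> 'v" where "\<And>n. v n \<in> V"
    "\<And>m n. ip (add (v m) (scl (- 1) (v n))) (add (v m) (scl (- 1) (v n)))
        \<le> 2 / real (Suc m) + 2 / real (Suc n)"
    "\<And>w. w \<in> V \<Longrightarrow> (\<lambda>n. ip (v n) w) \<longlonglongrightarrow> \<phi> w"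
proof -
  define J where "J u = ip u u - 2 * \<phi> u" for u
  have J_lc: "J (add u (scl s w)) = J u + 2 * s * (ip u w - \<phi> w) + s\<^sup>2 * ip w w"
    if "u \<in> V" "w \<in> V" for u w s
  proof -
    have sw: "scl s w \<in> V" using V that by auto
    have a: "ip (add u (scl s w)) (add u (scl s w)) =
        ip u (add u (scl s w)) + s * ip w (add u (scl s w))"
      using that sw V by (simp add: ip)
    have "ip u (add u (scl s w)) = ip u u + s * ip u w"
      using that sw V ip(3)[of u "add u (scl s w)"] ip(3)[of u w] by (simp add: ip(1,2))
    moreover have "ip w (add u (scl s w)) = ip u w + s * ip w w"
      using that sw V ip(3)[of w "add u (scl s w)"] by (simp add: ip(1,2))
    ultimately show ?thesis
      using that sw a by (simp add: J_def \<phi> power2_eq_square algebra_simps)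
  qed
  have bdd: "J u \<ge> - C\<^sup>2" if "u \<in> V" for u
  proof -
    have "0 \<le> (sqrt (ip u u) - C)\<^sup>2" by simp
    also have "\<dots> = ip u u - 2 * (C * sqrt (ip u u)) + C\<^sup>2"
      using ip(4)[OF that] by (simp add: power2_diff)
    finally show ?thesis using \<phi>(3)[OF that] unfolding J_def by linarith
  qed
  define d where "d = (INF u\<in>V. J u)"
  have bb: "bdd_below (J ` V)" using bdd by (intro bdd_belowI2[where m = "- C\<^sup>2"])
  have dle: "d \<le> J u" if "u \<in> V" for u unfolding d_def using that bb by (intro cINF_lower)
  have "\<exists>u\<in>V. J u < d + 1 / real (Suc n)" for n
  proof (rule ccontr)
    assume "\<not> ?thesis"
    then have "d + 1 / real (Suc n) \<le> d"
      unfolding d_def using V(1) by (intro cINF_greatest) (auto simp: not_less d_def)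
    then show False by (simp add: field_simps)
  qed
  then obtain v where vV: "\<And>n. v n \<in> V" and v: "\<And>n. J (v n) < d + 1 / real (Suc n)" by metis
  show ?thesis
  proof (rule that[of v])
    show "v n \<in> V" for n by (rule vV)
  next
    fix m n
    let ?w = "add (v m) (scl (- 1) (v n))"
    have w: "?w \<in> V" using V vV by auto
    \<comment> \<open>The argument of \<open>J\<close> is the midpoint of \<open>v m\<close> and
      \<open>v n\<close>. By the parallelogram law its value is the mean of \<open>J (v m)\<close>
      and \<open>J (v n)\<close> minus a quarter of the squared distance; since it is at least
      \<open>d\<close>, the distance is small.\<close>
    have "d \<le> J (add (v m) (scl (- 1/2) ?w))" using V vV w by (intro dle) auto
    also have "\<dots> = J (v m) - (ip (v m) ?w - \<phi> ?w) + ip ?w ?w / 4"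
      using J_lc[OF vV w, of m "- 1/2"] by (simp add: power2_eq_square)
    finally have 1: "d \<le> J (v m) - (ip (v m) ?w - \<phi> ?w) + ip ?w ?w / 4" .
    have e: "ip (v m) ?w = ip (v m) (v m) - ip (v m) (v n)" "ip (v n) ?w = ip (v m) (v n) - ip (v n) (v n)"
      using ip(3)[OF vV w, of m] ip(3)[OF vV w, of n] ip(3)[OF vV vV, of n m] V vV by (simp_all add: ip(1,2))
    have e2: "ip ?w ?w = ip (v m) ?w - ip (v n) ?w" using V vV w by (simp add: ip(1,2))
    have e3: "\<phi> ?w = \<phi> (v m) - \<phi> (v n)" using V vV by (simp add: \<phi>)
    have arith: "a - b - (b - c) \<le> 2 * \<epsilon> + 2 * \<delta>"
      if "d \<le> a - 2 * p - (a - b - (p - q)) + (a - b - (b - c)) / 4"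
        "a - 2 * p < d + \<epsilon>" "c - 2 * q < d + \<delta>" for a b c p q \<epsilon> \<delta>
      using that by argo
    show "ip ?w ?w \<le> 2 / real (Suc m) + 2 / real (Suc n)"
      using arith[OF 1[unfolded e2 e e3 J_def] v[of m, unfolded J_def] v[of n, unfolded J_def]]
      unfolding e2 e by simp
  next
    fix w assume w: "w \<in> V"
    \<comment> \<open>\<open>v n\<close> is minimal up to \<open>r^2 = 1 / (n + 1)\<close>, so the
      quadratic polynomial in \<open>s\<close> describing the change from \<open>v n\<close> to
      \<open>v n + s w\<close> is at least \<open>- r^2\<close>. Taking \<open>s = r\<close> and
      \<open>s = - r\<close> bounds its linear coefficient by a multiple of
      \<open>r\<close>.\<close>
    have bnd: "\<bar>ip (v n) w - \<phi> w\<bar> \<le> (1 + ip w w) / 2 * (1 / sqrt (real (Suc n)))" for n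
    proof -
      define r where "r = 1 / sqrt (real (Suc n))"
      have r: "r > 0" "r\<^sup>2 = 1 / real (Suc n)" by (auto simp: r_def power_divide)
      have "2 * s * (ip (v n) w - \<phi> w) + s\<^sup>2 * ip w w \<ge> - (r * r)" for s
        using dle[of "add (v n) (scl s w)"] V vV w v[of n] J_lc[OF vV w, of n s] r(2)
        by (auto simp: power2_eq_square)
      from this[of r] this[of "- r"] have "2 * r * \<bar>ip (v n) w - \<phi> w\<bar> \<le> r * r * (1 + ip w w)"
        using r(1) by (auto simp: power2_eq_square algebra_simps abs_if)
      then have "r * (2 * \<bar>ip (v n) w - \<phi> w\<bar>) \<le> r * (r * (1 + ip w w))" by (simp add: mult_ac)
      then have "2 * \<bar>ip (v n) w - \<phi> w\<bar> \<le> r * (1 + ip w w)" using r(1) by (rule mult_left_le_imp_le)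
      then show ?thesis unfolding r_def[symmetric] by (simp add: field_simps)
    qed
    have "(\<lambda>n. 1 / sqrt (real (Suc n))) \<longlonglongrightarrow> 0"
      using tendsto_inverse_0_at_top[OF filterlim_compose[OF sqrt_at_top
          filterlim_compose[OF filterlim_real_sequentially filterlim_Suc]]]
      by (simp add: inverse_eq_divide)
    then have "(\<lambda>n. (1 + ip w w) / 2 * (1 / sqrt (real (Suc n)))) \<longlonglongrightarrow> 0"
      by (rule tendsto_mult_right_zero)
    then have "(\<lambda>n. ip (v n) w - \<phi> w) \<longlonglongrightarrow> 0"
      by (rule Lim_null_comparison[rotated]) (use bnd in auto)
    then show "(\<lambda>n. ip (v n) w) \<longlonglongrightarrow> \<phi> w" by (simp add: LIM_zero_iff)
  qed
qed


text \<open>The hypothesis has the shape of the bound delivered by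
  \<open>riesz_sequence\<close>.\<close>

lemma Cauchy_if_sq_dist:
  fixes v :: "nat \<Rightarrow> 'a::metric_space"
  assumes "\<And>m n. (dist (v m) (v n))\<^sup>2 \<le> 2 / real (Suc m) + 2 / real (Suc n)"
  shows "Cauchy v"
proof (rule metric_CauchyI)
  fix e :: real assume e: "e > 0"
  obtain N :: nat where "4 / e\<^sup>2 < real N" using reals_Archimedean2 by blast
  then have N: "4 / real (Suc N) < e\<^sup>2" using e by (simp add: field_simps) (smt (verit) zero_less_power)
  show "\<exists>M. \<forall>m\<ge>M. \<forall>n\<ge>M. dist (v m) (v n) < e"
  proof (intro exI[of _ N] allI impI)
    fix m n assume "m \<ge> N" "n \<ge> N"
    then have "2 / real (Suc m) \<le> 2 / real (Suc N)" "2 / real (Suc n) \<le> 2 / real (Suc N)"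
      by (auto intro!: divide_left_mono)
    then have "(dist (v m) (v n))\<^sup>2 < e\<^sup>2" using assms[of m n] N by linarith
    then show "dist (v m) (v n) < e" using e by (simp add: power_less_imp_less_base)
  qed
qed

theorem riesz_representation:
  fixes f :: "'k::{real_inner,complete_space} \<Rightarrow>\<^sub>L real"
  obtains v where "\<And>h. f h = v \<bullet> h"
proof -
  obtain v :: "nat \<Rightarrow> 'k" where
    v: "\<And>m n. (v m + (- 1) *\<^sub>R v n) \<bullet> (v m + (- 1) *\<^sub>R v n) \<le> 2 / real (Suc m) + 2 / real (Suc n)"
      "\<And>w. w \<in> UNIV \<Longrightarrow> (\<lambda>n. v n \<bullet> w) \<longlonglongrightarrow> f w"
  proof (rule riesz_sequence[of UNIV "(+)" "scaleR" "(\<bullet>)" "blinfun_apply f" "norm f"])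
    show "\<bar>f u\<bar> \<le> norm f * sqrt (u \<bullet> u)" for u
      using norm_blinfun[of f u] by (simp add: norm_eq_sqrt_inner)
    show "u \<bullet> w = w \<bullet> u" for u w :: 'k by (rule inner_commute)
  qed (auto simp: inner_add_left blinfun.add_right blinfun.scaleR_right)
  have "Cauchy v" by (rule Cauchy_if_sq_dist) (use v(1) in \<open>simp add: dist_norm power2_norm_eq_inner\<close>)
  then obtain l where l: "v \<longlonglongrightarrow> l" using Cauchy_convergent convergent_def by blast
  have "f h = l \<bullet> h" for h
    using LIMSEQ_unique[OF v(2) tendsto_inner[OF l tendsto_const]] by simp
  with that show ?thesis by blast
qed

lemma inner_eqI: "(\<And>h. v \<bullet> h = w \<bullet> h) \<Longrightarrow> v = (w :: 'a::real_inner)"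
  using inner_eq_zero_iff[of "v - w"] by (simp add: inner_diff_left)

text \<open>Completeness makes the description in \<open>riesz_adjoint\<close> denote: existence is
  the Riesz theorem, uniqueness is \<open>inner_eqI\<close>.\<close>

lemma riesz_adjoint_inner:
  fixes R :: "'k::{real_inner,complete_space} \<Rightarrow>\<^sub>L 'e::real_normed_vector"
  shows "riesz_adjoint R y \<bullet> h = y (R h)"
proof -
  obtain v where v: "\<And>h. (y o\<^sub>L R) h = v \<bullet> h" by (rule riesz_representation[of "y o\<^sub>L R"]) blast
  have "\<forall>h. riesz_adjoint R y \<bullet> h = y (R h)"
    unfolding riesz_adjoint_def
  proof (rule theI)
    show "\<forall>h. v \<bullet> h = y (R h)" using v by simp
    show "w = v" if "\<forall>h. w \<bullet> h = y (R h)" for w using v that by (intro inner_eqI[of w v]) simp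
  qed
  then show ?thesis by simp
qed

lemma riesz_adjoint_unique:
  fixes R :: "'k::{real_inner,complete_space} \<Rightarrow>\<^sub>L 'e::real_normed_vector"
    and y :: "'e \<Rightarrow>\<^sub>L real"
  assumes "\<And>h. v \<bullet> h = y (R h)"
  shows "riesz_adjoint R y = v"
  by (rule inner_eqI) (simp add: riesz_adjoint_inner assms)

lemma riesz_adjoint_add:
  fixes R :: "'k::{real_inner,complete_space} \<Rightarrow>\<^sub>L 'e::real_normed_vector"
  shows "riesz_adjoint R (x + y) = riesz_adjoint R x + riesz_adjoint R y"
  by (rule riesz_adjoint_unique) (simp add: riesz_adjoint_inner inner_add_left blinfun.add_left)

lemma riesz_adjoint_scaleR:
  fixes R :: "'k::{real_inner,complete_space} \<Rightarrow>\<^sub>L 'e::real_normed_vector"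
  shows "riesz_adjoint R (c *\<^sub>R x) = c *\<^sub>R riesz_adjoint R x"
  by (rule riesz_adjoint_unique) (simp add: riesz_adjoint_inner blinfun.scaleR_left)

lemma riesz_adjoint_diff:
  fixes R :: "'k::{real_inner,complete_space} \<Rightarrow>\<^sub>L 'e::real_normed_vector"
  shows "riesz_adjoint R (x - y) = riesz_adjoint R x - riesz_adjoint R y"
  by (rule riesz_adjoint_unique) (simp add: riesz_adjoint_inner inner_diff_left blinfun.diff_left)

lemma norm_riesz_adjoint_le:
  fixes R :: "'k::{real_inner,complete_space} \<Rightarrow>\<^sub>L 'e::real_normed_vector"
  shows "norm (riesz_adjoint R y) \<le> norm R * norm y"
proof (cases "riesz_adjoint R y = 0")
  case False
  let ?v = "riesz_adjoint R y"
  have "norm ?v * norm ?v = y (R ?v)"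
    using riesz_adjoint_inner[of R y ?v] by (simp flip: power2_norm_eq_inner power2_eq_square)
  also have "\<dots> \<le> norm y * norm (R ?v)" using norm_blinfun[of y "R ?v"] by simp
  also have "\<dots> \<le> norm y * (norm R * norm ?v)" by (intro mult_left_mono norm_blinfun) auto
  finally show ?thesis using False by (simp add: mult_ac)
qed simp

text \<open>
  Sokal's argument: by the triangle inequality \<open>A\<close> attains at least \<open>r * norm A\<close> (up to a factor) in
  each ball of radius \<open>r\<close>, so that a point of unboundedness is found by a geometrically convergent
  sequence of corrections.
\<close>

theorem uniform_boundedness:
  fixes A :: "nat \<Rightarrow> 'a::banach \<Rightarrow>\<^sub>L 'b::real_normed_vector"
  assumes bdd: "\<And>x. \<exists>c. \<forall>n. norm (A n x) \<le> c"
  shows "\<exists>c. \<forall>n. norm (A n) \<le> c"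
proof (rule ccontr)
  assume "\<not> ?thesis"
  then have "\<forall>c. \<exists>n. norm (A n) > c" by (auto simp: not_le)
  \<comment> \<open>Corrections of size \<open>3^-k\<close> leave a tail of at most
    \<open>3^-k / 2\<close> after step \<open>k\<close>, so of the gain
    \<open>(2/3) 3^-k |A|\<close> at least \<open>(1/6) 3^-k |A|\<close> survives in the limit.
    Norms above \<open>4^k\<close> make this exceed \<open>(1/6) (4/3)^k\<close>, which is
    unbounded.\<close>
  then have "\<forall>k :: nat. \<exists>n. norm (A n) > 4 ^ k" by blast
  then obtain N where N: "\<And>k :: nat. norm (A (N k)) > 4 ^ k" using choice by metis
  have step: "\<exists>y. norm (y - x) \<le> (1/3) ^ k \<and> norm (A (N k) y) \<ge> (2/3) * (1/3) ^ k * norm (A (N k))"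
    for x k
  proof -
    let ?A = "A (N k)" and ?r = "(1/3::real) ^ k"
    have "0 < (4::real) ^ k" by simp
    then have "0 < norm ?A" using N[of k] by (rule less_trans)
    have "\<exists>h. norm (?A h) > (2/3) * norm ?A * norm h"
    proof (rule ccontr)
      assume "\<not> ?thesis"
      then have "norm ?A \<le> (2/3) * norm ?A"
        by (intro norm_blinfun_bound) (auto simp: not_less)
      with \<open>0 < norm ?A\<close> show False by simp
    qed
    then obtain h where h: "norm (?A h) > (2/3) * norm ?A * norm h" by auto
    then have "h \<noteq> 0" by auto
    define u where "u = (?r / norm h) *\<^sub>R h"
    have nu: "norm u = ?r" using \<open>h \<noteq> 0\<close> by (simp add: u_def)
    have Au: "norm (?A u) \<ge> (2/3) * ?r * norm ?A"
      using h \<open>h \<noteq> 0\<close> by (simp add: u_def blinfun.scaleR_right field_simps)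
    have "2 * norm (?A u) = norm (?A (x + u) - ?A (x - u))"
      by (simp add: blinfun.add_right blinfun.diff_right flip: scaleR_2)
    also have "\<dots> \<le> norm (?A (x + u)) + norm (?A (x - u))" by (rule norm_triangle_ineq4)
    finally have "norm (?A u) \<le> norm (?A (x + u)) \<or> norm (?A u) \<le> norm (?A (x - u))" by linarith
    then show ?thesis
    proof
      assume "norm (?A u) \<le> norm (?A (x + u))"
      then show ?thesis using Au nu by (intro exI[of _ "x + u"]) auto
    next
      assume "norm (?A u) \<le> norm (?A (x - u))"
      then show ?thesis using Au nu by (intro exI[of _ "x - u"]) auto
    qed
  qed
  then obtain g where g: "\<And>x k. norm (g x k - x) \<le> (1/3) ^ k"
      "\<And>x k. norm (A (N k) (g x k)) \<ge> (2/3) * (1/3) ^ k * norm (A (N k))"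
    using choice_iff by metis
  define x where "x = rec_nat 0 (\<lambda>k y. g y k)"
  have xS: "x (Suc k) = g (x k) k" for k by (simp add: x_def)
  have d: "norm (x (Suc k) - x k) \<le> (1/3) ^ k" for k using g(1) by (simp add: xS)
  have sm: "summable (\<lambda>k. x (Suc k) - x k)"
    by (rule summable_comparison_test'[of "\<lambda>k. (1/3::real) ^ k" 0]) (use d in auto)
  define l where "l = (\<Sum>k. x (Suc k) - x k)"
  have tail: "norm (l - x (Suc k)) \<le> (1/2) * (1/3) ^ k" for k
  proof -
    have "l = (\<Sum>i. x (Suc (i + Suc k)) - x (i + Suc k)) + (\<Sum>i<Suc k. x (Suc i) - x i)"
      unfolding l_def by (rule suminf_split_initial_segment[OF sm])
    also have "(\<Sum>i<Suc k. x (Suc i) - x i) = x (Suc k)"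
      using sum_lessThan_telescope[of x "Suc k"] by (simp add: x_def)
    finally have "l - x (Suc k) = (\<Sum>i. x (Suc (i + Suc k)) - x (i + Suc k))" by simp
    also have "norm \<dots> \<le> (\<Sum>i. (1/3::real) ^ Suc k * (1/3) ^ i)"
      using d by (intro norm_suminf_le summable_mult summable_geometric)
        (auto simp: power_add[symmetric] add.commute simp del: power_Suc)
    also have "\<dots> = (1/2) * (1/3) ^ k"
      by (subst suminf_mult) (auto simp: suminf_geometric)
    finally show ?thesis .
  qed
  obtain c where c: "\<And>n. norm (A n l) \<le> c" using bdd[of l] by auto
  have "(1/6) * (4/3) ^ k \<le> c" for k :: nat
  proof -
    let ?a = "norm (A (N k))"
    have "(2/3) * (1/3) ^ k * ?a \<le> norm (A (N k) (x (Suc k)))" using g(2) by (simp add: xS)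
    also have "\<dots> \<le> norm (A (N k) l) + norm (A (N k) (l - x (Suc k)))"
      by (simp add: blinfun.diff_right) (metis norm_minus_commute norm_triangle_sub)
    also have "\<dots> \<le> c + ?a * ((1/2) * (1/3) ^ k)"
      by (intro add_mono c order_trans[OF norm_blinfun] mult_left_mono tail) auto
    finally have "(1/6) * (1/3) ^ k * ?a \<le> c" by (simp add: algebra_simps)
    moreover have "(1/6) * (1/3) ^ k * (4::real) ^ k \<le> (1/6) * (1/3) ^ k * ?a"
      using N[of k] by (intro mult_left_mono) auto
    ultimately show ?thesis by (simp add: power_divide)
  qed
  then have "(4/3) ^ k \<le> 6 * c" for k :: nat using mult_left_mono[of _ c 6] by fastforce
  moreover obtain k :: nat where "6 * c < (4/3) ^ k" using real_arch_pow[of "4/3" "6 * c"] by auto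
  ultimately show False by (meson linorder_not_le)
qed


section \<open>Strongly measurable functions\<close>

lemma strongly_measurable_compose2:
  assumes "strongly_measurable M f" "strongly_measurable M g"
    and "\<And>u v a b. u \<longlonglongrightarrow> a \<Longrightarrow> v \<longlonglongrightarrow> b \<Longrightarrow> (\<lambda>n::nat. h (u n) (v n)) \<longlonglongrightarrow> h a b"
  shows "strongly_measurable M (\<lambda>x. h (f x) (g x))"
proof -
  obtain s where s: "\<And>i. simple_function M (s i)" "\<And>x. x \<in> space M \<Longrightarrow> (\<lambda>i::nat. s i x) \<longlonglongrightarrow> f x"
    using assms(1) unfolding strongly_measurable_def by metis
  obtain t where t: "\<And>i. simple_function M (t i)" "\<And>x. x \<in> space M \<Longrightarrow> (\<lambda>i::nat. t i x) \<longlonglongrightarrow> g x"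
    using assms(2) unfolding strongly_measurable_def by metis
  show ?thesis unfolding strongly_measurable_def
  proof (intro exI[of _ "\<lambda>i x. h (s i x) (t i x)"] conjI allI ballI)
    show "simple_function M (\<lambda>x. h (s i x) (t i x))" for i
      by (rule simple_function_compose2[OF s(1) t(1)])
    show "(\<lambda>i. h (s i x) (t i x)) \<longlonglongrightarrow> h (f x) (g x)" if "x \<in> space M" for x
      by (rule assms(3)[OF s(2)[OF that] t(2)[OF that]])
  qed
qed

lemma simple_strongly_measurable: "simple_function M f \<Longrightarrow> strongly_measurable M f"
  unfolding strongly_measurable_def by (intro exI[of _ "\<lambda>_. f"]) auto

lemma strongly_measurable_add:
  "strongly_measurable M f \<Longrightarrow> strongly_measurable M g \<Longrightarrow> strongly_measurable M (\<lambda>x. f x + g x)"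
  by (rule strongly_measurable_compose2) (auto intro: tendsto_add)

lemma strongly_measurable_diff:
  "strongly_measurable M f \<Longrightarrow> strongly_measurable M g \<Longrightarrow> strongly_measurable M (\<lambda>x. f x - g x)"
  by (rule strongly_measurable_compose2) (auto intro: tendsto_diff)

lemma strongly_measurable_scaleR:
  "strongly_measurable M f \<Longrightarrow> strongly_measurable M g \<Longrightarrow> strongly_measurable M (\<lambda>x. f x *\<^sub>R g x)"
  by (rule strongly_measurable_compose2) (auto intro: tendsto_scaleR)

lemma strongly_measurable_inner:
  "strongly_measurable M f \<Longrightarrow> strongly_measurable M g \<Longrightarrow> strongly_measurable M (\<lambda>x. f x \<bullet> g x)"
  by (rule strongly_measurable_compose2) (auto intro: tendsto_inner)

lemma strongly_measurable_const: "strongly_measurable M (\<lambda>x. c)"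
  by (rule simple_strongly_measurable) simp

lemma strongly_measurable_real:
  assumes "f \<in> borel_measurable M"
  shows "strongly_measurable M (f :: _ \<Rightarrow> real)"
  using borel_measurable_implies_sequence_metric[OF assms, of 0]
  unfolding strongly_measurable_def by blast

lemma strongly_measurable_borel:
  assumes "strongly_measurable M f"
  shows "f \<in> borel_measurable M"
proof -
  obtain s where "\<And>i. simple_function M (s i)" "\<And>x. x \<in> space M \<Longrightarrow> (\<lambda>i::nat. s i x) \<longlonglongrightarrow> f x"
    using assms unfolding strongly_measurable_def by metis
  then show ?thesis
    using borel_measurable_LIMSEQ_metric[of s M f] borel_measurable_simple_function by blast
qed

lemma strongly_measurable_norm:
  "strongly_measurable M f \<Longrightarrow> (\<lambda>x. norm (f x)) \<in> borel_measurable M"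
  by (drule strongly_measurable_borel) measurable

lemma measurable_blinfun_comp:
  fixes y :: "'a::real_normed_vector \<Rightarrow>\<^sub>L real"
  shows "f \<in> borel_measurable M \<Longrightarrow> (\<lambda>x. y (f x)) \<in> borel_measurable M"
  by (rule measurable_compose[OF _ borel_measurable_continuous_onI])
    (auto intro!: continuous_intros)

lemma strongly_measurable_restrict_space:
  assumes "strongly_measurable M f"
  shows "strongly_measurable (restrict_space M A) f"
proof -
  obtain s where s: "\<And>i. simple_function M (s i)" "\<And>x. x \<in> space M \<Longrightarrow> (\<lambda>i::nat. s i x) \<longlonglongrightarrow> f x"
    using assms unfolding strongly_measurable_def by metis
  have "simple_function (restrict_space M A) (s i)" for i
    using s(1)[of i] unfolding simple_function_eq_measurable
    by (auto simp: space_restrict_space intro: measurable_restrict_space1 finite_subset[of _ "s i ` space M"])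
  then show ?thesis
    unfolding strongly_measurable_def using s(2) by (intro exI[of _ s]) (auto simp: space_restrict_space)
qed

text \<open>Approximants are cut to 0 wherever they exceed \<open>2 * norm (f x)\<close>. The factor
  2 leaves room, so that the cut is eventually inactive where \<open>f x\<close> is nonzero; where
  \<open>f x = 0\<close> it forces the value 0. The bound is what dominated convergence
  needs.\<close>

lemma dominated_simple_sequence:
  assumes f: "strongly_measurable M f"
  obtains s where "\<And>i. simple_function M (s i)"
    "\<And>x. x \<in> space M \<Longrightarrow> (\<lambda>i::nat. s i x) \<longlonglongrightarrow> f x"
    "\<And>i x. norm (s i x) \<le> 2 * norm (f x)"
proof -
  obtain s where s: "\<And>i. simple_function M (s i)" "\<And>x. x \<in> space M \<Longrightarrow> (\<lambda>i::nat. s i x) \<longlonglongrightarrow> f x"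
    using assms unfolding strongly_measurable_def by metis
  have [measurable]: "(\<lambda>x. norm (f x)) \<in> borel_measurable M" "(\<lambda>x. norm (s i x)) \<in> borel_measurable M" for i
    using f s(1) by (auto intro!: strongly_measurable_norm simple_strongly_measurable)
  define t where "t i x = (if norm (s i x) \<le> 2 * norm (f x) then s i x else 0)" for i x
  have "simple_function M (t i)" for i
    unfolding t_def using s(1) by (intro simple_function_If) auto
  moreover have "(\<lambda>i. t i x) \<longlonglongrightarrow> f x" if x: "x \<in> space M" for x
  proof (cases "f x = 0")
    case True
    then have "t i x = 0" for i by (simp add: t_def)
    then show ?thesis using True by simp
  next
    case False
    have "(\<lambda>i. norm (s i x)) \<longlonglongrightarrow> norm (f x)" using s(2)[OF x] by (rule tendsto_norm)
    then have "eventually (\<lambda>i. norm (s i x) < 2 * norm (f x)) sequentially"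
      by (rule order_tendstoD) (use False in auto)
    then have "eventually (\<lambda>i. s i x = t i x) sequentially"
      by eventually_elim (simp add: t_def)
    with s(2)[OF x] show ?thesis by (rule Lim_transform_eventually)
  qed
  moreover have "norm (t i x) \<le> 2 * norm (f x)" for i x by (simp add: t_def)
  ultimately show ?thesis by (rule that)
qed

text \<open>Dominated convergence with majorant \<open>3 * norm (f x)\<close> makes the dominated
  simple functions converge in mean; their integrals are then Cauchy, and completeness of the target
  gives the value.\<close>

lemma has_strong_integral_exists:
  fixes f :: "'a \<Rightarrow> 'b::banach"
  assumes f: "strongly_measurable M f" and int: "integrable M (\<lambda>x. norm (f x))"
  obtains I where "has_strong_integral M f I"
proof -
  obtain s where s: "\<And>i. simple_function M (s i)"
    "\<And>x. x \<in> space M \<Longrightarrow> (\<lambda>i::nat. s i x) \<longlonglongrightarrow> f x"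
    "\<And>i x. norm (s i x) \<le> 2 * norm (f x)"
    using dominated_simple_sequence[OF f] by blast
  have fin: "(\<integral>\<^sup>+x. ennreal (3 * norm (f x)) \<partial>M) < \<infinity>"
    using int by (simp add: nn_integral_cmult ennreal_mult ennreal_mult_less_top integrable_iff_bounded)
  have sm: "strongly_measurable M (s i)" for i using s(1) by (rule simple_strongly_measurable)
  have [measurable]: "(\<lambda>x. norm (f x)) \<in> borel_measurable M" "(\<lambda>x. norm (f x - s i x)) \<in> borel_measurable M"
      "(\<lambda>x. norm (s i x - s j x)) \<in> borel_measurable M" for i j
    using f sm by (auto intro!: strongly_measurable_norm strongly_measurable_diff)
  have sbi: "Bochner_Integration.simple_bochner_integrable M (s i)" for i
  proof (rule simple_bochner_integrableI_bounded[OF s(1)])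
    have "(\<integral>\<^sup>+x. norm (s i x) \<partial>M) \<le> (\<integral>\<^sup>+x. ennreal (3 * norm (f x)) \<partial>M)"
      using s(3)[of i] by (intro nn_integral_mono ennreal_leI) (smt (verit) norm_ge_zero)
    then show "(\<integral>\<^sup>+x. norm (s i x) \<partial>M) < \<infinity>" using fin by (rule le_less_trans)
  qed
  define a where "a i = (\<integral>\<^sup>+x. ennreal (norm (f x - s i x)) \<partial>M)" for i
  have "a \<longlonglongrightarrow> (\<integral>\<^sup>+x. 0 \<partial>M)"
    unfolding a_def
  proof (rule nn_integral_dominated_convergence[where w = "\<lambda>x. ennreal (3 * norm (f x))"])
    show "AE x in M. ennreal (norm (f x - s i x)) \<le> ennreal (3 * norm (f x))" for i
    proof (intro AE_I2 ennreal_leI)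
      fix x show "norm (f x - s i x) \<le> 3 * norm (f x)"
        using s(3)[of i x] norm_triangle_ineq4[of "f x" "s i x"] by linarith
    qed
    show "AE x in M. (\<lambda>i. ennreal (norm (f x - s i x))) \<longlonglongrightarrow> 0"
    proof (rule AE_I2)
      fix x assume "x \<in> space M"
      from tendsto_norm[OF tendsto_diff[OF tendsto_const[of "f x"] s(2)[OF this]]]
      have "(\<lambda>i. norm (f x - s i x)) \<longlonglongrightarrow> 0" by simp
      then show "(\<lambda>i. ennreal (norm (f x - s i x))) \<longlonglongrightarrow> 0"
        using tendsto_ennrealI by fastforce
    qed
  qed (use fin in auto)
  then have a0: "a \<longlonglongrightarrow> 0" by simp
  define I where "I i = Bochner_Integration.simple_bochner_integral M (s i)" for i
  have le: "ennreal (norm (I i - I j)) \<le> a i + a j" for i j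
  proof -
    have "ennreal (norm (I i - I j)) = norm (Bochner_Integration.simple_bochner_integral M (\<lambda>x. s i x - s j x))"
      unfolding I_def using sbi by (subst simple_bochner_integral_diff) auto
    also have "\<dots> \<le> Bochner_Integration.simple_bochner_integral M (\<lambda>x. norm (s i x - s j x))"
      using simple_bochner_integrable_compose2[of "(-)" M "s i" "s j"] sbi
      by (auto intro!: simple_bochner_integral_norm_bound)
    also have "\<dots> = (\<integral>\<^sup>+x. norm (s i x - s j x) \<partial>M)"
      using simple_bochner_integrable_compose2[of "\<lambda>x y. norm (x - y)" M "s i" "s j"] sbi
      by (auto intro!: simple_bochner_integral_eq_nn_integral)
    also have "\<dots> \<le> (\<integral>\<^sup>+x. ennreal (norm (f x - s i x)) + ennreal (norm (f x - s j x)) \<partial>M)"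
    proof (rule nn_integral_mono)
      fix x
      have "norm (s i x - s j x) \<le> norm (f x - s i x) + norm (f x - s j x)"
        using norm_triangle_ineq4[of "f x - s j x" "f x - s i x"] by simp
      then show "ennreal (norm (s i x - s j x)) \<le> ennreal (norm (f x - s i x)) + ennreal (norm (f x - s j x))"
        by (simp add: ennreal_leI flip: ennreal_plus)
    qed
    also have "\<dots> = a i + a j" unfolding a_def by (rule nn_integral_add) auto
    finally show ?thesis .
  qed
  have "Cauchy I"
  proof (rule metric_CauchyI)
    fix e :: real assume e: "e > 0"
    have "eventually (\<lambda>i. a i < ennreal (e / 2)) sequentially"
      using a0 by (rule order_tendstoD) (use e in auto)
    then obtain N where N: "\<And>i. i \<ge> N \<Longrightarrow> a i < ennreal (e / 2)"
      by (auto simp: eventually_sequentially)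
    show "\<exists>N. \<forall>m\<ge>N. \<forall>n\<ge>N. dist (I m) (I n) < e"
    proof (intro exI[of _ N] allI impI)
      fix m n assume "m \<ge> N" "n \<ge> N"
      then have "a m + a n < ennreal (e / 2) + ennreal (e / 2)" by (intro add_strict_mono N)
      also have "\<dots> = ennreal e" using e by (subst ennreal_plus[symmetric]) auto
      finally have "ennreal (norm (I m - I n)) < ennreal e" using le[of m n] by (rule le_less_trans[rotated])
      then show "dist (I m) (I n) < e" using e by (simp add: dist_norm ennreal_less_iff)
    qed
  qed
  then obtain L where "I \<longlonglongrightarrow> L" using Cauchy_convergent convergent_def by blast
  then have "has_strong_integral M f L"
    unfolding has_strong_integral_def
    using f sbi a0[unfolded a_def] unfolding I_def by (auto intro!: exI[of _ s])
  then show ?thesis by (rule that)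
qed

text \<open>Strong integrals are evaluated only through this passage to real Bochner integrals;
  \<open>y\<close> is applied to the approximating simple functions.\<close>

lemma has_strong_integral_functional:
  fixes y :: "'b::real_normed_vector \<Rightarrow>\<^sub>L real"
  assumes "has_strong_integral M f I"
  shows "has_bochner_integral M (\<lambda>x. y (f x)) (y I)"
proof -
  obtain s where f: "strongly_measurable M f" and s: "\<And>i. Bochner_Integration.simple_bochner_integrable M (s i)"
      "(\<lambda>i::nat. \<integral>\<^sup>+x. ennreal (norm (f x - s i x)) \<partial>M) \<longlonglongrightarrow> 0"
      "(\<lambda>i. Bochner_Integration.simple_bochner_integral M (s i)) \<longlonglongrightarrow> I"
    using assms unfolding has_strong_integral_def by blast
  show ?thesis
  proof (rule has_bochner_integral.intros[where s = "\<lambda>i x. y (s i x)"])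
    show "(\<lambda>x. y (f x)) \<in> borel_measurable M"
      by (intro measurable_blinfun_comp strongly_measurable_borel f)
    show "Bochner_Integration.simple_bochner_integrable M (\<lambda>x. y (s i x))" for i
      using simple_bochner_integrable_compose2[where p = "\<lambda>x _. y x", OF _ s(1)[of i] s(1)[of i]] by auto
    have sm: "strongly_measurable M (s i)" for i
      using s(1)[of i] by (auto elim: simple_bochner_integrable.cases intro: simple_strongly_measurable)
    have meas: "(\<lambda>x. norm (f x - s i x)) \<in> borel_measurable M" for i
      using f sm by (auto intro!: strongly_measurable_norm strongly_measurable_diff)
    have "(\<integral>\<^sup>+x. ennreal (norm (y (f x) - y (s i x))) \<partial>M) \<le>
        ennreal (norm y) * (\<integral>\<^sup>+x. ennreal (norm (f x - s i x)) \<partial>M)" for i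
    proof -
      have "(\<integral>\<^sup>+x. ennreal (norm (y (f x) - y (s i x))) \<partial>M) \<le>
          (\<integral>\<^sup>+x. ennreal (norm y) * ennreal (norm (f x - s i x)) \<partial>M)"
      proof (rule nn_integral_mono)
        fix x show "ennreal (norm (y (f x) - y (s i x))) \<le> ennreal (norm y) * ennreal (norm (f x - s i x))"
          using norm_blinfun[of y "f x - s i x"] by (simp add: blinfun.diff_right ennreal_leI flip: ennreal_mult)
      qed
      also have "\<dots> = ennreal (norm y) * (\<integral>\<^sup>+x. ennreal (norm (f x - s i x)) \<partial>M)"
        using meas by (intro nn_integral_cmult) auto
      finally show ?thesis .
    qed
    moreover have "(\<lambda>i. ennreal (norm y) * (\<integral>\<^sup>+x. ennreal (norm (f x - s i x)) \<partial>M)) \<longlonglongrightarrow> ennreal (norm y) * 0"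
      by (intro ennreal_tendsto_cmult s(2)) auto
    ultimately show "(\<lambda>i. \<integral>\<^sup>+x. ennreal (norm (y (f x) - y (s i x))) \<partial>M) \<longlonglongrightarrow> 0"
      by (subst tendsto_sandwich[OF _ _ tendsto_const, where h = "\<lambda>i. ennreal (norm y) * (\<integral>\<^sup>+x. ennreal (norm (f x - s i x)) \<partial>M)"]) auto
    have "Bochner_Integration.simple_bochner_integral M (\<lambda>x. y (s i x)) = y (Bochner_Integration.simple_bochner_integral M (s i))" for i
      by (rule simple_bochner_integral_linear[OF _ s(1)])
        (simp add: bounded_linear.linear blinfun.bounded_linear_right)
    then show "(\<lambda>i. Bochner_Integration.simple_bochner_integral M (\<lambda>x. y (s i x))) \<longlonglongrightarrow> y I"
      using blinfun.tendsto[OF tendsto_const s(3)] by simp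
  qed
qed

lemma square_integrable_inner:
  fixes f g :: "'a \<Rightarrow> 'h::real_inner"
  assumes "square_integrable M f" "square_integrable M g"
  shows "integrable M (\<lambda>x. f x \<bullet> g x)"
proof (rule Bochner_Integration.integrable_bound)
  show "integrable M (\<lambda>x. (norm (f x))\<^sup>2 + (norm (g x))\<^sup>2)"
    using assms by (auto simp: square_integrable_def)
  show "(\<lambda>x. f x \<bullet> g x) \<in> borel_measurable M"
    using assms by (auto simp: square_integrable_def intro!: strongly_measurable_borel strongly_measurable_inner)
  show "AE x in M. norm (f x \<bullet> g x) \<le> norm ((norm (f x))\<^sup>2 + (norm (g x))\<^sup>2)"
  proof (rule AE_I2)
    fix x
    have "norm (f x \<bullet> g x) \<le> norm (f x) * norm (g x)" by (simp add: Cauchy_Schwarz_ineq2)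
    also have "\<dots> \<le> (norm (f x))\<^sup>2 + (norm (g x))\<^sup>2"
      using sum_squares_bound[of "norm (f x)" "norm (g x)"]
        mult_nonneg_nonneg[OF norm_ge_zero norm_ge_zero, of "f x" "g x"] by linarith
    finally show "norm (f x \<bullet> g x) \<le> norm ((norm (f x))\<^sup>2 + (norm (g x))\<^sup>2)" by simp
  qed
qed

lemma square_integrable_add:
  assumes "square_integrable M f" "square_integrable M g"
  shows "square_integrable M (\<lambda>x. f x + g x)"
proof -
  have sm: "strongly_measurable M (\<lambda>x. f x + g x)"
    using assms by (auto simp: square_integrable_def intro: strongly_measurable_add)
  have "integrable M (\<lambda>x. (norm (f x + g x))\<^sup>2)"
  proof (rule Bochner_Integration.integrable_bound)
    show "integrable M (\<lambda>x. 2 * (norm (f x))\<^sup>2 + 2 * (norm (g x))\<^sup>2)"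
      using assms by (auto simp: square_integrable_def)
    show "(\<lambda>x. (norm (f x + g x))\<^sup>2) \<in> borel_measurable M"
      using strongly_measurable_norm[OF sm] by measurable
    show "AE x in M. norm ((norm (f x + g x))\<^sup>2) \<le> norm (2 * (norm (f x))\<^sup>2 + 2 * (norm (g x))\<^sup>2)"
    proof (rule AE_I2)
      fix x
      have "(norm (f x + g x))\<^sup>2 \<le> (norm (f x) + norm (g x))\<^sup>2"
        by (intro power_mono norm_triangle_ineq) auto
      also have "\<dots> \<le> 2 * (norm (f x))\<^sup>2 + 2 * (norm (g x))\<^sup>2"
        using sum_squares_bound[of "norm (f x)" "norm (g x)"] by (simp add: power2_sum)
      finally show "norm ((norm (f x + g x))\<^sup>2) \<le> norm (2 * (norm (f x))\<^sup>2 + 2 * (norm (g x))\<^sup>2)" by simp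
    qed
  qed
  with sm show ?thesis by (simp add: square_integrable_def)
qed

lemma square_integrable_scaleR:
  assumes "square_integrable M f" shows "square_integrable M (\<lambda>x. c *\<^sub>R f x)"
  using assms unfolding square_integrable_def
  by (auto simp: power_mult_distrib intro!: strongly_measurable_scaleR strongly_measurable_const)

lemma square_integrable_diff:
  assumes "square_integrable M f" "square_integrable M g"
  shows "square_integrable M (\<lambda>x. f x - g x)"
  using square_integrable_add[OF assms(1) square_integrable_scaleR[OF assms(2), of "-1"]] by simp

lemma (in finite_measure) simple_square_integrable:
  assumes "simple_function M f"
  shows "square_integrable M f"
  unfolding square_integrable_def
proof
  show "strongly_measurable M f" using assms by (rule simple_strongly_measurable)
  have "Bochner_Integration.simple_bochner_integrable M (\<lambda>x. (norm (f x))\<^sup>2)"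
    using simple_function_compose1[OF assms, of "\<lambda>x. (norm x)\<^sup>2"]
    by (auto simp: simple_bochner_integrable.simps)
  then show "integrable M (\<lambda>x. (norm (f x))\<^sup>2)"
    by (rule integrableI_simple_bochner_integrable)
qed


section \<open>The Riesz theorem in the space of square integrable functions\<close>

lemma Cauchy_if_summable_dist:
  fixes u :: "nat \<Rightarrow> 'a::metric_space"
  assumes "summable (\<lambda>k. dist (u k) (u (Suc k)))"
  shows "Cauchy u"
proof -
  define D where "D n = (\<Sum>k<n. dist (u k) (u (Suc k)))" for n
  have "convergent D" unfolding D_def using assms by (simp add: summable_iff_convergent)
  then have CD: "Cauchy D" by (rule convergent_Cauchy)
  have le: "dist (u m) (u (m + n)) \<le> D (m + n) - D m" for m n
  proof (induction n)
    case (Suc n)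
    have "dist (u m) (u (m + Suc n)) \<le> dist (u m) (u (m + n)) + dist (u (m + n)) (u (Suc (m + n)))"
      using dist_triangle[of "u m" "u (Suc (m + n))" "u (m + n)"] by simp
    with Suc show ?case by (simp add: D_def)
  qed simp
  have le': "dist (u m) (u n) \<le> dist (D m) (D n)" for m n
  proof (cases "m \<le> n")
    case True
    then obtain k where "n = m + k" using le_Suc_ex by blast
    then show ?thesis using le[of m k] by (simp add: dist_real_def)
  next
    case False
    then obtain k where "m = n + k" using le_Suc_ex nat_le_linear by blast
    then show ?thesis using le[of n k] by (simp add: dist_real_def dist_commute)
  qed
  show ?thesis
    using CD unfolding Cauchy_def by (meson le' le_less_trans)
qed

lemma null_sequence_le:
  fixes f :: "nat \<Rightarrow> 'a::real_normed_vector"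
  assumes "\<And>n. norm (f n) \<le> g n" "g \<longlonglongrightarrow> 0"
  shows "f \<longlonglongrightarrow> 0"
  by (rule Lim_null_comparison[OF _ assms(2)]) (use assms(1) in auto)

text \<open>Riesz-Fischer with a rate: a fast subsequence converges almost everywhere, and Fatou's
  lemma hands the explicit bound over to the limit.\<close>

lemma (in finite_measure) simple_square_complete:
  fixes v :: "nat \<Rightarrow> 'a \<Rightarrow> 'h::{real_inner,complete_space}"
  assumes sf: "\<And>n. simple_function M (v n)"
    and bnd: "\<And>m n. (\<integral>x. (norm (v m x - v n x))\<^sup>2 \<partial>M) \<le> 2 / real (Suc m) + 2 / real (Suc n)"
  obtains f where "square_integrable M f" "\<And>n. (\<integral>x. (norm (v n x - f x))\<^sup>2 \<partial>M) \<le> 2 / real (Suc n)"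
proof -
  \<comment> \<open>Along this subsequence the squared distances \<open>d k\<close> integrate to at
    most \<open>4 / 16^k\<close>, so that even after weighting by \<open>2^k\<close> they sum to a
    finite value.\<close>
  define r :: "nat \<Rightarrow> nat" where "r k = 16 ^ k" for k
  define d where "d k x = norm (v (r k) x - v (r (Suc k)) x)" for k x
  have sq: "square_integrable M (\<lambda>x. v m x - v n x)" for m n
    by (intro square_integrable_diff simple_square_integrable sf)
  have int: "integrable M (\<lambda>x. (norm (v m x - v n x))\<^sup>2)" for m n
    using sq by (auto simp: square_integrable_def)
  have [measurable]: "(\<lambda>x. norm (v m x - v n x)) \<in> borel_measurable M" for m n
    using sq by (intro strongly_measurable_norm) (auto simp: square_integrable_def)
  have [measurable]: "d k \<in> borel_measurable M" for k unfolding d_def by measurable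
  define G where "G = {x\<in>space M. (\<Sum>k. ennreal (2 ^ k * (d k x)\<^sup>2)) \<noteq> \<infinity>}"
  have [measurable]: "G \<in> sets M" unfolding G_def by measurable
  have AEG: "AE x in M. x \<in> G"
  proof -
    have le: "(\<integral>\<^sup>+x. ennreal (2 ^ k * (d k x)\<^sup>2) \<partial>M) \<le> ennreal (4 * (1 / 8) ^ k)" for k
    proof -
      have "(\<integral>\<^sup>+x. ennreal (2 ^ k * (d k x)\<^sup>2) \<partial>M) = ennreal (\<integral>x. 2 ^ k * (d k x)\<^sup>2 \<partial>M)"
        using int unfolding d_def by (intro nn_integral_eq_integral) auto
      also have "\<dots> = ennreal (2 ^ k * (\<integral>x. (d k x)\<^sup>2 \<partial>M))" by simp
      also have "\<dots> \<le> ennreal (2 ^ k * (4 / 16 ^ k))"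
      proof (intro ennreal_leI mult_left_mono)
        have "(\<integral>x. (d k x)\<^sup>2 \<partial>M) \<le> 2 / real (Suc (r k)) + 2 / real (Suc (r (Suc k)))"
          unfolding d_def by (rule bnd)
        also have "\<dots> \<le> 2 / 16 ^ k + 2 / 16 ^ k"
          by (intro add_mono divide_left_mono mult_pos_pos) (auto simp: r_def add_pos_pos)
        finally show "(\<integral>x. (d k x)\<^sup>2 \<partial>M) \<le> 4 / 16 ^ k" by simp
      qed auto
      also have "2 ^ k * (4 / 16 ^ k) = 4 * (1 / 8 :: real) ^ k"
        using power_mult_distrib[of "2::real" 8 k] by (simp add: power_divide)
      finally show ?thesis .
    qed
    have "(\<integral>\<^sup>+x. (\<Sum>k. ennreal (2 ^ k * (d k x)\<^sup>2)) \<partial>M) = (\<Sum>k. \<integral>\<^sup>+x. ennreal (2 ^ k * (d k x)\<^sup>2) \<partial>M)"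
      by (rule nn_integral_suminf) measurable
    also have "\<dots> \<le> (\<Sum>k. ennreal (4 * (1 / 8) ^ k))" by (intro suminf_le le) auto
    also have "\<dots> = ennreal (\<Sum>k. 4 * (1 / 8) ^ k)"
      by (intro suminf_ennreal2 summable_mult summable_geometric) auto
    also have "\<dots> < \<infinity>" by simp
    finally have "AE x in M. (\<Sum>k. ennreal (2 ^ k * (d k x)\<^sup>2)) \<noteq> \<infinity>"
      by (intro nn_integral_PInf_AE) auto
    then show ?thesis unfolding G_def by auto
  qed
  \<comment> \<open>The value 0 off \<open>G\<close> makes \<open>f\<close> an everywhere limit of
    simple functions, as strong measurability demands, and not just an almost everywhere
    one.\<close>
  define f where "f x = (if x \<in> G then lim (\<lambda>k. v (r k) x) else 0)" for x
  have lim: "(\<lambda>k. v (r k) x) \<longlonglongrightarrow> f x" if x: "x \<in> G" for x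
  proof -
    have s1: "summable (\<lambda>k. 2 ^ k * (d k x)\<^sup>2)"
      using x unfolding G_def by (intro summable_suminf_not_top) auto
    have s2: "summable (\<lambda>k. (1 / 2 :: real) ^ k)" by (intro summable_geometric) auto
    have "summable (\<lambda>k. d k x)"
    proof (rule summable_comparison_test'[OF summable_add[OF s1 s2], of 0])
      fix k
      \<comment> \<open>Convergence of the weighted squares gives convergence of the distances
        themselves, since \<open>2 d <= 2^k d^2 + 2^-k\<close>.\<close>
      have "0 \<le> (2 ^ k * d k x - 1)\<^sup>2" by simp
      then have "2 * (2 ^ k * d k x) \<le> 2 ^ k * (2 ^ k * (d k x)\<^sup>2) + 1"
        unfolding power2_diff power_mult_distrib by (simp add: power2_eq_square algebra_simps)
      then have "2 ^ k * (2 * d k x) \<le> 2 ^ k * (2 ^ k * (d k x)\<^sup>2 + (1/2) ^ k)"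
        by (simp add: algebra_simps flip: power_mult_distrib)
      then have "2 * d k x \<le> 2 ^ k * (d k x)\<^sup>2 + (1/2) ^ k" by (rule mult_left_le_imp_le) simp
      moreover have "d k x \<ge> 0" by (simp add: d_def)
      ultimately show "norm (d k x) \<le> 2 ^ k * (d k x)\<^sup>2 + (1/2) ^ k" by simp
    qed
    then have "Cauchy (\<lambda>k. v (r k) x)"
      by (intro Cauchy_if_summable_dist) (simp add: dist_norm d_def)
    then show ?thesis
      using x Cauchy_convergent[of "\<lambda>k. v (r k) x"] by (simp add: f_def convergent_LIMSEQ_iff)
  qed
  have fm: "strongly_measurable M f"
    unfolding strongly_measurable_def
  proof (intro exI[of _ "\<lambda>k x. if x \<in> G then v (r k) x else 0"] conjI allI ballI)
    show "simple_function M (\<lambda>x. if x \<in> G then v (r k) x else 0)" for k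
      by (intro simple_function_If_set sf) auto
    show "(\<lambda>k. if x \<in> G then v (r k) x else 0) \<longlonglongrightarrow> f x" for x
      using lim[of x] by (cases "x \<in> G") (auto simp: f_def)
  qed
  have fat: "(\<integral>\<^sup>+x. ennreal ((norm (v n x - f x))\<^sup>2) \<partial>M) \<le> ennreal (2 / real (Suc n))" for n
  proof -
    have "(\<integral>\<^sup>+x. ennreal ((norm (v n x - f x))\<^sup>2) \<partial>M) =
        (\<integral>\<^sup>+x. liminf (\<lambda>k. ennreal ((norm (v n x - v (r k) x))\<^sup>2)) \<partial>M)"
    proof (rule nn_integral_cong_AE)
      show "AE x in M. ennreal ((norm (v n x - f x))\<^sup>2) = liminf (\<lambda>k. ennreal ((norm (v n x - v (r k) x))\<^sup>2))"
        using AEG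
      proof eventually_elim
        case (elim x)
        have "(\<lambda>k. ennreal ((norm (v n x - v (r k) x))\<^sup>2)) \<longlonglongrightarrow> ennreal ((norm (v n x - f x))\<^sup>2)"
          by (intro tendsto_ennrealI tendsto_power tendsto_norm tendsto_diff tendsto_const lim elim)
        then show ?case by (intro lim_imp_Liminf[symmetric]) auto
      qed
    qed
    also have "\<dots> \<le> liminf (\<lambda>k. \<integral>\<^sup>+x. ennreal ((norm (v n x - v (r k) x))\<^sup>2) \<partial>M)"
      by (rule nn_integral_liminf) measurable
    also have "\<dots> \<le> liminf (\<lambda>k. ennreal (2 / real (Suc n) + 2 / real (Suc (r k))))"
    proof (intro Liminf_mono always_eventually allI)
      fix k
      have "(\<integral>\<^sup>+x. ennreal ((norm (v n x - v (r k) x))\<^sup>2) \<partial>M) = ennreal (\<integral>x. (norm (v n x - v (r k) x))\<^sup>2 \<partial>M)"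
        by (intro nn_integral_eq_integral int) auto
      also have "\<dots> \<le> ennreal (2 / real (Suc n) + 2 / real (Suc (r k)))" by (intro ennreal_leI bnd)
      finally show "(\<integral>\<^sup>+x. ennreal ((norm (v n x - v (r k) x))\<^sup>2) \<partial>M) \<le> ennreal (2 / real (Suc n) + 2 / real (Suc (r k)))" .
    qed
    also have "liminf (\<lambda>k. ennreal (2 / real (Suc n) + 2 / real (Suc (r k)))) = ennreal (2 / real (Suc n) + 0)"
    proof (intro lim_imp_Liminf tendsto_ennrealI tendsto_add tendsto_const)
      have "filterlim r at_top sequentially"
      proof (rule filterlim_at_top_mono[OF filterlim_ident])
        show "eventually (\<lambda>k. k \<le> r k) sequentially"
          unfolding r_def using power_gt_expt[of 16] by (auto intro: less_imp_le)
      qed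
      then have "filterlim (\<lambda>k. Suc (r k)) at_top sequentially"
        by (rule filterlim_compose[OF filterlim_Suc])
      from filterlim_compose[OF filterlim_real_sequentially this]
      show "(\<lambda>k. 2 / real (Suc (r k))) \<longlonglongrightarrow> 0" by (rule real_tendsto_divide_at_top[OF tendsto_const])
    qed simp
    finally show ?thesis by simp
  qed
  have sqd: "square_integrable M (\<lambda>x. v n x - f x)" for n
    unfolding square_integrable_def
  proof
    show sm: "strongly_measurable M (\<lambda>x. v n x - f x)"
      by (rule strongly_measurable_diff[OF simple_strongly_measurable[OF sf] fm])
    show "integrable M (\<lambda>x. (norm (v n x - f x))\<^sup>2)"
      using le_less_trans[OF fat[of n] ennreal_less_top] strongly_measurable_norm[OF sm]
      by (intro integrableI_nonneg) auto
  qed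
  show ?thesis
  proof (rule that)
    have "square_integrable M (\<lambda>x. v 0 x - (v 0 x - f x))"
      by (intro square_integrable_diff sqd simple_square_integrable sf)
    then show "square_integrable M f" by simp
    show "(\<integral>x. (norm (v n x - f x))\<^sup>2 \<partial>M) \<le> 2 / real (Suc n)" for n
    proof -
      have "ennreal (\<integral>x. (norm (v n x - f x))\<^sup>2 \<partial>M) = (\<integral>\<^sup>+x. ennreal ((norm (v n x - f x))\<^sup>2) \<partial>M)"
        using sqd by (intro nn_integral_eq_integral[symmetric]) (auto simp: square_integrable_def)
      then have "ennreal (\<integral>x. (norm (v n x - f x))\<^sup>2 \<partial>M) \<le> ennreal (2 / real (Suc n))"
        using fat[of n] by simp
      then show ?thesis by (subst (asm) ennreal_le_iff) auto
    qed
  qed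
qed

text \<open>The representing function is built from simple functions alone and represents
  \<open>\<phi>\<close> on them first; both sides are continuous along a dominated simple
  approximation of \<open>h\<close>, which extends the identity to all \<open>h\<close>.\<close>

theorem (in finite_measure) riesz_square_integrable:
  fixes \<phi> :: "('a \<Rightarrow> 'h::{real_inner,complete_space}) \<Rightarrow> real"
  assumes add: "\<And>f g. square_integrable M f \<Longrightarrow> square_integrable M g \<Longrightarrow> \<phi> (\<lambda>x. f x + g x) = \<phi> f + \<phi> g"
    and scl: "\<And>c f. square_integrable M f \<Longrightarrow> \<phi> (\<lambda>x. c *\<^sub>R f x) = c * \<phi> f"
    and bnd: "\<And>f. square_integrable M f \<Longrightarrow> \<bar>\<phi> f\<bar> \<le> C * sqrt (\<integral>x. (norm (f x))\<^sup>2 \<partial>M)"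
  obtains f where "square_integrable M f" "\<And>h. square_integrable M h \<Longrightarrow> \<phi> h = (\<integral>x. h x \<bullet> f x \<partial>M)"
proof -
  have ii: "integrable M (\<lambda>x. f x \<bullet> g x)" if "simple_function M f" "simple_function M g" for f g :: "'a \<Rightarrow> 'h"
    using that by (intro square_integrable_inner simple_square_integrable)
  obtain v :: "nat \<Rightarrow> 'a \<Rightarrow> 'h" where v: "\<And>n. v n \<in> {f. simple_function M f}"
    "\<And>m n. (\<integral>x. (v m x + (- 1) *\<^sub>R v n x) \<bullet> (v m x + (- 1) *\<^sub>R v n x) \<partial>M) \<le> 2 / real (Suc m) + 2 / real (Suc n)"
    "\<And>w. w \<in> {f. simple_function M f} \<Longrightarrow> (\<lambda>n. \<integral>x. v n x \<bullet> w x \<partial>M) \<longlonglongrightarrow> \<phi> w"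
  proof (rule riesz_sequence[of "{f. simple_function M f}" "\<lambda>f g x. f x + g x" "\<lambda>c f x. c *\<^sub>R f x"
        "\<lambda>f g. \<integral>x. f x \<bullet> g x \<partial>M" \<phi> C])
    show "{f. simple_function M (f :: 'a \<Rightarrow> 'h)} \<noteq> {}" using simple_function_const[of M 0] by blast
    show "(\<integral>x. (u x + v x) \<bullet> w x \<partial>M) = (\<integral>x. u x \<bullet> w x \<partial>M) + (\<integral>x. v x \<bullet> w x \<partial>M)"
      if "u \<in> {f. simple_function M f}" "v \<in> {f. simple_function M f}" "w \<in> {f. simple_function M f}"
      for u v w :: "'a \<Rightarrow> 'h"
      using that ii by (simp add: inner_add_left)
    show "(\<integral>x. u x \<bullet> w x \<partial>M) = (\<integral>x. w x \<bullet> u x \<partial>M)" for u w :: "'a \<Rightarrow> 'h"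
      by (simp add: inner_commute)
    show "(\<lambda>x. c *\<^sub>R v x) \<in> {f. simple_function M f}" if "v \<in> {f. simple_function M f}"
      for c and v :: "'a \<Rightarrow> 'h"
      using that simple_function_compose1[of M v "\<lambda>x. c *\<^sub>R x"] by simp
    show "\<bar>\<phi> u\<bar> \<le> C * sqrt (\<integral>x. u x \<bullet> u x \<partial>M)" if "u \<in> {f. simple_function M f}" for u
      using bnd[of u] simple_square_integrable[of u] that by (simp add: power2_norm_eq_inner)
  qed (auto simp: add scl simple_square_integrable)
  have sf: "simple_function M (v n)" for n using v(1) by simp
  have "(\<integral>x. (norm (v m x - v n x))\<^sup>2 \<partial>M) \<le> 2 / real (Suc m) + 2 / real (Suc n)" for m n
    using v(2)[of m n] by (simp add: power2_norm_eq_inner)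
  from simple_square_complete[OF sf this] obtain f where f: "square_integrable M f"
      and fb: "\<And>n. (\<integral>x. (norm (v n x - f x))\<^sup>2 \<partial>M) \<le> 2 / real (Suc n)" by blast
  have simp_eq: "\<phi> w = (\<integral>x. w x \<bullet> f x \<partial>M)" if w: "simple_function M w" for w
  proof -
    have sw: "square_integrable M w" using w by (rule simple_square_integrable)
    \<comment> \<open>With \<open>\<delta>\<close> bounding the distance from \<open>v n\<close> to
      \<open>f\<close>, the pointwise inequality
      \<open>a b <= a^2 / (2 \<delta>) + \<delta> b^2 / 2\<close> integrates to
      \<open>c * \<delta>\<close>, in place of the Cauchy-Schwarz inequality for integrals.\<close>
    define c where "c = (1 + (\<integral>x. (norm (w x))\<^sup>2 \<partial>M)) / 2"
    have "norm ((\<integral>x. v n x \<bullet> w x \<partial>M) - (\<integral>x. w x \<bullet> f x \<partial>M)) \<le> c * sqrt (2 / real (Suc n))" for n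
    proof -
      define \<delta> where "\<delta> = sqrt (2 / real (Suc n))"
      have \<delta>: "\<delta> > 0" "\<delta>\<^sup>2 = 2 / real (Suc n)" by (auto simp: \<delta>_def)
      have sd: "square_integrable M (\<lambda>x. v n x - f x)"
        by (intro square_integrable_diff f simple_square_integrable sf)
      have "(\<integral>x. v n x \<bullet> w x \<partial>M) - (\<integral>x. w x \<bullet> f x \<partial>M) = (\<integral>x. (v n x - f x) \<bullet> w x \<partial>M)"
        using square_integrable_inner[OF simple_square_integrable[OF sf] sw, of n]
          square_integrable_inner[OF f sw]
        by (simp add: inner_diff_left inner_commute[of "w _"])
      also have "norm \<dots> \<le> (\<integral>x. (1 / (2 * \<delta>)) * (norm (v n x - f x))\<^sup>2 + (\<delta> / 2) * (norm (w x))\<^sup>2 \<partial>M)"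
      proof (rule order_trans[OF integral_norm_bound], rule integral_mono)
        show "integrable M (\<lambda>x. norm ((v n x - f x) \<bullet> w x))"
          using square_integrable_inner[OF sd sw] by simp
        show "integrable M (\<lambda>x. (1 / (2 * \<delta>)) * (norm (v n x - f x))\<^sup>2 + (\<delta> / 2) * (norm (w x))\<^sup>2)"
          using sd sw by (auto simp: square_integrable_def)
        fix x
        let ?a = "norm (v n x - f x)" and ?b = "norm (w x)"
        have "norm ((v n x - f x) \<bullet> w x) \<le> ?a * ?b" by (simp add: Cauchy_Schwarz_ineq2)
        also have "\<dots> \<le> (1 / (2 * \<delta>)) * ?a\<^sup>2 + (\<delta> / 2) * ?b\<^sup>2"
        proof -
          have "0 \<le> (?a - \<delta> * ?b)\<^sup>2 / (2 * \<delta>)" using \<delta>(1) by simp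
          also have "\<dots> = (1 / (2 * \<delta>)) * ?a\<^sup>2 + (\<delta> / 2) * ?b\<^sup>2 - ?a * ?b"
            using \<delta>(1) by (simp add: power2_eq_square field_simps)
          finally show ?thesis by simp
        qed
        finally show "norm ((v n x - f x) \<bullet> w x) \<le> (1 / (2 * \<delta>)) * ?a\<^sup>2 + (\<delta> / 2) * ?b\<^sup>2" .
      qed
      also have "\<dots> = (1 / (2 * \<delta>)) * (\<integral>x. (norm (v n x - f x))\<^sup>2 \<partial>M) + (\<delta> / 2) * (\<integral>x. (norm (w x))\<^sup>2 \<partial>M)"
        using sd sw by (auto simp: square_integrable_def)
      also have "\<dots> \<le> (1 / (2 * \<delta>)) * \<delta>\<^sup>2 + (\<delta> / 2) * (\<integral>x. (norm (w x))\<^sup>2 \<partial>M)"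
        using fb[of n] \<delta> by (intro add_mono mult_left_mono) auto
      also have "\<dots> = c * \<delta>" using \<delta>(1) by (simp add: c_def power2_eq_square field_simps)
      finally show ?thesis by (simp add: \<delta>_def)
    qed
    moreover have "(\<lambda>n. c * sqrt (2 / real (Suc n))) \<longlonglongrightarrow> 0"
    proof -
      have "(\<lambda>n. c * sqrt (2 / real (Suc n))) \<longlonglongrightarrow> c * sqrt 0"
      by (intro tendsto_intros real_tendsto_divide_at_top[OF tendsto_const]
          filterlim_compose[OF filterlim_real_sequentially filterlim_Suc])
      then show ?thesis by simp
    qed
    ultimately have "(\<lambda>n. (\<integral>x. v n x \<bullet> w x \<partial>M) - (\<integral>x. w x \<bullet> f x \<partial>M)) \<longlonglongrightarrow> 0"
      by (rule null_sequence_le)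
    then have "(\<lambda>n. \<integral>x. v n x \<bullet> w x \<partial>M) \<longlonglongrightarrow> (\<integral>x. w x \<bullet> f x \<partial>M)" by (simp add: LIM_zero_iff)
    with v(3)[of w] w show ?thesis by (auto intro: LIMSEQ_unique)
  qed
  show ?thesis
  proof (rule that[OF f])
    fix h :: "'a \<Rightarrow> 'h" assume h: "square_integrable M h"
    then have hm: "strongly_measurable M h" and hi: "integrable M (\<lambda>x. (norm (h x))\<^sup>2)"
      by (auto simp: square_integrable_def)
    obtain s where s: "\<And>i. simple_function M (s i)"
        "\<And>x. x \<in> space M \<Longrightarrow> (\<lambda>i::nat. s i x) \<longlonglongrightarrow> h x" "\<And>i x. norm (s i x) \<le> 2 * norm (h x)"
      using dominated_simple_sequence[OF hm] by blast
    have ss: "square_integrable M (s i)" for i using s(1) by (rule simple_square_integrable)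
    have sd: "square_integrable M (\<lambda>x. s i x - h x)" for i by (intro square_integrable_diff ss h)
    have "(\<lambda>i. \<integral>x. (norm (s i x - h x))\<^sup>2 \<partial>M) \<longlonglongrightarrow> (\<integral>x. 0 \<partial>M)"
    \<comment> \<open>The 9 is the square of \<open>2 + 1\<close>: \<open>s i\<close> is bounded by
      twice \<open>h\<close>, and \<open>h\<close> is subtracted.\<close>
    proof (rule integral_dominated_convergence[where w = "\<lambda>x. 9 * (norm (h x))\<^sup>2"])
      show "(\<lambda>x. (norm (s i x - h x))\<^sup>2) \<in> borel_measurable M" for i
        using sd[of i] by (auto simp: square_integrable_def)
      show "AE x in M. (\<lambda>i. (norm (s i x - h x))\<^sup>2) \<longlonglongrightarrow> 0"
      proof (rule AE_I2)
        fix x assume "x \<in> space M"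
        from tendsto_power[OF tendsto_norm[OF tendsto_diff[OF s(2)[OF this] tendsto_const[of "h x"]]], of 2]
        show "(\<lambda>i. (norm (s i x - h x))\<^sup>2) \<longlonglongrightarrow> 0" by simp
      qed
      show "AE x in M. norm ((norm (s i x - h x))\<^sup>2) \<le> 9 * (norm (h x))\<^sup>2" for i
      proof (rule AE_I2)
        fix x
        have "norm (s i x - h x) \<le> 3 * norm (h x)"
          using s(3)[of i x] norm_triangle_ineq4[of "s i x" "h x"] by linarith
        then have "(norm (s i x - h x))\<^sup>2 \<le> (3 * norm (h x))\<^sup>2" by (intro power_mono) auto
        then show "norm ((norm (s i x - h x))\<^sup>2) \<le> 9 * (norm (h x))\<^sup>2" by (simp add: power_mult_distrib)
      qed
    qed (use hi in auto)
    then have "(\<lambda>i. C * sqrt (\<integral>x. (norm (s i x - h x))\<^sup>2 \<partial>M)) \<longlonglongrightarrow> C * sqrt 0"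
      by (intro tendsto_intros) simp
    then have s0: "(\<lambda>i. C * sqrt (\<integral>x. (norm (s i x - h x))\<^sup>2 \<partial>M)) \<longlonglongrightarrow> 0" by simp
    have "norm (\<phi> (s i) - \<phi> h) \<le> C * sqrt (\<integral>x. (norm (s i x - h x))\<^sup>2 \<partial>M)" for i
      using bnd[OF sd[of i]] add[OF ss[of i] square_integrable_scaleR[OF h, of "-1"]] scl[OF h, of "-1"] by simp
    then have "(\<lambda>i. \<phi> (s i) - \<phi> h) \<longlonglongrightarrow> 0"
      using s0 by (rule null_sequence_le)
    then have "(\<lambda>i. \<integral>x. s i x \<bullet> f x \<partial>M) \<longlonglongrightarrow> \<phi> h" by (simp add: LIM_zero_iff simp_eq s(1))
    moreover have "(\<lambda>i. \<integral>x. s i x \<bullet> f x \<partial>M) \<longlonglongrightarrow> (\<integral>x. h x \<bullet> f x \<partial>M)"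
    proof (rule integral_dominated_convergence[where w = "\<lambda>x. 4 * (norm (h x))\<^sup>2 + (norm (f x))\<^sup>2"])
      show "(\<lambda>x. s i x \<bullet> f x) \<in> borel_measurable M" for i
        using square_integrable_inner[OF ss f] by auto
      show "(\<lambda>x. h x \<bullet> f x) \<in> borel_measurable M" using square_integrable_inner[OF h f] by auto
      show "integrable M (\<lambda>x. 4 * (norm (h x))\<^sup>2 + (norm (f x))\<^sup>2)"
        using hi f by (auto simp: square_integrable_def)
      show "AE x in M. (\<lambda>i. s i x \<bullet> f x) \<longlonglongrightarrow> h x \<bullet> f x"
        using s(2) by (auto intro!: tendsto_inner)
      show "AE x in M. norm (s i x \<bullet> f x) \<le> 4 * (norm (h x))\<^sup>2 + (norm (f x))\<^sup>2" for i
      proof (rule AE_I2)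
        fix x
        have "norm (s i x \<bullet> f x) \<le> norm (s i x) * norm (f x)" by (simp add: Cauchy_Schwarz_ineq2)
        also have "\<dots> \<le> 2 * norm (h x) * norm (f x)" by (intro mult_right_mono s(3)) auto
        also have "\<dots> \<le> (2 * norm (h x))\<^sup>2 + (norm (f x))\<^sup>2"
          using sum_squares_bound[of "2 * norm (h x)" "norm (f x)"]
            mult_nonneg_nonneg[OF norm_ge_zero norm_ge_zero, of "h x" "f x"] by linarith
        finally show "norm (s i x \<bullet> f x) \<le> 4 * (norm (h x))\<^sup>2 + (norm (f x))\<^sup>2" by (simp add: power_mult_distrib)
      qed
    qed
    ultimately show "\<phi> h = (\<integral>x. h x \<bullet> f x \<partial>M)" by (rule LIMSEQ_unique)
  qed
qed


section \<open>Null controllability\<close>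

text \<open>The times may be 0, a point that \<open>at_right 0\<close> leaves out; continuity within
  \<open>{0..}\<close> includes it because \<open>S 0\<close> is the identity.\<close>

lemma C0_semigroup_tendsto_0:
  assumes S: "C0_semigroup S" and t: "\<And>n. t n \<ge> 0" "t \<longlonglongrightarrow> 0"
  shows "(\<lambda>n. S (t n) x) \<longlonglongrightarrow> x"
proof -
  have "((\<lambda>t. S t x) \<longlongrightarrow> S 0 x) (at 0 within {0..})"
    using S by (simp add: C0_semigroup_def at_within_Ici_at_right)
  then have "continuous (at 0 within {0..}) (\<lambda>t. S t x)" by (simp add: continuous_within)
  then have "((\<lambda>t. S t x) \<circ> t) \<longlonglongrightarrow> S 0 x"
    using t unfolding continuous_within_sequentially by (metis atLeast_iff)
  then show ?thesis using S by (simp add: C0_semigroup_def o_def)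
qed

text \<open>Were \<open>S\<close> unbounded on every \<open>{0..\<delta>}\<close>, there would be
  times \<open>t n\<close> tending to 0 with norms above \<open>n\<close>, although each
  \<open>S (t n) x\<close> converges; this contradicts uniform boundedness. The semigroup law
  carries the bound from \<open>{0..\<delta>}\<close> to \<open>{0..T}\<close>.\<close>

lemma C0_semigroup_bounded:
  fixes S :: "real \<Rightarrow> 'e::banach \<Rightarrow>\<^sub>L 'e"
  assumes S: "C0_semigroup S"
  obtains K where "\<And>t. 0 \<le> t \<Longrightarrow> t \<le> T \<Longrightarrow> norm (S t) \<le> K"
proof -
  have "\<exists>\<delta>>0. \<exists>c. \<forall>t\<in>{0..\<delta>}. norm (S t) \<le> c"
  proof (rule ccontr)
    assume neg: "\<not> ?thesis"
    have "\<exists>t. 0 \<le> t \<and> t \<le> 1 / real (Suc n) \<and> norm (S t) > real n" for n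
    proof (rule ccontr)
      assume "\<not> ?thesis"
      then have "\<forall>t\<in>{0..1 / real (Suc n)}. norm (S t) \<le> real n" by (auto simp: not_less)
      moreover have "1 / real (Suc n) > 0" by simp
      ultimately show False using neg by blast
    qed
    then obtain t where t: "\<And>n. 0 \<le> t n" "\<And>n. t n \<le> 1 / real (Suc n)" "\<And>n. norm (S (t n)) > real n"
      by metis
    have "(\<lambda>n. 1 / real (Suc n)) \<longlonglongrightarrow> 0"
      by (rule real_tendsto_divide_at_top[OF tendsto_const filterlim_compose[OF filterlim_real_sequentially filterlim_Suc]])
    then have "t \<longlonglongrightarrow> 0" by (rule null_sequence_le[rotated]) (use t in auto)
    then have lim: "(\<lambda>n. S (t n) x) \<longlonglongrightarrow> x" for x by (rule C0_semigroup_tendsto_0[OF S t(1)])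
    have "\<exists>c. \<forall>n. norm (S (t n) x) \<le> c" for x
    proof -
      have "Bseq (\<lambda>n. S (t n) x)" using lim convergent_def by (intro convergent_imp_Bseq) blast
      then show ?thesis by (auto simp: Bseq_def)
    qed
    from uniform_boundedness[OF this] obtain c where c: "\<And>n. norm (S (t n)) \<le> c" by auto
    obtain n where "c < real n" using reals_Archimedean2 by blast
    with c[of n] t(3)[of n] show False by simp
  qed
  then obtain \<delta> c0 where \<delta>: "\<delta> > 0" and c0: "\<And>t. 0 \<le> t \<Longrightarrow> t \<le> \<delta> \<Longrightarrow> norm (S t) \<le> c0"
    by (metis atLeastAtMost_iff)
  \<comment> \<open>A base of at least 1 makes the powers increase, so that times below
    \<open>\<delta>\<close> satisfy the bound of every later step too.\<close>
  define c where "c = max 1 c0"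
  have c: "c \<ge> 1" "\<And>t. 0 \<le> t \<Longrightarrow> t \<le> \<delta> \<Longrightarrow> norm (S t) \<le> c" using c0 by (fastforce simp: c_def)+
  have ind: "norm (S t) \<le> c ^ Suc n" if "0 \<le> t" "t \<le> real (Suc n) * \<delta>" for n t
    using that
  proof (induction n arbitrary: t)
    case 0 then show ?case using c(2) by simp
  next
    case (Suc n)
    show ?case
    proof (cases "t \<le> \<delta>")
      case True
      then have "norm (S t) \<le> c * 1" using c(2) Suc.prems by simp
      also have "\<dots> \<le> c * c ^ Suc n" using c(1) by (intro mult_left_mono one_le_power) auto
      finally show ?thesis by simp
    next
      case False
      have "S (\<delta> + (t - \<delta>)) = S \<delta> o\<^sub>L S (t - \<delta>)"
        using S False \<delta> unfolding C0_semigroup_def by (meson diff_ge_0_iff_ge less_imp_le not_le)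
      then have "norm (S t) \<le> norm (S \<delta>) * norm (S (t - \<delta>))" by (simp add: norm_blinfun_compose)
      also have "\<dots> \<le> c * c ^ Suc n"
        using False Suc.prems \<delta> c by (intro mult_mono Suc.IH c(2)) (auto simp: algebra_simps)
      finally show ?thesis by simp
    qed
  qed
  obtain n where "T / \<delta> < real n" using reals_Archimedean2 by blast
  then have "T \<le> real (Suc n) * \<delta>" using \<delta> by (simp add: field_simps)
  then show ?thesis using ind by (intro that[of "c ^ Suc n"]) auto
qed

lemma C0_semigroup_tendsto:
  fixes S :: "real \<Rightarrow> 'e::banach \<Rightarrow>\<^sub>L 'e"
  assumes S: "C0_semigroup S"
    and r: "\<And>n. 0 \<le> r n" "\<And>n. r n \<le> T" "0 \<le> t" "t \<le> T" "r \<longlonglongrightarrow> t" and u: "u \<longlonglongrightarrow> x"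
  shows "(\<lambda>n. S (r n) (u n)) \<longlonglongrightarrow> S t x"
proof -
  obtain K where K: "\<And>t. 0 \<le> t \<Longrightarrow> t \<le> T \<Longrightarrow> norm (S t) \<le> K" using C0_semigroup_bounded[OF S] by blast
  have Kb: "norm (S s y) \<le> K * norm y" if "0 \<le> s" "s \<le> T" for s y
    using norm_blinfun[of "S s" y] K[OF that] by (meson mult_right_mono norm_ge_zero order_trans)
  have S_add: "S (s + s') y = S s (S s' y)" if "0 \<le> s" "0 \<le> s'" for s s' y
    using S that by (simp add: C0_semigroup_def)
  \<comment> \<open>The semigroup at the smaller of the two times is factored out; its norm is at
    most \<open>K\<close>, and what remains is strong continuity at 0 for the time
    \<open>|r n - t|\<close>.\<close>
  have "norm (S (r n) x - S t x) \<le> K * norm (S \<bar>r n - t\<bar> x - x)" for n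
  proof (cases "r n \<le> t")
    case True
    then have "S (r n) x - S t x = - S (r n) (S \<bar>r n - t\<bar> x - x)"
      using S_add[of "r n" "\<bar>r n - t\<bar>" x] r(1) by (simp add: blinfun.diff_right)
    then show ?thesis using Kb[OF r(1) r(2), of n] by simp
  next
    case False
    then have "S (r n) x - S t x = S t (S \<bar>r n - t\<bar> x - x)"
      using S_add[of t "\<bar>r n - t\<bar>" x] r(3) by (simp add: blinfun.diff_right)
    then show ?thesis using Kb[OF r(3,4)] by simp
  qed
  moreover have "(\<lambda>n. K * norm (S \<bar>r n - t\<bar> x - x)) \<longlonglongrightarrow> 0"
  proof -
    have "(\<lambda>n. \<bar>r n - t\<bar>) \<longlonglongrightarrow> 0"
      using tendsto_rabs[OF tendsto_diff[OF r(5) tendsto_const[of t]]] by simp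
    then have "(\<lambda>n. S \<bar>r n - t\<bar> x) \<longlonglongrightarrow> x" by (intro C0_semigroup_tendsto_0[OF S]) auto
    from tendsto_mult[OF tendsto_const[of K] tendsto_norm[OF tendsto_diff[OF this tendsto_const[of x]]]]
    show ?thesis by simp
  qed
  ultimately have 1: "(\<lambda>n. S (r n) x - S t x) \<longlonglongrightarrow> 0" by (rule null_sequence_le)
  have "norm (S (r n) (u n - x)) \<le> K * norm (u n - x)" for n by (rule Kb[OF r(1,2)])
  moreover have "(\<lambda>n. K * norm (u n - x)) \<longlonglongrightarrow> 0"
    using tendsto_mult[OF tendsto_const[of K] tendsto_norm[OF tendsto_diff[OF u tendsto_const[of x]]]] by simp
  ultimately have 2: "(\<lambda>n. S (r n) (u n - x)) \<longlonglongrightarrow> 0" by (rule null_sequence_le)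
  have "(\<lambda>n. S (r n) (u n) - S t x) \<longlonglongrightarrow> 0"
    using tendsto_add[OF 1 2] by (simp add: blinfun.diff_right)
  then show ?thesis by (simp add: LIM_zero_iff)
qed

text \<open>Evaluating \<open>S\<close> at a simple time and a simple vector gives a simple
  function, so joint sequential continuity suffices; continuity or measurability of \<open>S\<close>
  in operator norm, which may fail, is avoided.\<close>

lemma strongly_measurable_semigroup:
  fixes S :: "real \<Rightarrow> 'e::banach \<Rightarrow>\<^sub>L 'e"
  assumes S: "C0_semigroup S" and f: "strongly_measurable M f"
    and r: "r \<in> borel_measurable M" "\<And>x. x \<in> space M \<Longrightarrow> 0 \<le> r x \<and> r x \<le> T"
  shows "strongly_measurable M (\<lambda>x. S (r x) (f x))"
proof -
  obtain s where s: "\<And>i. simple_function M (s i)" "\<And>x. x \<in> space M \<Longrightarrow> (\<lambda>i::nat. s i x) \<longlonglongrightarrow> f x"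
    using f unfolding strongly_measurable_def by metis
  obtain q where q: "\<And>i. simple_function M (q i)" "\<And>x. x \<in> space M \<Longrightarrow> (\<lambda>i::nat. q i x) \<longlonglongrightarrow> r x"
    using strongly_measurable_real[OF r(1)] unfolding strongly_measurable_def by metis
  show ?thesis
    unfolding strongly_measurable_def
  \<comment> \<open>The approximating times may leave \<open>{0..T}\<close>, where nothing is known
    about \<open>S\<close>; clamping keeps them inside without changing their limit.\<close>
  proof (intro exI[of _ "\<lambda>i x. S (max 0 (min T (q i x))) (s i x)"] conjI allI ballI)
    show "simple_function M (\<lambda>x. S (max 0 (min T (q i x))) (s i x))" for i
      by (rule simple_function_compose2[OF q(1) s(1)])
    fix x assume x: "x \<in> space M"
    have "(\<lambda>i. max 0 (min T (q i x))) \<longlonglongrightarrow> max 0 (min T (r x))"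
      by (intro tendsto_intros tendsto_max tendsto_min q(2) x)
    then have "(\<lambda>i. max 0 (min T (q i x))) \<longlonglongrightarrow> r x" using r(2)[OF x] by (simp add: min_absorb2)
    then show "(\<lambda>i. S (max 0 (min T (q i x))) (s i x)) \<longlonglongrightarrow> S (r x) (f x)"
      using r(2)[OF x] by (intro C0_semigroup_tendsto[OF S, where T = T] s(2)[OF x]) auto
  qed
qed

lemma finite_measure_lebesgue_on_interval: "finite_measure (lebesgue_on {a<..<b :: real})"
  by (rule finite_measure_lebesgue_on) (metis lmeasurable_box box_real(1))

section \<open>Controls and the operator representing the integrand\<close>

text \<open>Needed at every \<open>t\<close>, not only at \<open>T\<close>, because a mild solution
  has to be exhibited on the whole interval.\<close>

lemma control_integral_exists:
  fixes S :: "real \<Rightarrow> 'e::banach \<Rightarrow>\<^sub>L 'e" and f :: "real \<Rightarrow> 'h::real_inner"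
    and B :: "'h \<Rightarrow>\<^sub>L 'e"
  assumes S: "C0_semigroup S" and f: "f \<in> L2 T" and t: "0 \<le> t" "t \<le> T"
  obtains I where "has_strong_integral (lebesgue_on {0<..<t}) (\<lambda>s. S (t - s) (B (f s))) I"
proof -
  let ?M = "lebesgue_on {0<..<T}" and ?N = "lebesgue_on {0<..<t}"
  interpret N: finite_measure ?N by (rule finite_measure_lebesgue_on_interval)
  have fm: "strongly_measurable ?M f" and fi: "integrable ?M (\<lambda>x. (norm (f x))\<^sup>2)"
    using f by (auto simp: L2_def square_integrable_def)
  have "{0<..<t} \<subseteq> {0<..<T}" using t by auto
  have N: "?N = restrict_space ?M {0<..<t}"
    using t by (subst restrict_restrict_space) (auto simp: Int_absorb1)
  have fmN: "strongly_measurable ?N f" unfolding N using fm by (rule strongly_measurable_restrict_space)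
  have fiN: "integrable ?N (\<lambda>x. (norm (f x))\<^sup>2)"
    unfolding N using integrable_mult_indicator[OF _ fi, of "{0<..<t}"] t \<open>{0<..<t} \<subseteq> {0<..<T}\<close>
    by (subst integrable_restrict_space) (auto simp: sets_restrict_space_iff)
  have Bm: "strongly_measurable ?N (\<lambda>s. B (f s))"
    by (rule strongly_measurable_compose2[OF fmN fmN, of "\<lambda>x _. B x"]) (auto intro: blinfun.tendsto)
  have sm: "strongly_measurable ?N (\<lambda>s. S (t - s) (B (f s)))"
  proof (rule strongly_measurable_semigroup[OF S Bm, where T = t])
    have "(\<lambda>s. t - s) \<in> borel_measurable lborel" by measurable
    then show "(\<lambda>s. t - s) \<in> borel_measurable ?N"
      by (intro measurable_restrict_space1 measurable_completion)
  qed auto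
  obtain K where K: "\<And>s. 0 \<le> s \<Longrightarrow> s \<le> t \<Longrightarrow> norm (S s) \<le> K" using C0_semigroup_bounded[OF S] by blast
  have K0: "K \<ge> 0" using K[of 0] t norm_ge_zero[of "S 0"] by linarith
  have "integrable ?N (\<lambda>s. norm (S (t - s) (B (f s))))"
  proof (rule Bochner_Integration.integrable_bound)
    \<comment> \<open>\<open>norm (f s) <= 1 + (norm (f s))^2\<close> turns square integrability
      into integrability, the interval having finite length.\<close>
    show "integrable ?N (\<lambda>s. K * norm B * (1 + (norm (f s))\<^sup>2))" using fiN by auto
    show "(\<lambda>s. norm (S (t - s) (B (f s)))) \<in> borel_measurable ?N" by (rule strongly_measurable_norm[OF sm])
    show "AE s in ?N. norm (norm (S (t - s) (B (f s)))) \<le> norm (K * norm B * (1 + (norm (f s))\<^sup>2))"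
    proof (rule AE_I2)
      fix s assume "s \<in> space ?N"
      then have s: "0 \<le> t - s" "t - s \<le> t" by auto
      have "norm (S (t - s) (B (f s))) \<le> norm (S (t - s)) * norm (B (f s))" by (rule norm_blinfun)
      also have "\<dots> \<le> K * (norm B * norm (f s))"
        using K0 by (intro mult_mono K[OF s] norm_blinfun) auto
      also have "\<dots> \<le> K * (norm B * (1 + (norm (f s))\<^sup>2))"
        using K0 sum_squares_bound[of "norm (f s)" 1] norm_ge_zero[of "f s"]
        by (intro mult_left_mono norm_ge_zero) (simp_all add: power2_eq_square del: norm_ge_zero)
      finally show "norm (norm (S (t - s) (B (f s)))) \<le> norm (K * norm B * (1 + (norm (f s))\<^sup>2))"
        using K0 by (simp add: mult.assoc)
    qed
  qed
  with has_strong_integral_exists[OF sm] that show ?thesis by blast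
qed

text \<open>For a functional \<open>y\<close> the orbit of \<open>y\<close> under the adjoints is
  itself an admissible test function \<open>h\<close>; the duality hypothesis then produces
  \<open>[k, j h]\<close>, and \<open>j h\<close> is the adjoint of \<open>R\<close> at
  \<open>y\<close>.\<close>

lemma control_integral_eq:
  fixes j :: "(real \<Rightarrow> 'h::{real_inner,complete_space}) \<Rightarrow> 'k::{real_inner,complete_space}"
    and \<Phi> :: "real \<Rightarrow> 'h \<Rightarrow>\<^sub>L 'e::real_normed_vector"
  assumes orb: "\<And>y. (\<lambda>t. riesz_adjoint (\<Phi> t) y) \<in> L2 T" and R: "represents T j \<Phi> R"
    and k: "\<And>h. h \<in> L2 T \<Longrightarrow> k \<bullet> j h = (\<integral>t. h t \<bullet> f t \<partial>lebesgue_on {0<..<T})"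
    and I: "has_strong_integral (lebesgue_on {0<..<T}) (\<lambda>t. \<Phi> t (f t)) I"
  shows "I = R k"
proof (rule functionals_separate)
  fix y :: "'e \<Rightarrow>\<^sub>L real"
  have "y I = (\<integral>t. y (\<Phi> t (f t)) \<partial>lebesgue_on {0<..<T})"
    using has_strong_integral_functional[OF I, of y] by (simp add: has_bochner_integral_integral_eq)
  also have "\<dots> = k \<bullet> j (\<lambda>t. riesz_adjoint (\<Phi> t) y)"
    by (simp add: k[OF orb] riesz_adjoint_inner)
  also have "\<dots> = y (R k)"
    using R riesz_adjoint_inner[of R y k] by (simp add: represents_def inner_commute)
  finally show "y I = y (R k)" .
qed

theorem null_controllable_iff:
  fixes j :: "(real \<Rightarrow> 'h::{real_inner,complete_space}) \<Rightarrow> 'k::{real_inner,complete_space}"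
    and S :: "real \<Rightarrow> 'e::banach \<Rightarrow>\<^sub>L 'e" and B :: "'h \<Rightarrow>\<^sub>L 'e"
  assumes T: "0 < T" and j: "L2_dense_inclusion T j" and S: "C0_semigroup S"
    and orb: "\<And>y. (\<lambda>t. riesz_adjoint (S (T - t) o\<^sub>L B) y) \<in> L2 T"
    and R: "represents T j (\<lambda>t. S (T - t) o\<^sub>L B) R"
  shows "null_controllable S B T (L2_dual T j) x0 \<longleftrightarrow> S T x0 \<in> range R"
proof
  assume "null_controllable S B T (L2_dual T j) x0"
  then obtain f x where f: "f \<in> L2_dual T j" and x: "mild_solution S B T x0 f x" "x T = 0"
    by (auto simp: null_controllable_def)
  obtain \<phi> :: "'k \<Rightarrow>\<^sub>L real" where \<phi>: "\<And>h. h \<in> L2 T \<Longrightarrow> \<phi> (j h) = (\<integral>t. h t \<bullet> f t \<partial>lebesgue_on {0<..<T})"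
    using f by (auto simp: L2_dual_def)
  obtain k where k: "\<And>h. \<phi> h = k \<bullet> h" using riesz_representation[of \<phi>] by blast
  obtain I where I: "has_strong_integral (lebesgue_on {0<..<T}) (\<lambda>t. (S (T - t) o\<^sub>L B) (f t)) I"
      and "x T = S T x0 + I"
    using x(1) T by (force simp: mild_solution_def)
  moreover have "I = R k"
    by (rule control_integral_eq[OF orb R _ I]) (simp add: \<phi> flip: k)
  ultimately have "S T x0 = R (- k)" using x(2) by (simp add: blinfun.minus_right add_eq_0_iff2)
  then show "S T x0 \<in> range R" by blast
next
  assume "S T x0 \<in> range R"
  then obtain k0 where k0: "S T x0 = R k0" by auto
  \<comment> \<open>The sign makes the control steer to 0: its integral will be
    \<open>R k = - S T x0\<close>.\<close>
  define k where "k = - k0"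
  let ?M = "lebesgue_on {0<..<T}"
  interpret finite_measure ?M by (rule finite_measure_lebesgue_on_interval)
  have jadd: "\<And>f g. f \<in> L2 T \<Longrightarrow> g \<in> L2 T \<Longrightarrow> j (\<lambda>t. f t + g t) = j f + j g"
    and jscl: "\<And>f c. f \<in> L2 T \<Longrightarrow> j (\<lambda>t. c *\<^sub>R f t) = c *\<^sub>R j f"
    using j by (auto simp: L2_dense_inclusion_def)
  obtain C where C: "\<And>f. f \<in> L2 T \<Longrightarrow> norm (j f) \<le> C * L2_norm T f"
    using j unfolding L2_dense_inclusion_def by blast
  obtain f where f: "square_integrable ?M f" "\<And>h. square_integrable ?M h \<Longrightarrow> k \<bullet> j h = (\<integral>t. h t \<bullet> f t \<partial>?M)"
  proof (rule riesz_square_integrable[of "\<lambda>h. k \<bullet> j h" "norm k * C"])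
    show "\<bar>k \<bullet> j f\<bar> \<le> norm k * C * sqrt (\<integral>t. (norm (f t))\<^sup>2 \<partial>?M)" if "square_integrable ?M f" for f
    proof -
      have "\<bar>k \<bullet> j f\<bar> \<le> norm k * norm (j f)" by (rule Cauchy_Schwarz_ineq2)
      also have "\<dots> \<le> norm k * (C * L2_norm T f)" using that by (intro mult_left_mono C) (auto simp: L2_def)
      finally show ?thesis by (simp add: L2_norm_def mult.assoc)
    qed
  qed (auto simp: L2_def jadd jscl inner_add_right)
  have fL: "f \<in> L2 T" using f by (simp add: L2_def)
  have k: "k \<bullet> j h = (\<integral>t. h t \<bullet> f t \<partial>?M)" if "h \<in> L2 T" for h using f(2) that by (simp add: L2_def)
  have "f \<in> L2_dual T j"
    unfolding L2_dual_def using fL k by (auto intro!: exI[of _ "blinfun_inner_right k"])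
  moreover have "\<exists>x. mild_solution S B T x0 f x \<and> x T = 0"
  proof -
    have "\<exists>I. has_strong_integral (lebesgue_on {0<..<t}) (\<lambda>s. S (t - s) (B (f s))) I" if "t \<in> {0..T}" for t
      using control_integral_exists[OF S fL, of t B] that by auto
    then obtain I where I: "\<And>t. t \<in> {0..T} \<Longrightarrow> has_strong_integral (lebesgue_on {0<..<t}) (\<lambda>s. S (t - s) (B (f s))) (I t)"
      by metis
    have "I T = R k"
      using I[of T] T by (intro control_integral_eq[OF orb R k]) auto
    then show ?thesis
      using I k0 by (intro exI[of _ "\<lambda>t. S t x0 + I t"])
        (auto simp: mild_solution_def k_def blinfun.minus_right)
  qed
  ultimately show "null_controllable S B T (L2_dual T j) x0" by (auto simp: null_controllable_def)
qed


section \<open>Independence from characteristic functions\<close>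

context prob_space
begin

lemma integrable_bounded_complex:
  fixes F :: "'a \<Rightarrow> complex"
  assumes "F \<in> borel_measurable M" "\<And>\<omega>. norm (F \<omega>) \<le> c"
  shows "integrable M F"
  using assms by (intro integrable_const_bound[of _ c]) auto

text \<open>The weight \<open>1 + G\<close> turns \<open>M\<close> into another probability measure under which \<open>Z\<close> has the same
  characteristic function.\<close>

lemma fourier_zero_real:
  fixes G Z :: "'a \<Rightarrow> real"
  assumes [measurable]: "G \<in> borel_measurable M" "Z \<in> borel_measurable M" "B \<in> sets borel"
    and G: "\<And>\<omega>. \<bar>G \<omega>\<bar> \<le> 1"
    and zero: "\<And>s. (\<integral>\<omega>. G \<omega> *\<^sub>R iexp (s * Z \<omega>) \<partial>M) = 0"
  shows "(\<integral>\<omega>. G \<omega> * indicator B (Z \<omega>) \<partial>M) = 0"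
proof -
  have pos: "0 \<le> 1 + G \<omega>" for \<omega> using G[of \<omega>] by linarith
  have iG: "integrable M G" by (rule integrable_const_bound[of _ 1]) (use G in auto)
  \<comment> \<open>Frequency 0 shows that \<open>G\<close> has mean zero, so the weight
    \<open>1 + G\<close> has total mass 1.\<close>
  have "complex_of_real (\<integral>\<omega>. G \<omega> \<partial>M) = 0" using zero[of 0] iG by (simp add: scaleR_conv_of_real)
  then have EG: "(\<integral>\<omega>. G \<omega> \<partial>M) = 0" by simp
  define N where "N = density M (\<lambda>\<omega>. ennreal (1 + G \<omega>))"
  have [measurable]: "Z \<in> borel_measurable N" by (simp add: N_def)
  interpret N: prob_space N
  proof
    have "emeasure N (space N) = (\<integral>\<^sup>+\<omega>. ennreal (1 + G \<omega>) \<partial>M)"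
      unfolding N_def by (simp add: emeasure_density cong: nn_integral_cong)
    also have "\<dots> = ennreal (\<integral>\<omega>. 1 + G \<omega> \<partial>M)"
      using iG pos by (intro nn_integral_eq_integral) auto
    also have "\<dots> = 1" using iG EG by (simp add: prob_space)
    finally show "emeasure N (space N) = 1" .
  qed
  have "distr N borel Z = distr M borel Z"
  proof (rule Levy_uniqueness)
    show "char (distr N borel Z) = char (distr M borel Z)"
    proof
      fix t
      have "char (distr N borel Z) t = (\<integral>\<omega>. iexp (t * Z \<omega>) \<partial>N)"
        unfolding char_def by (subst integral_distr) auto
      also have "\<dots> = (\<integral>\<omega>. (1 + G \<omega>) *\<^sub>R iexp (t * Z \<omega>) \<partial>M)"
        unfolding N_def using pos by (subst integral_density) auto
      also have "\<dots> = (\<integral>\<omega>. iexp (t * Z \<omega>) + G \<omega> *\<^sub>R iexp (t * Z \<omega>) \<partial>M)"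
        by (simp add: scaleR_add_left)
      also have "\<dots> = (\<integral>\<omega>. iexp (t * Z \<omega>) \<partial>M) + (\<integral>\<omega>. G \<omega> *\<^sub>R iexp (t * Z \<omega>) \<partial>M)"
        using G by (intro Bochner_Integration.integral_add integrable_bounded_complex[of _ 1]) auto
      also have "\<dots> = char (distr M borel Z) t"
        unfolding char_def zero by (subst integral_distr) auto
      finally show "char (distr N borel Z) t = char (distr M borel Z) t" .
    qed
  qed auto
  then have "(\<integral>x. indicat_real B x \<partial>distr N borel Z) = (\<integral>x. indicat_real B x \<partial>distr M borel Z)" by simp
  also have "(\<integral>x. indicat_real B x \<partial>distr N borel Z) = (\<integral>\<omega>. indicator B (Z \<omega>) \<partial>N)"
    by (subst integral_distr) auto
  also have "\<dots> = (\<integral>\<omega>. (1 + G \<omega>) *\<^sub>R indicator B (Z \<omega>) \<partial>M)"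
    unfolding N_def using pos by (subst integral_density) auto
  also have "\<dots> = (\<integral>\<omega>. indicator B (Z \<omega>) + G \<omega> * indicator B (Z \<omega>) \<partial>M)"
    by (simp add: algebra_simps)
  also have "\<dots> = (\<integral>\<omega>. indicator B (Z \<omega>) \<partial>M) + (\<integral>\<omega>. G \<omega> * indicator B (Z \<omega>) \<partial>M)"
    using G by (intro Bochner_Integration.integral_add integrable_const_bound[of _ 1])
      (auto simp: indicator_def)
  also have "(\<integral>x. indicat_real B x \<partial>distr M borel Z) = (\<integral>\<omega>. indicator B (Z \<omega>) \<partial>M)"
    by (subst integral_distr) auto
  finally show ?thesis by simp
qed

text \<open>Reduction to real weights: real and imaginary part are combinations of \<open>F\<close>
  and its conjugate, and conjugation preserves the hypothesis because it only replaces
  \<open>s\<close> by \<open>- s\<close>.\<close>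

lemma fourier_zero:
  fixes F :: "'a \<Rightarrow> complex" and Z :: "'a \<Rightarrow> real"
  assumes [measurable]: "F \<in> borel_measurable M" "Z \<in> borel_measurable M" "B \<in> sets borel"
    and F: "\<And>\<omega>. norm (F \<omega>) \<le> c"
    and zero: "\<And>s. (\<integral>\<omega>. F \<omega> * iexp (s * Z \<omega>) \<partial>M) = 0"
  shows "(\<integral>\<omega>. F \<omega> * indicator B (Z \<omega>) \<partial>M) = 0"
proof -
  \<comment> \<open>Adding 1 makes the bound positive, so that dividing by it yields weights between
    -1 and 1.\<close>
  define d where "d = 1 + \<bar>c\<bar>"
  have d: "d > 0" "\<And>\<omega>. norm (F \<omega>) \<le> d" using F by (auto simp: d_def intro: order_trans) (smt (verit) F)
  have int: "integrable M (\<lambda>\<omega>. H \<omega> * iexp (s * Z \<omega>))"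
    if "H \<in> borel_measurable M" "\<And>\<omega>. norm (H \<omega>) \<le> d" for s and H :: "'a \<Rightarrow> complex"
    using that by (intro integrable_bounded_complex[of _ d]) (auto simp: norm_mult)
  have [measurable]: "(\<lambda>\<omega>. cnj (F \<omega>)) \<in> borel_measurable M"
    by (rule borel_measurable_continuous_on[OF _ assms(1)]) (intro continuous_intros)
  have cnj0: "(\<integral>\<omega>. cnj (F \<omega>) * iexp (s * Z \<omega>) \<partial>M) = 0" for s
  proof -
    have "(\<integral>\<omega>. cnj (F \<omega>) * iexp (s * Z \<omega>) \<partial>M) = (\<integral>\<omega>. cnj (F \<omega> * iexp ((- s) * Z \<omega>)) \<partial>M)"
      by (simp add: exp_cnj)
    also have "\<dots> = 0" using zero[of "- s"] by (simp del: complex_cnj_mult)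
    finally show ?thesis .
  qed
  have part: "(\<integral>\<omega>. G \<omega> * indicator B (Z \<omega>) \<partial>M) = 0"
    if [measurable]: "G \<in> borel_measurable M" and Gd: "\<And>\<omega>. \<bar>G \<omega>\<bar> \<le> d"
      and lc: "\<And>\<omega>. complex_of_real (G \<omega>) = a * F \<omega> + b * cnj (F \<omega>)" for G a b
  proof -
    have "(\<integral>\<omega>. G \<omega> / d * indicator B (Z \<omega>) \<partial>M) = 0"
    proof (rule fourier_zero_real)
      show "\<bar>G \<omega> / d\<bar> \<le> 1" for \<omega> using Gd[of \<omega>] d(1) by simp
      fix s
      have "(\<integral>\<omega>. (G \<omega> / d) *\<^sub>R iexp (s * Z \<omega>) \<partial>M) =
          (\<integral>\<omega>. (a / d) * (F \<omega> * iexp (s * Z \<omega>)) + (b / d) * (cnj (F \<omega>) * iexp (s * Z \<omega>)) \<partial>M)"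
        by (intro Bochner_Integration.integral_cong)
          (auto simp: scaleR_conv_of_real lc add_divide_distrib algebra_simps)
      also have "\<dots> = (a / d) * (\<integral>\<omega>. F \<omega> * iexp (s * Z \<omega>) \<partial>M) + (b / d) * (\<integral>\<omega>. cnj (F \<omega>) * iexp (s * Z \<omega>) \<partial>M)"
        unfolding integral_mult_right_zero[symmetric]
        using d by (intro Bochner_Integration.integral_add integrable_mult_right int) auto
      finally show "(\<integral>\<omega>. (G \<omega> / d) *\<^sub>R iexp (s * Z \<omega>) \<partial>M) = 0" unfolding zero cnj0 by simp
    qed auto
    then show ?thesis using d(1) by simp
  qed
  have re: "(\<integral>\<omega>. Re (F \<omega>) * indicator B (Z \<omega>) \<partial>M) = 0"
    by (rule part[of "\<lambda>\<omega>. Re (F \<omega>)" "1/2" "1/2"])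
      (auto simp: complex_eq_iff intro: order_trans[OF abs_Re_le_cmod d(2)])
  have im: "(\<integral>\<omega>. Im (F \<omega>) * indicator B (Z \<omega>) \<partial>M) = 0"
    by (rule part[of "\<lambda>\<omega>. Im (F \<omega>)" "- \<i>/2" "\<i>/2"])
      (auto simp: complex_eq_iff intro: order_trans[OF abs_Im_le_cmod d(2)])
  have "integrable M (\<lambda>\<omega>. F \<omega> * indicator B (Z \<omega>))"
    using d(2) d(1) by (intro integrable_bounded_complex[of _ d]) (auto simp: indicator_def)
  then have "Re (\<integral>\<omega>. F \<omega> * indicator B (Z \<omega>) \<partial>M) = (\<integral>\<omega>. Re (F \<omega> * indicator B (Z \<omega>)) \<partial>M)"
    "Im (\<integral>\<omega>. F \<omega> * indicator B (Z \<omega>) \<partial>M) = (\<integral>\<omega>. Im (F \<omega> * indicator B (Z \<omega>)) \<partial>M)"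
    by (auto intro: integral_bounded_linear[OF bounded_linear_Re, symmetric]
        integral_bounded_linear[OF bounded_linear_Im, symmetric] simp del: times_complex.sel)
  moreover have "Re (F \<omega> * indicator B (Z \<omega>)) = Re (F \<omega>) * indicator B (Z \<omega>)"
    "Im (F \<omega> * indicator B (Z \<omega>)) = Im (F \<omega>) * indicator B (Z \<omega>)" for \<omega>
    by (auto simp: indicator_def)
  ultimately show ?thesis using re im by (simp add: complex_eq_iff)
qed

text \<open>Induction over the constraints: the exponentials in the direction of the new functional
  are traded for an indicator by \<open>fourier_zero\<close>. Testing with frequency
  \<open>s\<close> shifts the exponent from \<open>z\<close> to \<open>z + s y\<close>, hence
  \<open>z\<close> is kept general.\<close>

lemma fourier_zero_cylinder:
  fixes X :: "'a \<Rightarrow> 'e::real_normed_vector" and F :: "'a \<Rightarrow> complex"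
    and L :: "(('e \<Rightarrow>\<^sub>L real) \<times> real set) list" and z :: "'e \<Rightarrow>\<^sub>L real"
  assumes X: "X \<in> borel_measurable M" and F[measurable]: "F \<in> borel_measurable M"
    and b: "\<And>\<omega>. norm (F \<omega>) \<le> c"
    and zero: "\<And>y :: 'e \<Rightarrow>\<^sub>L real. (\<integral>\<omega>. F \<omega> * iexp (y (X \<omega>)) \<partial>M) = 0"
    and L: "\<And>y B. (y, B) \<in> set L \<Longrightarrow> B \<in> sets borel"
  shows "(\<integral>\<omega>. F \<omega> * indicator {\<omega>. \<forall>(y, B)\<in>set L. blinfun_apply y (X \<omega>) \<in> B} \<omega> * iexp (z (X \<omega>)) \<partial>M) = 0"
  using L
proof (induction L arbitrary: z)
  case Nil
  then show ?case using zero by simp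
next
  case (Cons p L)
  obtain y B where p: "p = (y, B)" by (cases p)
  have [measurable]: "(\<lambda>\<omega>. u (X \<omega>)) \<in> borel_measurable M" for u :: "'e \<Rightarrow>\<^sub>L real"
    using X by (rule measurable_blinfun_comp)
  have [measurable]: "B \<in> sets borel" using Cons.prems p by auto
  define I where "I \<omega> = (indicator {\<omega>. \<forall>(y, B)\<in>set L. blinfun_apply y (X \<omega>) \<in> B} \<omega> :: complex)" for \<omega>
  have ev: "{\<omega>\<in>space M. \<forall>(y, B)\<in>set L. blinfun_apply y (X \<omega>) \<in> B} \<in> sets M"
  proof -
    have "{\<omega>\<in>space M. u (X \<omega>) \<in> D} \<in> sets M" if "(u, D) \<in> set L" for u D
    proof -
      have [measurable]: "D \<in> sets borel" using Cons.prems that by auto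
      show ?thesis by measurable
    qed
    then show ?thesis by (intro sets.sets_Collect_finite_All) (auto split: prod.split)
  qed
  have [measurable]: "I \<in> borel_measurable M"
  proof -
    \<comment> \<open>The indicator lives on the whole type; measurability only concerns its trace
      on \<open>space M\<close>.\<close>
    have "I \<in> borel_measurable M \<longleftrightarrow> (indicator {\<omega>\<in>space M. \<forall>(y, B)\<in>set L. blinfun_apply y (X \<omega>) \<in> B} :: 'a \<Rightarrow> complex) \<in> borel_measurable M"
      by (rule measurable_cong) (auto simp: I_def indicator_def)
    then show ?thesis using ev by simp
  qed
  have In: "norm (I \<omega>) \<le> 1" for \<omega> by (auto simp: I_def indicator_def)
  have c0: "c \<ge> 0" using b[of undefined] norm_ge_zero order_trans by blast
  have "(\<integral>\<omega>. (F \<omega> * I \<omega> * iexp (z (X \<omega>))) * indicator B (y (X \<omega>)) \<partial>M) = 0"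
  proof (rule fourier_zero[where c = c])
    show "norm (F \<omega> * I \<omega> * iexp (z (X \<omega>))) \<le> c" for \<omega>
      using mult_mono[OF b[of \<omega>] In[of \<omega>] c0] by (simp add: norm_mult)
    fix s
    have "(\<integral>\<omega>. F \<omega> * I \<omega> * iexp (z (X \<omega>)) * iexp (s * y (X \<omega>)) \<partial>M) =
        (\<integral>\<omega>. F \<omega> * I \<omega> * iexp ((z + s *\<^sub>R y) (X \<omega>)) \<partial>M)"
      by (intro Bochner_Integration.integral_cong)
        (auto simp: plus_blinfun.rep_eq scaleR_blinfun.rep_eq distrib_left exp_add)
    also have "\<dots> = 0" unfolding I_def by (rule Cons.IH) (use Cons.prems in auto)
    finally show "(\<integral>\<omega>. F \<omega> * I \<omega> * iexp (z (X \<omega>)) * iexp (s * y (X \<omega>)) \<partial>M) = 0" .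
  qed auto
  moreover have "F \<omega> * indicator {\<omega>. \<forall>(y, B)\<in>set (p # L). blinfun_apply y (X \<omega>) \<in> B} \<omega> * iexp (z (X \<omega>)) =
      (F \<omega> * I \<omega> * iexp (z (X \<omega>))) * indicator B (y (X \<omega>))" for \<omega>
    by (auto simp: I_def p indicator_def)
  ultimately show ?case by (simp only:)
qed

text \<open>Separability of the range replaces separability of \<open>E\<close>. The values of the
  approximating simple functions form a countable set \<open>D\<close> whose closure contains the
  range of \<open>X\<close>. Preimages of balls are countable intersections of half-space events,
  and preimages of open sets are countable unions of such ball events.\<close>

lemma cylinder_events_generate:
  fixes X :: "'a \<Rightarrow> 'e::real_normed_vector"
  assumes X: "strongly_measurable M X" and A: "A \<in> sets borel"
  shows "X -` A \<inter> space M \<in> sigma_sets (space M)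
    {{\<omega>\<in>space M. \<forall>(y, B)\<in>set L. blinfun_apply y (X \<omega>) \<in> B} |L. \<forall>(y, B)\<in>set L. B \<in> sets (borel :: real measure)}"
    (is "_ \<in> sigma_sets _ ?\<A>")
proof -
  define N where "N = sigma (space M) ?\<A>"
  have setsN: "sets N = sigma_sets (space M) ?\<A>" and spaceN: "space N = space M"
    unfolding N_def by (auto intro!: sets_measure_of space_measure_of)
  have cyl: "{\<omega>\<in>space M. blinfun_apply y (X \<omega>) \<in> B} \<in> sets N" if "B \<in> sets borel" for y and B :: "real set"
    unfolding setsN using that by (intro sigma_sets.Basic CollectI exI[of _ "[(y, B)]"]) auto
  obtain s where s: "\<And>i. simple_function M (s i)" "\<And>x. x \<in> space M \<Longrightarrow> (\<lambda>i::nat. s i x) \<longlonglongrightarrow> X x"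
    using X unfolding strongly_measurable_def by metis
  define D where "D = (\<Union>i. s i ` space M)"
  have cD: "countable D"
    unfolding D_def using s(1) by (intro countable_UN countableI_type countable_finite[OF simple_functionD(1)])
  have dense: "\<exists>d\<in>D. dist d (X \<omega>) < e" if \<omega>: "\<omega> \<in> space M" and e: "e > 0" for \<omega> e
  proof -
    obtain i where "dist (s i \<omega>) (X \<omega>) < e"
      using s(2)[OF \<omega>] e unfolding lim_sequentially by blast
    then show ?thesis using \<omega> by (auto simp: D_def)
  qed
  obtain y :: "'e \<Rightarrow> 'e \<Rightarrow>\<^sub>L real" where y: "\<And>z. y z z = norm z" "\<And>z x. \<bar>y z x\<bar> \<le> norm x"
    using norming_functional by metis
  have ball: "{\<omega>\<in>space M. X \<omega> \<in> cball d q} \<in> sets N" for d q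
  \<comment> \<open>An intersection over the empty set would be the whole type, so this case is
    separate; it occurs only if \<open>space M\<close> is empty.\<close>
  proof (cases "D = {}")
    case True
    then have "space M = {}" using dense[OF _ zero_less_one] by blast
    then show ?thesis by simp
  next
    case False
    \<comment> \<open>The functional norming \<open>e - d\<close>, for \<open>e\<close> in
      \<open>D\<close> close to the point \<open>X \<omega>\<close>, nearly norms the distance from
      \<open>d\<close> to that point, so countably many half-spaces cut out the ball on the range of
      \<open>X\<close>.\<close>
    have "{\<omega>\<in>space M. X \<omega> \<in> cball d q} = (\<Inter>e\<in>D. {\<omega>\<in>space M. y (e - d) (X \<omega>) \<in> {..q + y (e - d) d}})"
    proof (intro set_eqI iffI)
      fix \<omega> assume \<omega>: "\<omega> \<in> {\<omega>\<in>space M. X \<omega> \<in> cball d q}"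
      have "y (e - d) (X \<omega> - d) \<le> q" for e
        using \<omega> y(2)[of "e - d" "X \<omega> - d"] by (auto simp: dist_norm norm_minus_commute)
      then show "\<omega> \<in> (\<Inter>e\<in>D. {\<omega>\<in>space M. y (e - d) (X \<omega>) \<in> {..q + y (e - d) d}})"
        using \<omega> by (simp add: blinfun.diff_right algebra_simps)
    next
      fix \<omega> assume \<omega>: "\<omega> \<in> (\<Inter>e\<in>D. {\<omega>\<in>space M. y (e - d) (X \<omega>) \<in> {..q + y (e - d) d}})"
      then have sp: "\<omega> \<in> space M" using False by auto
      have "norm (X \<omega> - d) \<le> q + \<epsilon>" if \<epsilon>: "\<epsilon> > 0" for \<epsilon>
      proof -
        obtain e where e: "e \<in> D" "dist e (X \<omega>) < \<epsilon> / 2" using dense[OF sp, of "\<epsilon> / 2"] \<epsilon> by auto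
        have "norm (e - d) = y (e - d) (e - X \<omega>) + y (e - d) (X \<omega> - d)"
          using y(1)[of "e - d"] by (simp add: blinfun.diff_right)
        also have "y (e - d) (X \<omega> - d) \<le> q" using \<omega> e(1) by (auto simp: blinfun.diff_right)
        also have "y (e - d) (e - X \<omega>) \<le> \<epsilon> / 2" using y(2)[of "e - d" "e - X \<omega>"] e(2) by (simp add: dist_norm)
        finally have "norm (e - d) \<le> \<epsilon> / 2 + q" by simp
        moreover have "norm (X \<omega> - d) \<le> norm (X \<omega> - e) + norm (e - d)"
          using norm_triangle_ineq[of "X \<omega> - e" "e - d"] by simp
        ultimately show ?thesis using e(2) by (simp add: dist_norm norm_minus_commute)
      qed
      then have "norm (X \<omega> - d) \<le> q" by (rule field_le_epsilon)
      then show "\<omega> \<in> {\<omega>\<in>space M. X \<omega> \<in> cball d q}" using sp by (simp add: dist_norm norm_minus_commute)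
    qed
    also have "\<dots> \<in> sets N" using False cD by (intro sets.countable_INT' image_subsetI cyl) auto
    finally show ?thesis .
  qed
  have "X \<in> borel_measurable N"
  proof (rule borel_measurableI)
    fix U :: "'e set" assume U: "open U"
    have "X -` U \<inter> space N = (\<Union>(d, q)\<in>{(d, q). d \<in> D \<and> q \<in> \<rat> \<and> cball d q \<subseteq> U}. {\<omega>\<in>space M. X \<omega> \<in> cball d q})"
    proof safe
      fix \<omega> assume \<omega>: "\<omega> \<in> space N" "X \<omega> \<in> U"
      then obtain e where e: "e > 0" "ball (X \<omega>) e \<subseteq> U" using U openE by blast
      obtain d where d: "d \<in> D" "dist d (X \<omega>) < e / 2" using dense[of \<omega> "e / 2"] \<omega> e(1) spaceN by auto
      obtain q where q: "q \<in> \<rat>" "dist d (X \<omega>) < q" "q < e / 2" using Rats_dense_in_real[OF d(2)] by auto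
      have "cball d q \<subseteq> ball (X \<omega>) e"
      proof
        fix x assume "x \<in> cball d q"
        then have "dist (X \<omega>) x \<le> dist d (X \<omega>) + q"
          using dist_triangle[of "X \<omega>" x d] by (simp add: dist_commute)
        then show "x \<in> ball (X \<omega>) e" using d(2) q(3) by simp
      qed
      then show "\<omega> \<in> (\<Union>(d, q)\<in>{(d, q). d \<in> D \<and> q \<in> \<rat> \<and> cball d q \<subseteq> U}. {\<omega>\<in>space M. X \<omega> \<in> cball d q})"
        using d(1) q e(2) \<omega> spaceN by (intro UN_I[of "(d, q)"]) auto
    qed (auto simp: spaceN)
    also have "\<dots> \<in> sets N"
    proof (rule sets.countable_UN')
      have "{(d, q). d \<in> D \<and> q \<in> \<rat> \<and> cball d q \<subseteq> U} \<subseteq> D \<times> \<rat>" by auto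
      then show "countable {(d, q). d \<in> D \<and> q \<in> \<rat> \<and> cball d q \<subseteq> U}"
        by (rule countable_subset) (intro countable_SIGMA cD countable_rat)
    qed (use ball in auto)
    finally show "X -` U \<inter> space N \<in> sets N" .
  qed
  from measurable_sets[OF this A] show ?thesis by (simp add: setsN spaceN)
qed

text \<open>The exponentials are replaced by indicators in two rounds, first those of
  \<open>Z\<close> for fixed \<open>y\<close>, then those of \<open>X\<close> for a fixed event of
  \<open>Z\<close>. This gives independence of two intersection-stable families, which extends to
  the sigma-algebras they generate.\<close>

theorem joint_distribution_if_fourier:
  fixes X :: "'a \<Rightarrow> 'e::real_normed_vector" and Z :: "'a \<Rightarrow> real"
  assumes X: "strongly_measurable M X" and Z[measurable]: "Z \<in> borel_measurable M"
    and prod: "\<And>(y :: 'e \<Rightarrow>\<^sub>L real) s. (\<integral>\<omega>. iexp (y (X \<omega>)) * iexp (s * Z \<omega>) \<partial>M) =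
      (\<integral>\<omega>. iexp (y (X \<omega>)) \<partial>M) * (\<integral>\<omega>. iexp (s * Z \<omega>) \<partial>M)"
  shows "distr M borel X \<Otimes>\<^sub>M distr M borel Z = distr M (borel \<Otimes>\<^sub>M borel) (\<lambda>\<omega>. (X \<omega>, Z \<omega>))"
proof -
  have Xb: "X \<in> borel_measurable M" using X by (rule strongly_measurable_borel)
  have [measurable]: "(\<lambda>\<omega>. u (X \<omega>)) \<in> borel_measurable M" for u :: "'e \<Rightarrow>\<^sub>L real"
    using Xb by (rule measurable_blinfun_comp)
  let ?\<A> = "{{\<omega>\<in>space M. \<forall>(y, B)\<in>set L. blinfun_apply y (X \<omega>) \<in> B} |L. \<forall>(y, B)\<in>set L. B \<in> sets (borel :: real measure)}"
  let ?\<B> = "{Z -` B \<inter> space M |B. B \<in> sets borel}"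
  have \<A>_ev: "{\<omega>\<in>space M. \<forall>(y, B)\<in>set L. blinfun_apply y (X \<omega>) \<in> B} \<in> events"
    if L: "\<forall>(y, B)\<in>set L. B \<in> sets (borel :: real measure)" for L
  proof -
    have "{\<omega>\<in>space M. blinfun_apply u (X \<omega>) \<in> D} \<in> events" if "(u, D) \<in> set L" for u D
    proof -
      have [measurable]: "D \<in> sets borel" using L that by auto
      show ?thesis by measurable
    qed
    then show ?thesis by (intro sets.sets_Collect_finite_All) (auto split: prod.split)
  qed
  have "indep_set ?\<A> ?\<B>"
  proof (rule indep_setI)
    fix a b assume "a \<in> ?\<A>" "b \<in> ?\<B>"
    then obtain L B where L: "\<forall>(y, B)\<in>set L. B \<in> sets (borel :: real measure)"
        and a: "a = {\<omega>\<in>space M. \<forall>(y, B)\<in>set L. blinfun_apply y (X \<omega>) \<in> B}"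
        and [measurable]: "B \<in> sets borel" and b: "b = Z -` B \<inter> space M" by auto
    have [measurable]: "a \<in> events" "b \<in> events" using \<A>_ev[OF L] by (auto simp: a b)
    \<comment> \<open>The centred indicator serves as weight in the second round; its vanishing
      integral over a cylinder event is exactly the product rule for \<open>a\<close> and
      \<open>b\<close>.\<close>
    define F where "F \<omega> = (indicator B (Z \<omega>) - complex_of_real (prob b))" for \<omega>
    have Eb: "(\<integral>\<omega>. (indicator B (Z \<omega>) :: complex) \<partial>M) = complex_of_real (prob b)"
    proof -
      have "(\<integral>\<omega>. (indicator B (Z \<omega>) :: complex) \<partial>M) = (\<integral>\<omega>. complex_of_real (indicator b \<omega>) \<partial>M)"
        by (intro Bochner_Integration.integral_cong) (auto simp: b indicator_def)
      then show ?thesis by (simp add: integral_complex_of_real)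
    qed
    have F0: "(\<integral>\<omega>. F \<omega> * iexp (y (X \<omega>)) \<partial>M) = 0" for y :: "'e \<Rightarrow>\<^sub>L real"
    proof -
      define m where "m = (\<integral>\<omega>. iexp (y (X \<omega>)) \<partial>M)"
      have i1: "integrable M (\<lambda>\<omega>. iexp (y (X \<omega>)))" "integrable M (\<lambda>\<omega>. iexp (s * Z \<omega>))"
          "integrable M (\<lambda>\<omega>. iexp (y (X \<omega>)) * iexp (s * Z \<omega>))"
          "integrable M (\<lambda>\<omega>. iexp (y (X \<omega>)) * indicator B (Z \<omega>))"
          "integrable M (\<lambda>\<omega>. (indicator B (Z \<omega>) :: complex))" for s
        by (intro integrable_bounded_complex[of _ 1]; auto simp: norm_mult indicator_def)+
      \<comment> \<open>First round: centring at \<open>m\<close> turns the factorisation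
        \<open>prod\<close> into vanishing Fourier integrals in \<open>Z\<close>.\<close>
      have "(\<integral>\<omega>. (iexp (y (X \<omega>)) - m) * indicator B (Z \<omega>) \<partial>M) = 0"
      proof (rule fourier_zero[where c = "1 + norm m"])
        show "norm (iexp (y (X \<omega>)) - m) \<le> 1 + norm m" for \<omega>
          by (rule order_trans[OF norm_triangle_ineq4]) simp
        show "(\<integral>\<omega>. (iexp (y (X \<omega>)) - m) * iexp (s * Z \<omega>) \<partial>M) = 0" for s
          using i1(2,3)[of s] prod[of y s] by (simp add: left_diff_distrib m_def)
      qed auto
      then have "(\<integral>\<omega>. iexp (y (X \<omega>)) * indicator B (Z \<omega>) \<partial>M) = m * complex_of_real (prob b)"
        using i1(4,5) by (simp add: left_diff_distrib Eb)
      moreover have "(\<integral>\<omega>. F \<omega> * iexp (y (X \<omega>)) \<partial>M) =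
          (\<integral>\<omega>. iexp (y (X \<omega>)) * indicator B (Z \<omega>) \<partial>M) - complex_of_real (prob b) * m"
      proof -
        have "(\<integral>\<omega>. F \<omega> * iexp (y (X \<omega>)) \<partial>M) =
            (\<integral>\<omega>. iexp (y (X \<omega>)) * indicator B (Z \<omega>) - complex_of_real (prob b) * iexp (y (X \<omega>)) \<partial>M)"
          by (intro Bochner_Integration.integral_cong) (auto simp: F_def algebra_simps)
        also have "\<dots> = (\<integral>\<omega>. iexp (y (X \<omega>)) * indicator B (Z \<omega>) \<partial>M) - (\<integral>\<omega>. complex_of_real (prob b) * iexp (y (X \<omega>)) \<partial>M)"
          using i1 by (intro Bochner_Integration.integral_diff integrable_mult_right)
        finally show ?thesis by (simp add: m_def)
      qed
      ultimately show ?thesis by (simp add: mult.commute)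
    qed
    have "(\<integral>\<omega>. F \<omega> * indicator {\<omega>. \<forall>(y, B)\<in>set L. blinfun_apply y (X \<omega>) \<in> B} \<omega> * iexp ((0 :: 'e \<Rightarrow>\<^sub>L real) (X \<omega>)) \<partial>M) = 0"
    proof (rule fourier_zero_cylinder[OF Xb, where c = 2])
      show "F \<in> borel_measurable M" unfolding F_def by measurable
      show "norm (F \<omega>) \<le> 2" for \<omega>
      proof -
        have "norm (complex_of_real (prob b)) \<le> 1" "norm (indicator B (Z \<omega>) :: complex) \<le> 1"
          by (auto simp: indicator_def)
        then show ?thesis
          unfolding F_def by (intro order_trans[OF norm_triangle_ineq4]) linarith
      qed
    qed (use L F0 in auto)
    also have "(\<integral>\<omega>. F \<omega> * indicator {\<omega>. \<forall>(y, B)\<in>set L. blinfun_apply y (X \<omega>) \<in> B} \<omega> * iexp ((0 :: 'e \<Rightarrow>\<^sub>L real) (X \<omega>)) \<partial>M) =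
        (\<integral>\<omega>. complex_of_real (indicator (a \<inter> b) \<omega> - prob b * indicator a \<omega>) \<partial>M)"
      by (intro Bochner_Integration.integral_cong) (auto simp: F_def a b indicator_def)
    also have "\<dots> = complex_of_real (prob (a \<inter> b) - prob b * prob a)"
      by (subst integral_complex_of_real, subst Bochner_Integration.integral_diff)
        (auto simp: emeasure_eq_measure sets.Int_space_eq2)
    finally show "prob (a \<inter> b) = prob a * prob b" by (simp add: mult.commute flip: of_real_mult)
  qed (use \<A>_ev in auto)
  moreover have "Int_stable ?\<A>"
  proof (rule Int_stableI)
    fix a b assume "a \<in> ?\<A>" "b \<in> ?\<A>"
    then obtain L L' where "\<forall>(y, B)\<in>set L. B \<in> sets (borel :: real measure)" "\<forall>(y, B)\<in>set L'. B \<in> sets (borel :: real measure)"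
        "a = {\<omega>\<in>space M. \<forall>(y, B)\<in>set L. blinfun_apply y (X \<omega>) \<in> B}"
        "b = {\<omega>\<in>space M. \<forall>(y, B)\<in>set L'. blinfun_apply y (X \<omega>) \<in> B}" by blast
    then show "a \<inter> b \<in> ?\<A>" by (intro CollectI exI[of _ "L @ L'"]) auto
  qed
  moreover have "Int_stable ?\<B>"
  proof (rule Int_stableI)
    fix a b assume "a \<in> ?\<B>" "b \<in> ?\<B>"
    then obtain C C' where "C \<in> sets borel" "C' \<in> sets borel" "a = Z -` C \<inter> space M" "b = Z -` C' \<inter> space M" by blast
    then show "a \<inter> b \<in> ?\<B>" by (intro CollectI exI[of _ "C \<inter> C'"]) auto
  qed
  ultimately have ind: "indep_set (sigma_sets (space M) ?\<A>) (sigma_sets (space M) ?\<B>)"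
    by (rule indep_set_sigma_sets)
  have XZ: "(\<lambda>\<omega>. (X \<omega>, Z \<omega>)) \<in> measurable M (borel \<Otimes>\<^sub>M borel)"
    using Xb Z by (rule measurable_Pair)
  interpret DX: prob_space "distr M borel X" using Xb by (rule prob_space_distr)
  interpret DZ: prob_space "distr M borel Z" using Z by (rule prob_space_distr)
  show ?thesis
  proof (rule pair_measure_eqI)
    show "sets (distr M borel X \<Otimes>\<^sub>M distr M borel Z) = sets (distr M (borel \<Otimes>\<^sub>M borel) (\<lambda>\<omega>. (X \<omega>, Z \<omega>)))"
      by (simp cong: sets_pair_measure_cong)
    fix A :: "'e set" and B :: "real set" assume "A \<in> sets (distr M borel X)" "B \<in> sets (distr M borel Z)"
    then have A: "A \<in> sets borel" and B: "B \<in> sets borel" by auto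
    have "emeasure (distr M (borel \<Otimes>\<^sub>M borel) (\<lambda>\<omega>. (X \<omega>, Z \<omega>))) (A \<times> B) =
        emeasure M ((X -` A \<inter> space M) \<inter> (Z -` B \<inter> space M))"
      using XZ A B by (subst emeasure_distr) (auto intro!: arg_cong[where f = "emeasure M"])
    also have "\<dots> = ennreal (prob (X -` A \<inter> space M) * prob (Z -` B \<inter> space M))"
      unfolding emeasure_eq_measure
      by (subst indep_setD[OF ind cylinder_events_generate[OF X A]]) (use B in \<open>auto intro!: sigma_sets.Basic\<close>)
    also have "\<dots> = emeasure (distr M borel X) A * emeasure (distr M borel Z) B"
      using Xb Z A B by (simp add: emeasure_distr emeasure_eq_measure ennreal_mult)
    finally show "emeasure (distr M borel X) A * emeasure (distr M borel Z) B =
        emeasure (distr M (borel \<Otimes>\<^sub>M borel) (\<lambda>\<omega>. (X \<omega>, Z \<omega>))) (A \<times> B)" by simp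
  qed unfold_locales
qed

end


section \<open>Translates of the stochastic integral\<close>

text \<open>Continuity alone gives Borel sets of the product space, which may exceed the product
  sigma-algebra. As the second factor has a countable base, an open preimage is a countable union of
  rectangles \<open>V I x I\<close> with \<open>V I\<close> the union of all admissible open
  sets.\<close>

lemma measurable_add_scaleR:
  fixes z :: "'e::real_normed_vector"
  shows "(\<lambda>(x, s). x + s *\<^sub>R z) \<in> measurable (borel \<Otimes>\<^sub>M (borel :: real measure)) borel"
proof (rule borel_measurableI)
  fix U :: "'e set" assume U: "open U"
  obtain \<B> :: "real set set" where \<B>: "countable \<B>" "topological_basis \<B>"
    using ex_countable_basis by blast
  have cont: "continuous_on UNIV (\<lambda>(x :: 'e, s :: real). x + s *\<^sub>R z)"
    by (auto simp: case_prod_beta intro!: continuous_intros)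
  define V where "V I = \<Union>{V. open V \<and> V \<times> I \<subseteq> (\<lambda>(x, s). x + s *\<^sub>R z) -` U}" for I
  have "(\<lambda>(x, s). x + s *\<^sub>R z) -` U = (\<Union>I\<in>\<B>. V I \<times> I)"
  proof (intro equalityI subsetI)
    fix p assume p: "p \<in> (\<lambda>(x, s). x + s *\<^sub>R z) -` U"
    have "open ((\<lambda>(x, s). x + s *\<^sub>R z) -` U)" using open_vimage[OF U cont] .
    then obtain A C where AC: "open A" "open C" "p \<in> A \<times> C" "A \<times> C \<subseteq> (\<lambda>(x, s). x + s *\<^sub>R z) -` U"
      using p by (rule open_prod_elim)
    obtain I where I: "I \<in> \<B>" "snd p \<in> I" "I \<subseteq> C"
      using topological_basisE[OF \<B>(2) AC(2), of "snd p"] AC(3) by (metis mem_Times_iff)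
    have "fst p \<in> V I" unfolding V_def using AC I(3) by (intro UnionI[of A]) auto
    then show "p \<in> (\<Union>I\<in>\<B>. V I \<times> I)" using I by (auto simp: mem_Times_iff)
  qed (auto simp: V_def)
  moreover have "(\<Union>I\<in>\<B>. V I \<times> I) \<in> sets (borel \<Otimes>\<^sub>M borel)"
  proof (intro sets.countable_UN' \<B>(1) image_subsetI pair_measureI)
    fix I assume "I \<in> \<B>"
    then show "I \<in> sets borel" using topological_basis_open[OF \<B>(2)] by auto
    have "open (V I)" unfolding V_def by auto
    then show "V I \<in> sets borel" by auto
  qed
  ultimately show "(\<lambda>(x, s). x + s *\<^sub>R z) -` U \<inter> space (borel \<Otimes>\<^sub>M borel) \<in> sets (borel \<Otimes>\<^sub>M borel)"
    by (simp add: space_pair_measure)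
qed

text \<open>The density is positive, so the null sets are those of Lebesgue measure, which is
  translation invariant.\<close>

lemma std_normal_null_translate:
  assumes B: "B \<in> sets borel" and null: "emeasure std_normal_distribution B = 0"
  shows "emeasure std_normal_distribution {s. s + c \<in> B} = 0"
proof -
  have "B \<in> null_sets (density lborel (\<lambda>x. ennreal (std_normal_density x)))"
    using assms by (auto simp: null_sets_def)
  then have "AE x in lborel. x \<notin> B"
    using normal_density_pos[of 1 0]
    by (subst (asm) null_sets_density_iff) (auto simp: ennreal_eq_0_iff linorder_not_le[symmetric])
  then have "AE x in distr lborel borel ((+) c). x \<notin> B" by (subst lborel_distr_plus)
  then have "AE x in lborel. c + x \<notin> B" by (subst (asm) AE_distr_iff) (use B in auto)
  then have "AE x in density lborel (\<lambda>x. ennreal (std_normal_density x)). x \<notin> {s. s + c \<in> B}"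
    by (subst AE_density) (auto simp: add.commute)
  moreover have "{s. s + c \<in> B} \<in> sets borel"
    using measurable_sets[of "\<lambda>s. s + c" borel borel B] B by (simp add: vimage_def)
  ultimately show ?thesis by (subst (asm) AE_iff_measurable) auto
qed

lemma tensor_op_apply: "tensor_op u k = (\<Sum>(h, x)\<leftarrow>u. (h \<bullet> k) *\<^sub>R x)"
  by (induction u) (auto simp: tensor_op_def blinfun.add_left)

lemma riesz_adjoint_tensor_op:
  fixes y :: "'e::real_normed_vector \<Rightarrow>\<^sub>L real" and u :: "('k::{real_inner,complete_space} \<times> 'e) list"
  shows "riesz_adjoint (tensor_op u) y = (\<Sum>(h, x)\<leftarrow>u. y x *\<^sub>R h)"
proof (rule riesz_adjoint_unique)
  show "(\<Sum>(h, x)\<leftarrow>u. y x *\<^sub>R h) \<bullet> k = y (tensor_op u k)" for k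
    unfolding tensor_op_apply
    by (induction u) (auto simp: inner_add_left blinfun.add_right blinfun.scaleR_right)
qed

text \<open>Assertions (i) and (iii) see the integrand only through \<open>R\<close> and
  \<open>X\<close>; the facts behind them are proved for an arbitrary bounded \<open>R\<close> with
  a version \<open>X\<close> of \<open>W(R)\<close>.\<close>

locale isonormal_integral = prob_space M for M :: "'w measure" +
  fixes W :: "'k::{real_inner,complete_space} \<Rightarrow> 'w \<Rightarrow> real"
    and R :: "'k \<Rightarrow>\<^sub>L 'e::real_normed_vector" and X :: "'w \<Rightarrow> 'e"
  assumes iso: "isonormal_process M W" and ext: "isonormal_extension M W R X"
begin

lemma W_measurable [measurable]: "W h \<in> borel_measurable M"
  and W_square_integrable: "integrable M (\<lambda>\<omega>. (W h \<omega>)\<^sup>2)"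
  and W_add: "AE \<omega> in M. W (g + h) \<omega> = W g \<omega> + W h \<omega>"
  and W_scaleR: "AE \<omega> in M. W (c *\<^sub>R h) \<omega> = c * W h \<omega>"
  and W_gaussian: "centred_gaussian M (W h)"
  and W_inner: "(\<integral>\<omega>. W g \<omega> * W h \<omega> \<partial>M) = g \<bullet> h"
  using iso unfolding isonormal_process_def by blast+

lemma W_diff: "AE \<omega> in M. W (g - h) \<omega> = W g \<omega> - W h \<omega>"
  using W_add[of g "(- 1) *\<^sub>R h"] W_scaleR[of "- 1" h] by eventually_elim simp

lemma W_norm: "(\<integral>\<^sup>+\<omega>. ennreal ((W h \<omega>)\<^sup>2) \<partial>M) = ennreal ((norm h)\<^sup>2)"
proof -
  have "(\<integral>\<^sup>+\<omega>. ennreal ((W h \<omega>)\<^sup>2) \<partial>M) = ennreal (\<integral>\<omega>. (W h \<omega>)\<^sup>2 \<partial>M)"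
    by (intro nn_integral_eq_integral W_square_integrable) auto
  also have "(\<integral>\<omega>. (W h \<omega>)\<^sup>2 \<partial>M) = (norm h)\<^sup>2"
    using W_inner[of h h] by (simp add: power2_eq_square power2_norm_eq_inner[unfolded power2_eq_square])
  finally show ?thesis .
qed

lemma X_strongly_measurable: "strongly_measurable M X"
  using ext by (auto simp: isonormal_extension_def square_integrable_def)

lemma X_measurable [measurable]: "X \<in> borel_measurable M"
  using X_strongly_measurable by (rule strongly_measurable_borel)

lemma functional_X_measurable [measurable]: "(\<lambda>\<omega>. blinfun_apply y (X \<omega>)) \<in> borel_measurable M"
  for y :: "'e \<Rightarrow>\<^sub>L real"
  by (rule measurable_blinfun_comp[OF X_measurable])

lemma functional_tensor:
  fixes y :: "'e \<Rightarrow>\<^sub>L real"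
  shows "AE \<omega> in M. y (\<Sum>(h, x)\<leftarrow>u. W h \<omega> *\<^sub>R x) = W (\<Sum>(h, x)\<leftarrow>u. y x *\<^sub>R h) \<omega>"
proof (induction u)
  case Nil
  \<comment> \<open>\<open>W\<close> is linear only almost surely, so even \<open>W 0 = 0\<close>
    comes from homogeneity with factor 0.\<close>
  then show ?case using W_scaleR[of 0 0] by eventually_elim simp
next
  case (Cons p u)
  obtain h x where p: "p = (h, x)" by (cases p)
  show ?case
    using Cons.IH W_add[of "y x *\<^sub>R h" "\<Sum>(h, x)\<leftarrow>u. y x *\<^sub>R h"] W_scaleR[of "y x" h]
    by eventually_elim (simp add: p blinfun.add_right blinfun.scaleR_right mult.commute)
qed

text \<open>The identity holds for finite tensors. In mean square it passes to the limit on the left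
  by convergence to \<open>X\<close>, on the right because the adjoints converge in norm and
  \<open>W\<close> is isometric.\<close>

theorem functional_X:
  fixes y :: "'e \<Rightarrow>\<^sub>L real"
  shows "AE \<omega> in M. y (X \<omega>) = W (riesz_adjoint R y) \<omega>"
proof -
  obtain u where u: "gamma_approx u R"
      "(\<lambda>n. \<integral>\<^sup>+\<omega>. ennreal ((norm (X \<omega> - (\<Sum>(h, x)\<leftarrow>u n. W h \<omega> *\<^sub>R x)))\<^sup>2) \<partial>M) \<longlonglongrightarrow> 0"
    using ext by (auto simp: isonormal_extension_def)
  define Y where "Y n \<omega> = (\<Sum>(h, x)\<leftarrow>u n. W h \<omega> *\<^sub>R x)" for n \<omega>
  define a where "a n = riesz_adjoint (tensor_op (u n)) y" for n
  define b where "b = riesz_adjoint R y"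
  have yY: "AE \<omega> in M. y (Y n \<omega>) = W (a n) \<omega>" for n
    unfolding Y_def a_def riesz_adjoint_tensor_op by (rule functional_tensor)
  have Ym: "strongly_measurable M (Y n)" for n
  proof -
    have "strongly_measurable M (\<lambda>\<omega>. \<Sum>(h, x)\<leftarrow>v. W h \<omega> *\<^sub>R x)" for v :: "('k \<times> 'e) list"
      by (induction v) (auto intro!: strongly_measurable_add strongly_measurable_scaleR
          strongly_measurable_const strongly_measurable_real)
    then show ?thesis by (simp add: Y_def[abs_def])
  qed
  have [measurable]: "(\<lambda>\<omega>. norm (X \<omega> - Y n \<omega>)) \<in> borel_measurable M" for n
    by (intro strongly_measurable_norm strongly_measurable_diff X_strongly_measurable Ym)
  have ab: "norm (a n - b) \<le> norm (tensor_op (u n) - R) * norm y" for n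
  proof -
    have "riesz_adjoint (tensor_op (u n) - R) y = a n - b"
      by (rule riesz_adjoint_unique)
        (simp add: a_def b_def inner_diff_left riesz_adjoint_inner blinfun.diff_left blinfun.diff_right)
    then show ?thesis using norm_riesz_adjoint_le[of "tensor_op (u n) - R" y] by simp
  qed
  have le: "(\<integral>\<^sup>+\<omega>. ennreal ((y (X \<omega>) - W b \<omega>)\<^sup>2) \<partial>M) \<le>
      ennreal (2 * (norm y)\<^sup>2) * (\<integral>\<^sup>+\<omega>. ennreal ((norm (X \<omega> - Y n \<omega>))\<^sup>2) \<partial>M) +
      2 * ennreal ((norm (tensor_op (u n) - R) * norm y)\<^sup>2)" for n
  proof -
    have "(\<integral>\<^sup>+\<omega>. ennreal ((y (X \<omega>) - W b \<omega>)\<^sup>2) \<partial>M) \<le>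
        (\<integral>\<^sup>+\<omega>. ennreal (2 * (norm y)\<^sup>2) * ennreal ((norm (X \<omega> - Y n \<omega>))\<^sup>2) + 2 * ennreal ((W (a n - b) \<omega>)\<^sup>2) \<partial>M)"
    proof (rule nn_integral_mono_AE)
      show "AE \<omega> in M. ennreal ((y (X \<omega>) - W b \<omega>)\<^sup>2) \<le>
          ennreal (2 * (norm y)\<^sup>2) * ennreal ((norm (X \<omega> - Y n \<omega>))\<^sup>2) + 2 * ennreal ((W (a n - b) \<omega>)\<^sup>2)"
        using yY[of n] W_diff[of "a n" b]
      proof eventually_elim
        case (elim \<omega>)
        \<comment> \<open>\<open>p\<close> is the error of approximating \<open>X\<close>,
          \<open>q\<close> the error of approximating the adjoint;
          \<open>(p + q)^2 <= 2 p^2 + 2 q^2\<close> separates them.\<close>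
        define p q where "p = y (X \<omega> - Y n \<omega>)" and "q = W (a n - b) \<omega>"
        have pq: "y (X \<omega>) - W b \<omega> = p + q" using elim by (simp add: p_def q_def blinfun.diff_right)
        have "\<bar>p\<bar> \<le> norm y * norm (X \<omega> - Y n \<omega>)" using norm_blinfun[of y "X \<omega> - Y n \<omega>"] by (simp add: p_def)
        then have "\<bar>p\<bar>\<^sup>2 \<le> (norm y * norm (X \<omega> - Y n \<omega>))\<^sup>2" by (intro power_mono) auto
        moreover have "(p + q)\<^sup>2 \<le> 2 * p\<^sup>2 + 2 * q\<^sup>2"
          using sum_squares_bound[of p q] by (simp add: power2_sum)
        ultimately have "(p + q)\<^sup>2 \<le> 2 * (norm y)\<^sup>2 * (norm (X \<omega> - Y n \<omega>))\<^sup>2 + 2 * q\<^sup>2"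
          by (simp add: power_mult_distrib)
        then have "ennreal ((p + q)\<^sup>2) \<le> ennreal (2 * (norm y)\<^sup>2 * (norm (X \<omega> - Y n \<omega>))\<^sup>2 + 2 * q\<^sup>2)"
          by (rule ennreal_leI)
        then show ?case unfolding pq q_def[symmetric] by (simp add: ennreal_plus ennreal_mult)
      qed
    qed
    also have "\<dots> = ennreal (2 * (norm y)\<^sup>2) * (\<integral>\<^sup>+\<omega>. ennreal ((norm (X \<omega> - Y n \<omega>))\<^sup>2) \<partial>M) +
        2 * ennreal ((norm (a n - b))\<^sup>2)"
      by (simp add: nn_integral_add nn_integral_cmult W_norm)
    also have "\<dots> \<le> ennreal (2 * (norm y)\<^sup>2) * (\<integral>\<^sup>+\<omega>. ennreal ((norm (X \<omega> - Y n \<omega>))\<^sup>2) \<partial>M) +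
        2 * ennreal ((norm (tensor_op (u n) - R) * norm y)\<^sup>2)"
      using ab[of n] by (intro add_left_mono mult_left_mono ennreal_leI power_mono) auto
    finally show ?thesis .
  qed
  have "(\<integral>\<^sup>+\<omega>. ennreal ((y (X \<omega>) - W b \<omega>)\<^sup>2) \<partial>M) \<le> ennreal (2 * (norm y)\<^sup>2) * 0 + 2 * ennreal 0"
  proof (rule LIMSEQ_le_const)
    have "(\<lambda>n. tensor_op (u n) - R) \<longlonglongrightarrow> 0"
      using u(1) by (simp add: gamma_approx_def LIM_zero)
    from tendsto_power[OF tendsto_mult[OF tendsto_norm[OF this] tendsto_const[of "norm y"]], of 2]
    have "(\<lambda>n. (norm (tensor_op (u n) - R) * norm y)\<^sup>2) \<longlonglongrightarrow> 0" by simp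
    then show "(\<lambda>n. ennreal (2 * (norm y)\<^sup>2) * (\<integral>\<^sup>+\<omega>. ennreal ((norm (X \<omega> - Y n \<omega>))\<^sup>2) \<partial>M) +
        2 * ennreal ((norm (tensor_op (u n) - R) * norm y)\<^sup>2)) \<longlonglongrightarrow> ennreal (2 * (norm y)\<^sup>2) * 0 + 2 * ennreal 0"
      using u(2) unfolding Y_def by (intro tendsto_add ennreal_tendsto_cmult tendsto_ennrealI) auto
  qed (use le in auto)
  then have "(\<integral>\<^sup>+\<omega>. ennreal ((y (X \<omega>) - W b \<omega>)\<^sup>2) \<partial>M) = 0" by simp
  then have "AE \<omega> in M. ennreal ((y (X \<omega>) - W b \<omega>)\<^sup>2) = 0"
    by (subst (asm) nn_integral_0_iff_AE) auto
  then show ?thesis by eventually_elim (simp add: b_def)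
qed

section \<open>Covariance and the reproducing kernel space\<close>

text \<open>By \<open>functional_X\<close> and the isometry the covariance of \<open>x X\<close> and
  \<open>y X\<close> is \<open>[R* x, R* y]\<close>, that is \<open>y\<close> at
  \<open>R R* x\<close>; functionals separate points, so the description has this unique
  solution.\<close>

lemma covariance_operator_eq: "blinfun_apply (covariance_operator M X) x = R (riesz_adjoint R x)"
proof -
  have bl: "bounded_linear (\<lambda>x. R (riesz_adjoint R x))"
  proof (rule bounded_linear_intro[where K = "norm R * norm R"])
    fix x :: "'e \<Rightarrow>\<^sub>L real"
    have "norm (R (riesz_adjoint R x)) \<le> norm R * norm (riesz_adjoint R x)" by (rule norm_blinfun)
    also have "\<dots> \<le> norm R * (norm R * norm x)" by (intro mult_left_mono norm_riesz_adjoint_le) auto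
    finally show "norm (R (riesz_adjoint R x)) \<le> norm x * (norm R * norm R)" by (simp add: mult_ac)
  qed (auto simp: riesz_adjoint_add riesz_adjoint_scaleR blinfun.add_right blinfun.scaleR_right)
  have cov: "(\<integral>\<omega>. x (X \<omega>) * y (X \<omega>) \<partial>M) = y (R (riesz_adjoint R x))" for x y :: "'e \<Rightarrow>\<^sub>L real"
  proof -
    have "(\<integral>\<omega>. x (X \<omega>) * y (X \<omega>) \<partial>M) = (\<integral>\<omega>. W (riesz_adjoint R x) \<omega> * W (riesz_adjoint R y) \<omega> \<partial>M)"
    proof (rule integral_cong_AE)
      show "AE \<omega> in M. x (X \<omega>) * y (X \<omega>) = W (riesz_adjoint R x) \<omega> * W (riesz_adjoint R y) \<omega>"
        using functional_X[of x] functional_X[of y] by eventually_elim simp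
    qed measurable
    also have "\<dots> = riesz_adjoint R y \<bullet> riesz_adjoint R x" unfolding W_inner by (rule inner_commute)
    finally show ?thesis unfolding riesz_adjoint_inner .
  qed
  have "covariance_operator M X = Blinfun (\<lambda>x. R (riesz_adjoint R x))"
    unfolding covariance_operator_def
  proof (rule the_equality)
    show "\<forall>x y. blinfun_apply y (blinfun_apply (Blinfun (\<lambda>x. R (riesz_adjoint R x))) x) =
        (\<integral>\<omega>. blinfun_apply x (X \<omega>) * blinfun_apply y (X \<omega>) \<partial>M)"
      by (simp add: bounded_linear_Blinfun_apply[OF bl] cov)
    fix Q :: "('e \<Rightarrow>\<^sub>L real) \<Rightarrow>\<^sub>L 'e"
    assume Q: "\<forall>x y. blinfun_apply y (blinfun_apply Q x) = (\<integral>\<omega>. blinfun_apply x (X \<omega>) * blinfun_apply y (X \<omega>) \<partial>M)"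
    have "Q x = R (riesz_adjoint R x)" for x
    proof (rule functionals_separate)
      show "blinfun_apply y (Q x) = blinfun_apply y (R (riesz_adjoint R x))" for y :: "'e \<Rightarrow>\<^sub>L real"
        using Q by (simp add: cov)
    qed
    then show "Q = Blinfun (\<lambda>x. R (riesz_adjoint R x))"
      by (intro blinfun_eqI) (simp add: bounded_linear_Blinfun_apply[OF bl])
  qed
  then show ?thesis by (simp add: bounded_linear_Blinfun_apply[OF bl])
qed

text \<open>The functional \<open>y \<mapsto> y z\<close> factors through \<open>R\<^sup>*\<close>, so that the Riesz sequence consists of \<open>R\<^sup>* v\<^sub>n\<close>.\<close>

lemma range_if_functional_bound:
  fixes z :: 'e
  assumes bnd: "\<And>y. \<bar>blinfun_apply y z\<bar> \<le> C * norm (riesz_adjoint R y)"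
  obtains v k where "(\<lambda>n. riesz_adjoint R (v n)) \<longlonglongrightarrow> k" "z = R k"
proof -
  obtain v :: "nat \<Rightarrow> 'e \<Rightarrow>\<^sub>L real" where
    v: "\<And>m n. riesz_adjoint R (v m + (- 1) *\<^sub>R v n) \<bullet> riesz_adjoint R (v m + (- 1) *\<^sub>R v n)
        \<le> 2 / real (Suc m) + 2 / real (Suc n)"
      "\<And>w. w \<in> UNIV \<Longrightarrow> (\<lambda>n. riesz_adjoint R (v n) \<bullet> riesz_adjoint R w) \<longlonglongrightarrow> blinfun_apply w z"
  proof (rule riesz_sequence[of UNIV "(+)" "scaleR" "\<lambda>x y. riesz_adjoint R x \<bullet> riesz_adjoint R y"
        "\<lambda>y. blinfun_apply y z" C])
    show "riesz_adjoint R x \<bullet> riesz_adjoint R y = riesz_adjoint R y \<bullet> riesz_adjoint R x" for x y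
      by (rule inner_commute)
    show "\<bar>y z\<bar> \<le> C * sqrt (riesz_adjoint R y \<bullet> riesz_adjoint R y)" for y :: "'e \<Rightarrow>\<^sub>L real"
      using bnd[of y] by (simp add: norm_eq_sqrt_inner)
  qed (auto simp: riesz_adjoint_add riesz_adjoint_scaleR inner_add_left blinfun.add_left blinfun.scaleR_left)
  have "Cauchy (\<lambda>n. riesz_adjoint R (v n))"
  proof (rule Cauchy_if_sq_dist)
    show "(dist (riesz_adjoint R (v m)) (riesz_adjoint R (v n)))\<^sup>2 \<le> 2 / real (Suc m) + 2 / real (Suc n)" for m n
      using v(1)[of m n] by (simp add: dist_norm power2_norm_eq_inner riesz_adjoint_diff)
  qed
  then obtain k where k: "(\<lambda>n. riesz_adjoint R (v n)) \<longlonglongrightarrow> k"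
    using Cauchy_convergent convergent_def by blast
  have "z = R k"
  proof (rule functionals_separate)
    fix w :: "'e \<Rightarrow>\<^sub>L real"
    have "w z = k \<bullet> riesz_adjoint R w"
      using LIMSEQ_unique[OF v(2) tendsto_inner[OF k tendsto_const]] by simp
    then show "w z = w (R k)" by (simp add: inner_commute[of k] riesz_adjoint_inner)
  qed
  with k that show ?thesis by blast
qed

text \<open>The kernel norm of \<open>R R* x\<close> is the norm of \<open>R* x\<close>, so Cauchy
  sequences for the kernel are Cauchy sequences of adjoints in a complete space, and
  \<open>R\<close> maps their limits to the elements of the kernel space.\<close>

theorem rkhs_covariance_eq_range: "rkhs (covariance_operator M X) = range R"
proof (intro equalityI subsetI)
  have norm_eq: "sqrt (blinfun_apply x (R (riesz_adjoint R x))) = norm (riesz_adjoint R x)" for x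
    using riesz_adjoint_inner[of R x "riesz_adjoint R x"] by (simp add: norm_eq_sqrt_inner)
  {
    fix z assume "z \<in> rkhs (covariance_operator M X)"
    then obtain x where x: "\<forall>\<epsilon>>0. \<exists>N. \<forall>m\<ge>N. \<forall>n\<ge>N. norm (riesz_adjoint R (x m - x n)) < \<epsilon>"
        "(\<lambda>n. R (riesz_adjoint R (x n))) \<longlonglongrightarrow> z"
      by (auto simp only: rkhs_def mem_Collect_eq norm_eq covariance_operator_eq)
    have "Cauchy (\<lambda>n. riesz_adjoint R (x n))"
      using x(1) by (auto simp: Cauchy_def dist_norm riesz_adjoint_diff)
    then obtain k where "(\<lambda>n. riesz_adjoint R (x n)) \<longlonglongrightarrow> k"
      using Cauchy_convergent convergent_def by blast
    then have "z = R k"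
      by (intro LIMSEQ_unique[OF x(2)] blinfun.tendsto tendsto_const)
    then show "z \<in> range R" by blast
  next
    fix z assume "z \<in> range R"
    then obtain k0 where k0: "z = R k0" by auto
    have "\<bar>y z\<bar> \<le> norm k0 * norm (riesz_adjoint R y)" for y :: "'e \<Rightarrow>\<^sub>L real"
      using Cauchy_Schwarz_ineq2[of "riesz_adjoint R y" k0]
      by (simp add: k0 riesz_adjoint_inner mult.commute)
    \<comment> \<open>\<open>k0\<close> may have a component in the kernel of \<open>R\<close> and
      then is no limit of adjoints; it is exchanged for a preimage \<open>k\<close> of
      \<open>z\<close> that is one.\<close>
    then obtain v k where v: "(\<lambda>n. riesz_adjoint R (v n)) \<longlonglongrightarrow> k" "z = R k"
      by (rule range_if_functional_bound)
    have "Cauchy (\<lambda>n. riesz_adjoint R (v n))" using v(1) by (rule LIMSEQ_imp_Cauchy)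
    then show "z \<in> rkhs (covariance_operator M X)"
      unfolding rkhs_def covariance_operator_eq norm_eq
      using blinfun.tendsto[OF tendsto_const v(1), of R] v(2)
      by (auto simp: Cauchy_def dist_norm riesz_adjoint_diff intro!: exI[of _ v])
  }
qed

section \<open>Gaussian laws and null sets under translation\<close>

text \<open>The second moment is 1, which excludes the degenerate branch and forces
  \<open>\<sigma> = 1\<close>.\<close>

lemma W_unit_distribution:
  assumes "norm k = 1"
  shows "distr M borel (W k) = std_normal_distribution"
proof -
  have sq: "(\<integral>\<omega>. (W k \<omega>)\<^sup>2 \<partial>M) = 1"
    using W_inner[of k k] assms by (simp add: power2_eq_square norm_eq_sqrt_inner)
  obtain \<sigma> where \<sigma>: "\<sigma> \<ge> 0" and law: "distr M borel (W k) =
      (if \<sigma> = 0 then return borel 0 else density lborel (\<lambda>x. ennreal (normal_density 0 \<sigma> x)))"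
    using W_gaussian[of k] unfolding centred_gaussian_def by blast
  have sq': "(\<integral>x. x\<^sup>2 \<partial>distr M borel (W k)) = 1" using sq by (subst integral_distr) auto
  have "\<sigma> \<noteq> 0"
  proof
    assume "\<sigma> = 0"
    then have "(\<integral>x. x\<^sup>2 \<partial>(return borel (0 :: real))) = (1 :: real)" using sq' law by simp
    then show False by (subst (asm) integral_return) auto
  qed
  then have pos: "\<sigma> > 0" and law': "distr M borel (W k) = density lborel (\<lambda>x. ennreal (normal_density 0 \<sigma> x))"
    using \<sigma> law by auto
  have D: "distributed M lborel (W k) (normal_density 0 \<sigma>)"
    unfolding distributed_def using law' by (auto cong: distr_cong)
  have "expectation (W k) = 0" using normal_distributed_expectation[OF pos D] .
  with normal_distributed_variance[OF pos D] sq have "\<sigma>\<^sup>2 = 1" by simp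
  with pos have "\<sigma> = 1" by (simp add: power2_eq_1_iff)
  with law' show ?thesis by simp
qed

lemma W_fourier: "(\<integral>\<omega>. iexp (W h \<omega>) \<partial>M) = complex_of_real (exp (- ((norm h)\<^sup>2) / 2))"
proof -
  \<comment> \<open>For \<open>h = 0\<close> a unit vector \<open>k\<close> need not exist, as the
    Hilbert space may be trivial.\<close>
  obtain k :: 'k and c where h: "h = c *\<^sub>R k" and "norm k = 1 \<or> h = 0" and c: "c = norm h"
  proof (cases "h = 0")
    case False
    then show ?thesis using that[of "norm h" "h /\<^sub>R norm h"] by simp
  qed (use that[of 0 0] in auto)
  show ?thesis
  proof (cases "h = 0")
    case True
    have "(\<integral>\<omega>. iexp (W h \<omega>) \<partial>M) = (\<integral>\<omega>. 1 \<partial>M)"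
    proof (rule integral_cong_AE)
      show "AE \<omega> in M. iexp (W h \<omega>) = 1"
        using W_scaleR[of 0 h] by eventually_elim (simp add: True)
    qed auto
    then show ?thesis using True by (simp add: prob_space)
  next
    case False
    then have k: "norm k = 1" using \<open>norm k = 1 \<or> h = 0\<close> by simp
    have "(\<integral>\<omega>. iexp (W h \<omega>) \<partial>M) = (\<integral>\<omega>. iexp (c * W k \<omega>) \<partial>M)"
    proof (rule integral_cong_AE)
      show "AE \<omega> in M. iexp (W h \<omega>) = iexp (c * W k \<omega>)"
        using W_scaleR[of c k] by eventually_elim (simp add: h)
    qed auto
    also have "\<dots> = char (distr M borel (W k)) c"
      unfolding char_def by (subst integral_distr) auto
    also have "\<dots> = complex_of_real (exp (- (c\<^sup>2) / 2))"
      by (simp add: W_unit_distribution[OF k] char_std_normal_distribution)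
    finally show ?thesis by (simp add: c)
  qed
qed

text \<open>Subtracting its component along the unit vector \<open>k\<close> makes \<open>X\<close> independent of \<open>W k\<close>, which has a
  density; hence conditionally on the difference, a translation along \<open>R k\<close> preserves null sets.\<close>

lemma translate_unit_null:
  assumes k: "norm k = 1" and A[measurable]: "A \<in> sets borel"
    and null: "emeasure (distr M borel X) A = 0"
  shows "emeasure (distr M borel (\<lambda>\<omega>. c *\<^sub>R R k + X \<omega>)) A = 0"
proof -
  define Y where "Y \<omega> = X \<omega> - W k \<omega> *\<^sub>R R k" for \<omega>
  have Y: "strongly_measurable M Y"
    unfolding Y_def by (intro strongly_measurable_diff strongly_measurable_scaleR X_strongly_measurable
        strongly_measurable_const strongly_measurable_real W_measurable)
  have Yb: "Y \<in> borel_measurable M" using Y by (rule strongly_measurable_borel)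
  have [measurable]: "(\<lambda>\<omega>. u (Y \<omega>)) \<in> borel_measurable M" for u :: "'e \<Rightarrow>\<^sub>L real"
    using Yb by (rule measurable_blinfun_comp)
  \<comment> \<open>The component of the adjoint orthogonal to \<open>k\<close>:
    \<open>y (Y \<omega>)\<close> is \<open>W (p y) \<omega>\<close> almost surely, and
    orthogonality makes the Gaussian characteristic functions factor.\<close>
  define p where "p y = riesz_adjoint R y - (riesz_adjoint R y \<bullet> k) *\<^sub>R k" for y
  have kk: "k \<bullet> k = 1" using k by (simp add: norm_eq_sqrt_inner)
  have pk: "p y \<bullet> k = 0" for y by (simp add: p_def inner_diff_left kk)
  have yY: "AE \<omega> in M. y (Y \<omega>) = W (p y) \<omega>" for y :: "'e \<Rightarrow>\<^sub>L real"
    using functional_X[of y] W_diff[of "riesz_adjoint R y" "(riesz_adjoint R y \<bullet> k) *\<^sub>R k"]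
      W_scaleR[of "riesz_adjoint R y \<bullet> k" k]
    by eventually_elim (simp add: Y_def p_def blinfun.diff_right blinfun.scaleR_right riesz_adjoint_inner mult.commute)
  have joint: "distr M borel Y \<Otimes>\<^sub>M distr M borel (W k) = distr M (borel \<Otimes>\<^sub>M borel) (\<lambda>\<omega>. (Y \<omega>, W k \<omega>))"
  proof (rule joint_distribution_if_fourier[OF Y W_measurable])
    fix y :: "'e \<Rightarrow>\<^sub>L real" and s :: real
    have "(\<integral>\<omega>. iexp (y (Y \<omega>)) * iexp (s * W k \<omega>) \<partial>M) = (\<integral>\<omega>. iexp (W (p y + s *\<^sub>R k) \<omega>) \<partial>M)"
    proof (rule integral_cong_AE)
      show "AE \<omega> in M. iexp (y (Y \<omega>)) * iexp (s * W k \<omega>) = iexp (W (p y + s *\<^sub>R k) \<omega>)"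
        using yY[of y] W_add[of "p y" "s *\<^sub>R k"] W_scaleR[of s k]
        by eventually_elim (simp add: distrib_left exp_add)
    qed auto
    also have "\<dots> = complex_of_real (exp (- ((norm (p y))\<^sup>2 + (norm (s *\<^sub>R k))\<^sup>2) / 2))"
    proof -
      have "(norm (p y + s *\<^sub>R k))\<^sup>2 = (norm (p y))\<^sup>2 + (norm (s *\<^sub>R k))\<^sup>2"
        using pk[of y] inner_commute[of k "p y"]
        by (simp add: power2_norm_eq_inner inner_add_left inner_add_right del: norm_scaleR)
      then show ?thesis by (simp add: W_fourier)
    qed
    also have "\<dots> = (\<integral>\<omega>. iexp (W (p y) \<omega>) \<partial>M) * (\<integral>\<omega>. iexp (W (s *\<^sub>R k) \<omega>) \<partial>M)"
    proof -
      have "exp (- (a + b) / 2) = exp (- a / 2) * exp (- b / 2)" for a b :: real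
        by (subst exp_add[symmetric]) (simp add: field_simps)
      then show ?thesis unfolding W_fourier by (simp only: of_real_mult)
    qed
    also have "(\<integral>\<omega>. iexp (W (p y) \<omega>) \<partial>M) = (\<integral>\<omega>. iexp (y (Y \<omega>)) \<partial>M)"
    proof (rule integral_cong_AE)
      show "AE \<omega> in M. iexp (W (p y) \<omega>) = iexp (y (Y \<omega>))" using yY[of y] by eventually_elim simp
    qed auto
    also have "(\<integral>\<omega>. iexp (W (s *\<^sub>R k) \<omega>) \<partial>M) = (\<integral>\<omega>. iexp (s * W k \<omega>) \<partial>M)"
    proof (rule integral_cong_AE)
      show "AE \<omega> in M. iexp (W (s *\<^sub>R k) \<omega>) = iexp (s * W k \<omega>)"
        using W_scaleR[of s k] by eventually_elim simp
    qed auto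
    finally show "(\<integral>\<omega>. iexp (y (Y \<omega>)) * iexp (s * W k \<omega>) \<partial>M) =
        (\<integral>\<omega>. iexp (y (Y \<omega>)) \<partial>M) * (\<integral>\<omega>. iexp (s * W k \<omega>) \<partial>M)" .
  qed
  interpret DZ: prob_space "distr M borel (W k)" by (rule prob_space_distr) simp
  have YZ: "(\<lambda>\<omega>. (Y \<omega>, W k \<omega>)) \<in> measurable M (borel \<Otimes>\<^sub>M borel)"
    using Yb W_measurable by (rule measurable_Pair)
  \<comment> \<open>As \<open>X = Y + W(k) R k\<close>, this is the event of the translate by
    \<open>d R k\<close> in terms of the pair of \<open>Y\<close> and \<open>W k\<close>.\<close>
  define C where "C d = (\<lambda>(x, s). x + s *\<^sub>R R k) -` {x. d *\<^sub>R R k + x \<in> A}" for d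
  have shift: "{x. d *\<^sub>R R k + x \<in> A} \<in> sets borel" for d
  proof -
    have "(\<lambda>x. d *\<^sub>R R k + x) \<in> borel_measurable borel"
      by (intro borel_measurable_continuous_onI continuous_intros)
    from measurable_sets[OF this A] show ?thesis by (simp add: vimage_def)
  qed
  have C: "C d \<in> sets (borel \<Otimes>\<^sub>M borel)" for d
    using measurable_sets[OF measurable_add_scaleR shift, of "R k" d] by (simp add: C_def space_pair_measure)
  have law: "emeasure (distr M borel (\<lambda>\<omega>. d *\<^sub>R R k + X \<omega>)) A =
      (\<integral>\<^sup>+x. emeasure (distr M borel (W k)) (Pair x -` C d) \<partial>distr M borel Y)" for d
  proof -
    have Xd: "(\<lambda>\<omega>. d *\<^sub>R R k + X \<omega>) \<in> borel_measurable M"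
      by (intro strongly_measurable_borel strongly_measurable_add strongly_measurable_const X_strongly_measurable)
    have "emeasure (distr M borel (\<lambda>\<omega>. d *\<^sub>R R k + X \<omega>)) A = emeasure (distr M (borel \<Otimes>\<^sub>M borel) (\<lambda>\<omega>. (Y \<omega>, W k \<omega>))) (C d)"
      using Xd YZ C[of d] A
      by (auto simp: emeasure_distr C_def Y_def intro!: arg_cong[where f = "emeasure M"])
    also have "\<dots> = (\<integral>\<^sup>+x. emeasure (distr M borel (W k)) (Pair x -` C d) \<partial>distr M borel Y)"
      unfolding joint[symmetric]
      by (rule DZ.emeasure_pair_measure_alt) (use C[of d] in \<open>simp cong: sets_pair_measure_cong\<close>)
    finally show ?thesis .
  qed
  have slice: "Pair x -` C d \<in> sets borel" for x d
    using sets_Pair1[OF C] by simp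
  have "(\<integral>\<^sup>+x. emeasure (distr M borel (W k)) (Pair x -` C 0) \<partial>distr M borel Y) = 0"
    using law[of 0] null by simp
  moreover have meas: "(\<lambda>x. emeasure (distr M borel (W k)) (Pair x -` C d)) \<in> borel_measurable (distr M borel Y)" for d
    by (rule DZ.measurable_emeasure_Pair) (use C[of d] in \<open>simp cong: sets_pair_measure_cong\<close>)
  ultimately have "AE x in distr M borel Y. emeasure (distr M borel (W k)) (Pair x -` C 0) = 0"
    using nn_integral_0_iff_AE by blast
  then have "AE x in distr M borel Y. emeasure (distr M borel (W k)) (Pair x -` C c) = 0"
  proof eventually_elim
    case (elim x)
    \<comment> \<open>Translating \<open>X\<close> by \<open>c R k\<close> only shifts each slice by
      \<open>c\<close> on the real line, where the normal law preserves null sets.\<close>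
    have "Pair x -` C c = {s. s + c \<in> Pair x -` C 0}" by (auto simp: C_def algebra_simps)
    with std_normal_null_translate[OF slice, of x 0 c] elim show ?case
      by (simp add: W_unit_distribution[OF k])
  qed
  then have "(\<integral>\<^sup>+x. emeasure (distr M borel (W k)) (Pair x -` C c) \<partial>distr M borel Y) = 0"
    using meas by (subst nn_integral_0_iff_AE) auto
  then show ?thesis unfolding law .
qed

theorem translate_range_absolutely_continuous:
  assumes z: "z \<in> range R" "z' \<in> range R"
  shows "absolutely_continuous (distr M borel (\<lambda>\<omega>. z + X \<omega>)) (distr M borel (\<lambda>\<omega>. z' + X \<omega>))"
  unfolding absolutely_continuous_def
proof
  have tr: "(\<lambda>\<omega>. w + X \<omega>) \<in> borel_measurable M" for w
    by (intro strongly_measurable_borel strongly_measurable_add strongly_measurable_const X_strongly_measurable)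
  fix A assume "A \<in> null_sets (distr M borel (\<lambda>\<omega>. z + X \<omega>))"
  then have A: "A \<in> sets borel" and null: "emeasure (distr M borel (\<lambda>\<omega>. z + X \<omega>)) A = 0" by auto
  obtain k0 where k0: "z' - z = R k0"
    using z by (auto simp flip: blinfun.diff_right)
  \<comment> \<open>Moving the test set by \<open>z\<close> reduces the comparison to
    \<open>X\<close> itself and its translate by \<open>z' - z\<close>.\<close>
  define A' where "A' = {x. z + x \<in> A}"
  have A': "A' \<in> sets borel"
  proof -
    have "(\<lambda>x. z + x) \<in> borel_measurable borel" by (intro borel_measurable_continuous_onI continuous_intros)
    from measurable_sets[OF this A] show ?thesis by (simp add: A'_def vimage_def)
  qed
  have eq: "emeasure (distr M borel (\<lambda>\<omega>. w + X \<omega>)) A' = emeasure (distr M borel (\<lambda>\<omega>. (z + w) + X \<omega>)) A" for w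
    using tr A A' by (auto simp: emeasure_distr A'_def add.assoc intro!: arg_cong[where f = "emeasure M"])
  have null': "emeasure (distr M borel X) A' = 0" using eq[of 0] null by simp
  have "emeasure (distr M borel (\<lambda>\<omega>. R k0 + X \<omega>)) A' = 0"
  proof (cases "k0 = 0")
    case False
    then have "norm (k0 /\<^sub>R norm k0) = 1" by simp
    from translate_unit_null[OF this A' null', of "norm k0"] False show ?thesis
      by (simp flip: blinfun.scaleR_right)
  qed (use null' in simp)
  then have "emeasure (distr M borel (\<lambda>\<omega>. z' + X \<omega>)) A = 0" using eq[of "R k0"] k0[symmetric] by simp
  then show "A \<in> null_sets (distr M borel (\<lambda>\<omega>. z' + X \<omega>))" using A by auto
qed

theorem range_if_translate_absolutely_continuous:
  assumes ac: "absolutely_continuous (distr M borel X) (distr M borel (\<lambda>\<omega>. z + X \<omega>))"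
  shows "z \<in> range R"
proof (rule ccontr)
  assume z: "z \<notin> range R"
  \<comment> \<open>If no such \<open>y\<close> existed, rescaling to \<open>y z = 1\<close> would
    give the bound of \<open>range_if_functional_bound\<close> with constant
    \<open>1 / \<epsilon>\<close>, placing \<open>z\<close> in the range.\<close>
  have "\<exists>y :: 'e \<Rightarrow>\<^sub>L real. blinfun_apply y z = 1 \<and> norm (riesz_adjoint R y) < \<epsilon>" if \<epsilon>: "\<epsilon> > 0" for \<epsilon>
  proof (rule ccontr)
    assume neg: "\<not> ?thesis"
    have "\<bar>y z\<bar> \<le> (1 / \<epsilon>) * norm (riesz_adjoint R y)" for y :: "'e \<Rightarrow>\<^sub>L real"
    proof (cases "y z = 0")
      case False
      have "\<epsilon> \<le> norm (riesz_adjoint R ((1 / y z) *\<^sub>R y))"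
        using neg False by (force simp: blinfun.scaleR_left not_less)
      also have "\<dots> = norm (riesz_adjoint R y) / \<bar>y z\<bar>" by (simp add: riesz_adjoint_scaleR)
      finally show ?thesis using \<epsilon> False by (simp add: field_simps)
    qed (use \<epsilon> in simp)
    then show False using range_if_functional_bound[of z "1 / \<epsilon>"] z by blast
  qed
  \<comment> \<open>With this rate the second moments of \<open>y n X\<close> are at most
    \<open>4^-n\<close>, so the sum of squares has finite expectation and its terms tend to 0 almost
    surely.\<close>
  then have "\<exists>y :: 'e \<Rightarrow>\<^sub>L real. blinfun_apply y z = 1 \<and> norm (riesz_adjoint R y) < (1/2) ^ n" for n by simp
  then obtain y :: "nat \<Rightarrow> 'e \<Rightarrow>\<^sub>L real" where y: "\<And>n. y n z = 1" "\<And>n. norm (riesz_adjoint R (y n)) < (1/2) ^ n"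
    by metis
  define A where "A = {x. (\<lambda>n. y n x) \<longlonglongrightarrow> 0}"
  have [measurable]: "(\<lambda>x. y n x) \<in> borel_measurable borel" for n
    by (intro measurable_blinfun_comp) simp
  have "{x \<in> space borel. (\<lambda>n. y n x) \<longlonglongrightarrow> 0} \<in> sets borel"
    by measurable
  then have A[measurable]: "A \<in> sets borel" by (simp add: A_def)
  have "AE \<omega> in M. X \<omega> \<in> A"
  proof -
    have "(\<integral>\<^sup>+\<omega>. (\<Sum>n. ennreal ((W (riesz_adjoint R (y n)) \<omega>)\<^sup>2)) \<partial>M) = (\<Sum>n. ennreal ((norm (riesz_adjoint R (y n)))\<^sup>2))"
      by (subst nn_integral_suminf) (auto simp: W_norm)
    also have "\<dots> \<le> (\<Sum>n. ennreal ((1/4) ^ n))"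
    proof (intro suminf_le ennreal_leI)
      fix n
      have "(norm (riesz_adjoint R (y n)))\<^sup>2 \<le> ((1/2) ^ n)\<^sup>2" using y(2)[of n] by (intro power_mono) auto
      also have "((1/2::real) ^ n)\<^sup>2 = (1/4) ^ n" by (simp add: power2_eq_square flip: power_mult_distrib)
      finally show "(norm (riesz_adjoint R (y n)))\<^sup>2 \<le> (1/4) ^ n" .
    qed auto
    also have "\<dots> = ennreal (\<Sum>n. (1/4) ^ n)" by (intro suminf_ennreal2 summable_geometric) auto
    also have "\<dots> < \<infinity>" by simp
    finally have "AE \<omega> in M. (\<Sum>n. ennreal ((W (riesz_adjoint R (y n)) \<omega>)\<^sup>2)) \<noteq> \<infinity>"
      by (intro nn_integral_PInf_AE) auto
    moreover have "AE \<omega> in M. \<forall>n. y n (X \<omega>) = W (riesz_adjoint R (y n)) \<omega>"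
      using functional_X by (subst AE_all_countable) auto
    ultimately show ?thesis
    proof eventually_elim
      case (elim \<omega>)
      have "summable (\<lambda>n. (W (riesz_adjoint R (y n)) \<omega>)\<^sup>2)"
        using elim(1) by (intro summable_suminf_not_top) auto
      from tendsto_real_sqrt[OF summable_LIMSEQ_zero[OF this]]
      have "(\<lambda>n. \<bar>y n (X \<omega>)\<bar>) \<longlonglongrightarrow> 0" using elim(2) by simp
      then show ?case by (simp add: A_def tendsto_rabs_zero_iff)
    qed
  qed
  then have AX: "AE x in distr M borel X. x \<in> A" by (subst AE_distr_iff) (auto simp: A)
  have tr: "(\<lambda>\<omega>. z + X \<omega>) \<in> borel_measurable M"
    by (intro strongly_measurable_borel strongly_measurable_add strongly_measurable_const X_strongly_measurable)
  have "- A \<in> null_sets (distr M borel X)"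
    using AX A by (subst (asm) AE_iff_null_sets[symmetric, of "- A", simplified]) auto
  then have "- A \<in> null_sets (distr M borel (\<lambda>\<omega>. z + X \<omega>))" using ac by (auto simp: absolutely_continuous_def)
  then have "AE x in distr M borel (\<lambda>\<omega>. z + X \<omega>). x \<in> A"
    using AE_not_in by fastforce
  then have "AE \<omega> in M. z + X \<omega> \<in> A" using tr by (subst (asm) AE_distr_iff) (auto simp: A)
  with \<open>AE \<omega> in M. X \<omega> \<in> A\<close> have "AE \<omega> in M. False"
  proof eventually_elim
    case (elim \<omega>)
    \<comment> \<open>Since \<open>y n z = 1\<close>, a point of \<open>A\<close> whose translate by
      \<open>z\<close> is also in \<open>A\<close> would make the constant sequence 1 tend to
      0.\<close>
    then have "(\<lambda>n. y n (X \<omega>)) \<longlonglongrightarrow> 0" "(\<lambda>n. 1 + y n (X \<omega>)) \<longlonglongrightarrow> 0"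
      by (auto simp: A_def blinfun.add_right y(1))
    from tendsto_diff[OF this(2,1)] show ?case by (simp add: LIMSEQ_const_iff)
  qed
  then show False by simp
qed

end

theorem theorem2p11:
  fixes T :: real
    and j :: "(real \<Rightarrow> 'h::{real_inner,complete_space}) \<Rightarrow> 'k::{real_inner,complete_space}"
    and M :: "'w measure"
    and W :: "'k \<Rightarrow> 'w \<Rightarrow> real"
    and domA :: "'e::banach set"
    and A :: "'e \<Rightarrow> 'e"
    and S :: "real \<Rightarrow> 'e \<Rightarrow>\<^sub>L 'e"
    and B :: "'h \<Rightarrow>\<^sub>L 'e"
    and X :: "'w \<Rightarrow> 'e"
  assumes "0 < T"
    and "L2_dense_inclusion T j"
    and "prob_space M"
    and "isonormal_process M W"
    and "generates domA A S"
    and "stochastically_integrable T j (\<lambda>t. S (T - t) o\<^sub>L B)"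
    and "is_stochastic_integral M W T j (\<lambda>t. S (T - t) o\<^sub>L B) X"
  shows "(range (S T) \<subseteq> rkhs (covariance_operator M X)
      \<longleftrightarrow> (\<forall>x0. null_controllable S B T (L2_dual T j) x0))
    \<and> ((\<forall>x0. null_controllable S B T (L2_dual T j) x0)
      \<longleftrightarrow> (\<forall>x0 y0. mutually_absolutely_continuous
            (distr M borel (\<lambda>\<omega>. S T x0 + X \<omega>)) (distr M borel (\<lambda>\<omega>. S T y0 + X \<omega>))))"
proof -
  obtain R where R: "represents T j (\<lambda>t. S (T - t) o\<^sub>L B) R" and ext: "isonormal_extension M W R X"
    using assms(7) by (auto simp: is_stochastic_integral_def)
  interpret prob_space M by fact
  interpret isonormal_integral M W R X using assms(4) ext by unfold_locales
  have S: "C0_semigroup S" using assms(5) by (simp add: generates_def)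
  have orb: "(\<lambda>t. riesz_adjoint (S (T - t) o\<^sub>L B) y) \<in> L2 T" for y
    using assms(6) by (simp add: stochastically_integrable_def)
  have control: "(\<forall>x0. null_controllable S B T (L2_dual T j) x0) \<longleftrightarrow> range (S T) \<subseteq> range R"
    using null_controllable_iff[OF assms(1,2) S orb R] by blast
  have "(\<forall>x0 y0. mutually_absolutely_continuous
      (distr M borel (\<lambda>\<omega>. S T x0 + X \<omega>)) (distr M borel (\<lambda>\<omega>. S T y0 + X \<omega>))) \<longleftrightarrow> range (S T) \<subseteq> range R"
  proof
    assume "range (S T) \<subseteq> range R"
    then show "\<forall>x0 y0. mutually_absolutely_continuous
        (distr M borel (\<lambda>\<omega>. S T x0 + X \<omega>)) (distr M borel (\<lambda>\<omega>. S T y0 + X \<omega>))"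
      unfolding mutually_absolutely_continuous_def
      by (intro allI conjI translate_range_absolutely_continuous) auto
  next
    assume mac: "\<forall>x0 y0. mutually_absolutely_continuous
        (distr M borel (\<lambda>\<omega>. S T x0 + X \<omega>)) (distr M borel (\<lambda>\<omega>. S T y0 + X \<omega>))"
    show "range (S T) \<subseteq> range R"
    proof safe
      fix x0
      \<comment> \<open>The initial value 0 gives the law of \<open>X\<close> itself, with which all
        others are compared.\<close>
      have "absolutely_continuous (distr M borel (\<lambda>\<omega>. S T 0 + X \<omega>)) (distr M borel (\<lambda>\<omega>. S T x0 + X \<omega>))"
        using mac unfolding mutually_absolutely_continuous_def by blast
      then show "S T x0 \<in> range R"
        by (intro range_if_translate_absolutely_continuous) simp
    qed
  qed
  with control show ?thesis by (simp add: rkhs_covariance_eq_range)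
qed


end
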